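(* Let $M$ be a smooth manifold of dimension $n\ge 3$ equipped with a pseudo-Riemannian conformal structure (of any signature), and let $\tau_k$ denote its $k$-th conformal Pontrjagin (character) form, i.e. the $k$-th Pontrjagin character form of the standard conformal tractor connection. Then for every $k\ge 1$ the de Rham class $[\tau_k]\in H^{4k}(M)$ equals $\mathrm{ph}_k(TM)$, the $k$-th Pontrjagin character class of the tangent bundle.
   Context: Character forms. For a vector bundle $\mathcal V$ and an $\mathrm{End}(\mathcal V)$-valued 2-form $F$, let $s_{j}(F)=\mathrm{Tr}(F F\cdots F)$ ($j$ factors), where the product composes endomorphisms and wedges the form parts; this is a $2j$-form. For a connection $D$ on a real vector bundle $\mathcal V$, with curvature $F^D$ (viewed on the complexification), the $k$-th Pontrjagin (character) form is the closed real $4k$-form $$p_k^D=\frac{1}{(2k)!}\,s_{2k}\!\left(\frac{-1}{2\pi\sqrt{-1}}F^D\right).$$ Its de Rham class is independent of the connection $D$, and is the $k$-th Pontrjagin character class $\mathrm{ph}_k(\mathcal V)$ (that is, the $2k$-th Chern character class of $\mathcal V\otimes\mathbb C$). Tractor connection. Let $\mathcal E[w]$ be the bundle of conformal densities of weight $w$ (normalised so that $(-n)$-densities are integrable), let $\boldsymbol g\in S^2T^*M\otimes\mathcal E[2]$ be the conformal metric, used to raise and lower indices. For a metric $g$ in the conformal class let $\nabla$ be its Levi-Civita connection (also on densities) and $\mathsf P=\frac{1}{n-2}(\mathrm{Ric}-\mathsf J g)$ its Schouten tensor, $\mathsf J=\mathrm{tr}_g\mathsf P=\mathrm{Scal}/(2(n-1))$.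 The standard tractor bundle $\mathbb T$ is the real rank $n+2$ bundle which for each $g$ in the conformal class is identified with $\mathcal E[1]\oplus (T^*M\otimes\mathcal E[1])\oplus\mathcal E[-1]$, where under $\hat g=e^{2\omega}g$, with $\Upsilon=d\omega$, the triples are identified by $(\sigma,\mu_a,\rho)\mapsto(\sigma,\ \mu_a+\Upsilon_a\sigma,\ \rho-\Upsilon^b\mu_b-\tfrac12\Upsilon^b\Upsilon_b\sigma)$. The (conformally invariant) tractor connection is $$\nabla_a(\sigma,\mu_b,\rho)=(\nabla_a\sigma-\mu_a,\ \nabla_a\mu_b+\boldsymbol g_{ab}\rho+\mathsf P_{ab}\sigma,\ \nabla_a\rho-\mathsf P_{ab}\mu^b).$$ Let $\Omega$ be its curvature. The $k$-th conformal Pontrjagin (character) form is $\tau_k=\frac{1}{(2k)!}s_{2k}\!\left(\frac{-1}{2\pi\sqrt{-1}}\Omega\right)$. *)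

theory Defs
  imports "HOL-Analysis.Analysis" "HOL-Combinatorics.Permutations"
begin

section \<open>Smooth functions and smooth manifolds\<close>

text \<open>\<open>S\<close> is meant to be an open subset of a finite-dimensional space.\<close>

primrec Ck_on :: "nat \<Rightarrow> ('a::real_normed_vector \<Rightarrow> 'b::real_normed_vector) \<Rightarrow> 'a set \<Rightarrow> bool" where
  "Ck_on 0 f S \<longleftrightarrow> continuous_on S f"
| "Ck_on (Suc k) f S \<longleftrightarrow>
     (\<forall>x\<in>S. f differentiable (at x)) \<and> (\<forall>v. Ck_on k (\<lambda>x. frechet_derivative f (at x) v) S)"

definition smooth_on :: "('a::real_normed_vector \<Rightarrow> 'b::real_normed_vector) \<Rightarrow> 'a set \<Rightarrow> bool" where
  "smooth_on f S \<longleftrightarrow> (\<forall>k. Ck_on k f S)"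

definition pd :: "'n \<Rightarrow> (real^'n \<Rightarrow> real) \<Rightarrow> real^'n \<Rightarrow> real" where
  "pd a f x = frechet_derivative f (at x) (axis a 1)"

text \<open>The manifold is the whole type \<open>'m\<close>, and a chart is a pair of its domain and its coordinate
  map. All local objects below (components of metrics, forms, connections) are functions of the
  coordinates, and only their values on the image of the chart are meaningful.\<close>

type_synonym ('m, 'n) chart = "'m set \<times> ('m \<Rightarrow> real^'n)"

abbreviation dom :: "('m, 'n) chart \<Rightarrow> 'm set" where "dom c \<equiv> fst c"
abbreviation coord :: "('m, 'n) chart \<Rightarrow> 'm \<Rightarrow> real^'n" where "coord c \<equiv> snd c"
abbreviation img :: "('m, 'n) chart \<Rightarrow> (real^'n) set" where "img c \<equiv> coord c ` dom c"
abbreviation param :: "('m, 'n) chart \<Rightarrow> real^'n \<Rightarrow> 'm" where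
  "param c \<equiv> inv_into (dom c) (coord c)"

definition smooth_atlas :: "('m::topological_space, 'n::finite) chart set \<Rightarrow> bool" where
  "smooth_atlas A \<longleftrightarrow>
     (\<forall>c\<in>A. open (dom c) \<and> open (img c) \<and> homeomorphism (dom c) (img c) (coord c) (param c)) \<and>
     (\<Union>c\<in>A. dom c) = UNIV \<and>
     (\<forall>c\<in>A. \<forall>c'\<in>A. smooth_on (coord c' \<circ> param c) (coord c ` (dom c \<inter> dom c')))"

definition smooth_fun :: "('m, 'n::finite) chart set \<Rightarrow> ('m \<Rightarrow> real) \<Rightarrow> bool" where
  "smooth_fun A f \<longleftrightarrow> (\<forall>c\<in>A. smooth_on (f \<circ> param c) (img c))"

text \<open>The Jacobian matrix at the point \<open>p\<close> of the change of coordinates from \<open>c\<close> to \<open>c'\<close>.\<close>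

definition jac :: "('m, 'n::finite) chart \<Rightarrow> ('m, 'n) chart \<Rightarrow> 'm \<Rightarrow> real^'n^'n" where
  "jac c c' p = jacobian (coord c' \<circ> param c) (at (coord c p))"


section \<open>Differential forms and de Rham cohomology\<close>

text \<open>A \<open>q\<close>-covector takes a sequence of vectors as its argument and depends only on the
  first \<open>q\<close> of them. A \<open>q\<close>-form on an open subset of \<open>real^'n\<close> has type
  \<open>real^'n \<Rightarrow> (nat \<Rightarrow> real^'n) \<Rightarrow> 'b\<close>.\<close>

definition alternating :: "nat \<Rightarrow> ((nat \<Rightarrow> 'v::real_vector) \<Rightarrow> 'b::real_vector) \<Rightarrow> bool" where
  "alternating q \<alpha> \<longleftrightarrow>
     (\<forall>v w. (\<forall>i<q. v i = w i) \<longrightarrow> \<alpha> v = \<alpha> w) \<and>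
     (\<forall>v. \<forall>i<q. linear (\<lambda>u. \<alpha> (v(i := u)))) \<and>
     (\<forall>v. \<forall>i<q. \<forall>j<q. i \<noteq> j \<and> v i = v j \<longrightarrow> \<alpha> v = 0)"

definition ext_deriv ::
  "nat \<Rightarrow> (real^'n::finite \<Rightarrow> (nat \<Rightarrow> real^'n) \<Rightarrow> 'b::real_normed_vector) \<Rightarrow> real^'n \<Rightarrow> (nat \<Rightarrow> real^'n) \<Rightarrow> 'b" where
  "ext_deriv q \<omega> x v =
     (\<Sum>i\<le>q. (-1)^i *\<^sub>R
        frechet_derivative (\<lambda>y. \<omega> y (\<lambda>m. v (if m < i then m else Suc m))) (at x) (v i))"

text \<open>A form on the manifold is the family of its coordinate expressions, compatible under
  pullback along the changes of coordinates.\<close>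

type_synonym ('m, 'n) form = "('m, 'n) chart \<Rightarrow> real^'n \<Rightarrow> (nat \<Rightarrow> real^'n) \<Rightarrow> real"

definition diff_form :: "('m, 'n::finite) chart set \<Rightarrow> nat \<Rightarrow> ('m, 'n) form \<Rightarrow> bool" where
  "diff_form A q \<omega> \<longleftrightarrow>
     (\<forall>c\<in>A. (\<forall>x\<in>img c. alternating q (\<omega> c x)) \<and> (\<forall>v. smooth_on (\<lambda>x. \<omega> c x v) (img c))) \<and>
     (\<forall>c\<in>A. \<forall>c'\<in>A. \<forall>p\<in>dom c \<inter> dom c'. \<forall>v.
        \<omega> c (coord c p) v = \<omega> c' (coord c' p) (\<lambda>i. jac c c' p *v v i))"

definition closed_forms :: "('m, 'n::finite) chart set \<Rightarrow> nat \<Rightarrow> ('m, 'n) form set" where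
  "closed_forms A q = {\<omega>. diff_form A q \<omega> \<and> (\<forall>c\<in>A. \<forall>x\<in>img c. \<forall>v. ext_deriv q (\<omega> c) x v = 0)}"

text \<open>In degree 0 the only exact form is 0, so being cohomologous there means equality on the
  images of all charts.\<close>

definition cohomologous :: "('m, 'n::finite) chart set \<Rightarrow> nat \<Rightarrow> (('m, 'n) form \<times> ('m, 'n) form) set" where
  "cohomologous A q =
     {(\<omega>, \<omega>'). \<omega> \<in> closed_forms A q \<and> \<omega>' \<in> closed_forms A q \<and>
       (case q of
          0 \<Rightarrow> \<forall>c\<in>A. \<forall>x\<in>img c. \<forall>v. \<omega>' c x v - \<omega> c x v = 0
        | Suc r \<Rightarrow> \<exists>\<eta>. diff_form A r \<eta> \<and>
            (\<forall>c\<in>A. \<forall>x\<in>img c. \<forall>v. \<omega>' c x v - \<omega> c x v = ext_deriv r (\<eta> c) x v))}"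

definition de_rham_cohomology :: "('m, 'n::finite) chart set \<Rightarrow> nat \<Rightarrow> ('m, 'n) form set set" where
  "de_rham_cohomology A q = closed_forms A q // cohomologous A q"

text \<open>This is an element of \<open>de_rham_cohomology A q\<close> only if \<open>\<omega>\<close> is a closed \<open>q\<close>-form; otherwise it
  is empty.\<close>

definition de_rham_class :: "('m, 'n::finite) chart set \<Rightarrow> nat \<Rightarrow> ('m, 'n) form \<Rightarrow> ('m, 'n) form set" where
  "de_rham_class A q \<omega> = cohomologous A q `` {\<omega>}"


section \<open>Vector bundles and connections\<close>

text \<open>A real vector bundle with fibre \<open>real^'r\<close> is given by a family of local trivialisations over the
  charts of the atlas and their transition functions: if \<open>s\<^sub>i\<close> and \<open>s\<^sub>j\<close> represent the same section in
  the trivialisations \<open>i\<close> and \<open>j\<close>, then \<open>s\<^sub>j = transition V i j p *v s\<^sub>i\<close> at the point \<open>p\<close>.\<close>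

record ('m, 'n, 'i, 'r) bundle_data =
  triv :: "'i set"
  chart_of :: "'i \<Rightarrow> ('m, 'n) chart"
  transition :: "'i \<Rightarrow> 'i \<Rightarrow> 'm \<Rightarrow> real^'r^'r"

definition vector_bundle ::
  "('m, 'n::finite) chart set \<Rightarrow> ('m, 'n, 'i, 'r::finite) bundle_data \<Rightarrow> bool" where
  "vector_bundle A V \<longleftrightarrow>
     chart_of V ` triv V = A \<and>
     (\<forall>i\<in>triv V. \<forall>j\<in>triv V.
        smooth_on (transition V i j \<circ> param (chart_of V i))
          (coord (chart_of V i) ` (dom (chart_of V i) \<inter> dom (chart_of V j)))) \<and>
     (\<forall>i\<in>triv V. \<forall>p\<in>dom (chart_of V i). transition V i i p = mat 1) \<and>
     (\<forall>i\<in>triv V. \<forall>j\<in>triv V. \<forall>l\<in>triv V.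
        \<forall>p\<in>dom (chart_of V i) \<inter> dom (chart_of V j) \<inter> dom (chart_of V l).
          transition V j l p ** transition V i j p = transition V i l p)"

text \<open>A connection is given by its matrix-valued 1-forms: in the trivialisation \<open>i\<close>, the covariant
  derivative of \<open>s\<close> at \<open>x\<close> in the direction \<open>u\<close> is \<open>\<partial>\<^sub>u s x + D i x u *v s x\<close>. The last
  condition says that these local operators agree on overlaps.\<close>

type_synonym ('n, 'r) conn_form = "real^'n \<Rightarrow> real^'n \<Rightarrow> real^'r^'r"

definition connection ::
  "('m, 'n::finite) chart set \<Rightarrow> ('m, 'n, 'i, 'r::finite) bundle_data \<Rightarrow> ('i \<Rightarrow> ('n, 'r) conn_form) \<Rightarrow> bool" where
  "connection A V D \<longleftrightarrow>
     vector_bundle A V \<and>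
     (\<forall>i\<in>triv V. (\<forall>x\<in>img (chart_of V i). linear (D i x)) \<and>
        (\<forall>u. smooth_on (\<lambda>x. D i x u) (img (chart_of V i)))) \<and>
     (\<forall>i\<in>triv V. \<forall>j\<in>triv V. \<forall>p\<in>dom (chart_of V i) \<inter> dom (chart_of V j). \<forall>u.
        let c = chart_of V i; c' = chart_of V j; h = transition V i j in
          h p ** D i (coord c p) u =
            frechet_derivative (h \<circ> param c) (at (coord c p)) u
              + D j (coord c' p) (jac c c' p *v u) ** h p)"

definition tangent_bundle :: "('m, 'n::finite) chart set \<Rightarrow> ('m, 'n, ('m, 'n) chart, 'n) bundle_data" where
  "tangent_bundle A = \<lparr>triv = A, chart_of = (\<lambda>c. c), transition = jac\<rparr>"


section \<open>Curvature and character forms\<close>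

definition mwedge ::
  "nat \<Rightarrow> nat \<Rightarrow> ((nat \<Rightarrow> 'v) \<Rightarrow> 'b::{real_vector,semiring_1}^'r^'r) \<Rightarrow> ((nat \<Rightarrow> 'v) \<Rightarrow> 'b^'r^'r)
     \<Rightarrow> (nat \<Rightarrow> 'v) \<Rightarrow> 'b^'r::finite^'r" where
  "mwedge p q \<alpha> \<beta> v =
     (1 / (fact p * fact q)) *\<^sub>R
       (\<Sum>\<pi> | \<pi> permutes {..<p+q}.
          real_of_int (sign \<pi>) *\<^sub>R (\<alpha> (\<lambda>i. v (\<pi> i)) ** \<beta> (\<lambda>i. v (\<pi> (p + i)))))"

text \<open>The curvature 2-form \<open>dA + A \<and> A\<close> of the connection \<open>d + A\<close>.\<close>

definition curvature :: "('n::finite, 'r::finite) conn_form \<Rightarrow> real^'n \<Rightarrow> (nat \<Rightarrow> real^'n) \<Rightarrow> real^'r^'r" where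
  "curvature A x v =
     ext_deriv 1 (\<lambda>y w. A y (w 0)) x v + mwedge 1 1 (\<lambda>w. A x (w 0)) (\<lambda>w. A x (w 0)) v"

primrec mwpower ::
  "nat \<Rightarrow> ((nat \<Rightarrow> 'v) \<Rightarrow> 'b::{real_vector,semiring_1}^'r^'r) \<Rightarrow> (nat \<Rightarrow> 'v) \<Rightarrow> 'b^'r::finite^'r" where
  "mwpower 0 F = (\<lambda>v. mat 1)"
| "mwpower (Suc j) F = mwedge 2 (2 * j) F (mwpower j F)"

definition trace_form ::
  "nat \<Rightarrow> ((nat \<Rightarrow> 'v) \<Rightarrow> 'b::{real_vector,semiring_1}^'r^'r::finite) \<Rightarrow> (nat \<Rightarrow> 'v) \<Rightarrow> 'b" where
  "trace_form j F v = trace (mwpower j F v)"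

definition cscale :: "complex \<Rightarrow> real^'r^'r \<Rightarrow> complex^'r^'r" where
  "cscale z M = (\<chi> a b. z * complex_of_real (M $ a $ b))"

text \<open>The complex number of which the real part is taken is real. The trace form does not depend
  on the choice of the trivialisation \<open>i\<close> over the chart \<open>c\<close> when \<open>D\<close> is a connection on \<open>V\<close>.\<close>

definition pontrjagin_form ::
  "('m, 'n::finite, 'i, 'r::finite) bundle_data \<Rightarrow> ('i \<Rightarrow> ('n, 'r) conn_form) \<Rightarrow> nat \<Rightarrow> ('m, 'n) form" where
  "pontrjagin_form V D k c x v =
     (let i = (SOME i. i \<in> triv V \<and> chart_of V i = c) in
      Re (1 / fact (2 * k) *
        trace_form (2 * k)
          (\<lambda>w. cscale (-1 / (2 * complex_of_real pi * \<i>)) (curvature (D i) x w)) v))"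

text \<open>The class of \<open>pontrjagin_form V D k\<close> is the same for all connections \<open>D\<close> on \<open>V\<close>.\<close>

definition pontrjagin_class ::
  "('m, 'n::finite) chart set \<Rightarrow> ('m, 'n, 'i, 'r::finite) bundle_data \<Rightarrow> nat \<Rightarrow> ('m, 'n) form set" where
  "pontrjagin_class A V k =
     (THE X. \<exists>D. connection A V D \<and> X = de_rham_class A (4 * k) (pontrjagin_form V D k))"


section \<open>Pseudo-Riemannian and conformal structures\<close>

type_synonym ('m, 'n) metric = "('m, 'n) chart \<Rightarrow> real^'n \<Rightarrow> real^'n^'n"

definition neg_index :: "real^'n^'n::finite \<Rightarrow> nat" where
  "neg_index G = Max {dim W |W. subspace W \<and> (\<forall>v\<in>W. v \<noteq> 0 \<longrightarrow> v \<bullet> (G *v v) < 0)}"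

definition pseudo_riemannian :: "('m, 'n::finite) chart set \<Rightarrow> ('m, 'n) metric \<Rightarrow> bool" where
  "pseudo_riemannian A g \<longleftrightarrow>
     (\<forall>c\<in>A. smooth_on (g c) (img c) \<and>
        (\<forall>x\<in>img c. transpose (g c x) = g c x \<and> invertible (g c x))) \<and>
     (\<forall>c\<in>A. \<forall>c'\<in>A. \<forall>p\<in>dom c \<inter> dom c'.
        g c (coord c p) = transpose (jac c c' p) ** g c' (coord c' p) ** jac c c' p) \<and>
     (\<exists>q. \<forall>c\<in>A. \<forall>x\<in>img c. neg_index (g c x) = q)"

text \<open>\<open>g' = exp (2\<omega>) g\<close>\<close>

definition conformal_change ::
  "('m, 'n::finite) chart set \<Rightarrow> ('m \<Rightarrow> real) \<Rightarrow> ('m, 'n) metric \<Rightarrow> ('m, 'n) metric \<Rightarrow> bool" where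
  "conformal_change A \<omega> g g' \<longleftrightarrow>
     smooth_fun A \<omega> \<and> (\<forall>c\<in>A. \<forall>x\<in>img c. g' c x = exp (2 * \<omega> (param c x)) *\<^sub>R g c x)"

definition conformal_rel :: "('m, 'n::finite) chart set \<Rightarrow> (('m, 'n) metric \<times> ('m, 'n) metric) set" where
  "conformal_rel A =
     {(g, g'). pseudo_riemannian A g \<and> pseudo_riemannian A g' \<and> (\<exists>\<omega>. conformal_change A \<omega> g g')}"

definition conformal_structure :: "('m, 'n::finite) chart set \<Rightarrow> ('m, 'n) metric set \<Rightarrow> bool" where
  "conformal_structure A C \<longleftrightarrow> C \<in> Collect (pseudo_riemannian A) // conformal_rel A"

definition log_factor ::
  "('m, 'n::finite) chart set \<Rightarrow> ('m, 'n) metric \<Rightarrow> ('m, 'n) metric \<Rightarrow> 'm \<Rightarrow> real" where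
  "log_factor A g g' = (THE \<omega>. conformal_change A \<omega> g g')"


section \<open>Local Riemannian geometry\<close>

text \<open>Here \<open>G\<close> is the matrix of components of a metric in coordinates, and
  \<open>christoffel G x a b c\<close> is the Christoffel symbol with upper index \<open>a\<close> and lower indices \<open>b c\<close>.\<close>

definition christoffel :: "(real^'n \<Rightarrow> real^'n^'n) \<Rightarrow> real^'n \<Rightarrow> 'n \<Rightarrow> 'n \<Rightarrow> 'n::finite \<Rightarrow> real" where
  "christoffel G x a b c =
     1/2 * (\<Sum>d\<in>UNIV. matrix_inv (G x) $ a $ d *
       (pd b (\<lambda>y. G y $ d $ c) x + pd c (\<lambda>y. G y $ d $ b) x - pd d (\<lambda>y. G y $ b $ c) x))"

definition levi_civita :: "(real^'n \<Rightarrow> real^'n^'n) \<Rightarrow> ('n::finite, 'n) conn_form" where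
  "levi_civita G x u = (\<chi> a c. \<Sum>b\<in>UNIV. u $ b * christoffel G x a b c)"

definition ricci :: "(real^'n \<Rightarrow> real^'n^'n) \<Rightarrow> real^'n \<Rightarrow> real^'n^'n::finite" where
  "ricci G x = (\<chi> b d. \<Sum>a\<in>UNIV.
     curvature (levi_civita G) x (\<lambda>i. if i = 0 then axis a 1 else axis b 1) $ a $ d)"

definition scal :: "(real^'n \<Rightarrow> real^'n^'n::finite) \<Rightarrow> real^'n \<Rightarrow> real" where
  "scal G x = trace (matrix_inv (G x) ** ricci G x)"

definition schouten :: "(real^'n \<Rightarrow> real^'n^'n) \<Rightarrow> real^'n \<Rightarrow> real^'n^'n::finite" where
  "schouten G x =
     (1 / (real CARD('n) - 2)) *\<^sub>R
       (ricci G x - (scal G x / (2 * (real CARD('n) - 1))) *\<^sub>R G x)"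


section \<open>Densities\<close>

text \<open>A chart trivialises the bundle of conformal densities of weight \<open>w\<close>, which is the bundle of
  ordinary densities \<open>\<bar>\<Lambda>\<^sup>n T\<^sup>*M\<bar>\<close> to the power \<open>-w/n\<close>; \<open>J\<close> is the Jacobian matrix of the
  change of coordinates. Correspondingly the Levi-Civita connection on this bundle has connection form
  \<open>w/n\<close> times the trace of the one on the tangent bundle.\<close>

definition density_transition :: "real \<Rightarrow> real^'n^'n::finite \<Rightarrow> real" where
  "density_transition w J = \<bar>det J\<bar> powr (w / CARD('n))"

definition density_conn :: "real \<Rightarrow> (real^'n \<Rightarrow> real^'n^'n::finite) \<Rightarrow> real^'n \<Rightarrow> real^'n \<Rightarrow> real" where
  "density_conn w G x u = w / CARD('n) * trace (levi_civita G x u)"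

text \<open>The conformal metric, of weight 2, in the coordinate trivialisation. It depends only on the
  conformal class of \<open>G\<close>.\<close>

definition conf_metric :: "(real^'n \<Rightarrow> real^'n^'n) \<Rightarrow> real^'n \<Rightarrow> real^'n^'n::finite" where
  "conf_metric G x = (\<bar>det (G x)\<bar> powr (-1 / CARD('n))) *\<^sub>R G x"


section \<open>The standard tractor bundle and its connection\<close>

text \<open>The fibre \<open>real^(unit + 'n + unit)\<close> consists of the triples \<open>(\<sigma>, \<mu>, \<rho>)\<close>. A trivialisation is given
  by a chart together with a metric in the conformal class; the components \<open>\<sigma>\<close>, \<open>\<mu>\<close>, \<open>\<rho>\<close> are taken with
  respect to the coordinate trivialisations of densities and 1-forms.\<close>

definition triple :: "real \<Rightarrow> real^'n \<Rightarrow> real \<Rightarrow> real^(unit + 'n::finite + unit)" where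
  "triple \<sigma> \<mu> \<rho> = (\<chi> i. case i of Inl _ \<Rightarrow> \<sigma> | Inr (Inl a) \<Rightarrow> \<mu> $ a | Inr (Inr _) \<Rightarrow> \<rho>)"

definition triple_matrix ::
  "(real \<Rightarrow> real^'n \<Rightarrow> real \<Rightarrow> real^(unit + 'n + unit)) \<Rightarrow> real^(unit + 'n + unit)^(unit + 'n::finite + unit)" where
  "triple_matrix f = matrix (\<lambda>t. f (t $ Inl ()) (\<chi> a. t $ Inr (Inl a)) (t $ Inr (Inr ())))"

text \<open>The change of metric from \<open>G\<close> in a fixed chart, where \<open>\<Upsilon>\<close> is the differential of the
  logarithm of the conformal factor.\<close>

definition tractor_rescale :: "(real^'n \<Rightarrow> real^'n^'n) \<Rightarrow> real^'n \<Rightarrow> real^'n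
    \<Rightarrow> real^(unit + 'n + unit)^(unit + 'n::finite + unit)" where
  "tractor_rescale G x \<Upsilon> =
     (let K = matrix_inv (conf_metric G x) in
      triple_matrix (\<lambda>\<sigma> \<mu> \<rho>.
        triple \<sigma> (\<mu> + \<sigma> *\<^sub>R \<Upsilon>) (\<rho> - (K *v \<Upsilon>) \<bullet> \<mu> - 1/2 * ((K *v \<Upsilon>) \<bullet> \<Upsilon>) * \<sigma>)))"

text \<open>The change of coordinates with Jacobian matrix \<open>J\<close>, for a fixed metric.\<close>

definition tractor_recoord ::
  "real^'n^'n \<Rightarrow> real^(unit + 'n + unit)^(unit + 'n::finite + unit)" where
  "tractor_recoord J =
     triple_matrix (\<lambda>\<sigma> \<mu> \<rho>.
       triple (density_transition 1 J * \<sigma>)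
         (density_transition 1 J *\<^sub>R (transpose (matrix_inv J) *v \<mu>))
         (density_transition (-1) J * \<rho>))"

definition tractor_bundle :: "('m, 'n::finite) chart set \<Rightarrow> ('m, 'n) metric set
    \<Rightarrow> ('m, 'n, ('m, 'n) chart \<times> ('m, 'n) metric, unit + 'n + unit) bundle_data" where
  "tractor_bundle A C =
     \<lparr>triv = A \<times> C, chart_of = fst,
      transition = (\<lambda>(c, g) (c', g') p.
        tractor_recoord (jac c c' p) **
        tractor_rescale (g c) (coord c p)
          (\<chi> a. pd a (log_factor A g g' \<circ> param c) (coord c p)))\<rparr>"

definition tractor_connection ::
  "('m, 'n::finite) chart \<times> ('m, 'n) metric \<Rightarrow> ('n, unit + 'n + unit) conn_form" where
  "tractor_connection = (\<lambda>(c, g) x u.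
     let G = g c; H = conf_metric G x; P = schouten G x in
     triple_matrix (\<lambda>\<sigma> \<mu> \<rho>.
       triple
         (density_conn 1 G x u * \<sigma> - u \<bullet> \<mu>)
         (density_conn 1 G x u *\<^sub>R \<mu> - transpose (levi_civita G x u) *v \<mu>
            + \<rho> *\<^sub>R (u v* H) + \<sigma> *\<^sub>R (u v* P))
         (density_conn (-1) G x u * \<rho> - (u v* P) \<bullet> (matrix_inv H *v \<mu>))))"

definition conformal_pontrjagin_form ::
  "('m, 'n::finite) chart set \<Rightarrow> ('m, 'n) metric set \<Rightarrow> nat \<Rightarrow> ('m, 'n) form" where
  "conformal_pontrjagin_form A C k = pontrjagin_form (tractor_bundle A C) tractor_connection k"

end

theory Submission
  imports Defs "HOL-Computational_Algebra.Polynomial"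
begin

text \<open>
  Fix one metric \<open>g\<close> of the conformal class. Its volume density trivialises all density bundles, and
  the splitting of the tractor bundle that belongs to \<open>g\<close> then identifies it with
  \<open>\<real> \<oplus> TM \<oplus> \<real>\<close>, with transition functions \<open>diag (1, J, 1)\<close> for the Jacobian matrices \<open>J\<close>. On this
  bundle there are two connections: the tractor connection, and the direct sum of the Levi-Civita
  connection with two trivial ones. By Chern--Weil theory (\<open>chern_weil\<close>) their Pontrjagin forms are
  cohomologous. The curvature of the direct sum is \<open>diag (0, R, 0)\<close>, so the traces of its powers are
  those of the Riemann curvature \<open>R\<close> (\<open>trace_form_split_connection\<close>), and the second form is the
  Pontrjagin form of the Levi-Civita connection. By \<open>chern_weil\<close> again, now on the tangent bundle,
  every connection there gives the same class.

  The Chern--Weil part rests on three computations with connection forms \<open>A\<close> on open sets: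
  \<open>d Tr F\<^sup>m = 0\<close> (\<open>trace_form_closed\<close>); the covariance of the curvature under simultaneous changes of
  frame and coordinates (\<open>curvature_gauge\<close>), by which the local forms agree on overlaps; and
  \<open>d/dt Tr F\<^sup>m = m d Tr (\<theta> F\<^sup>m\<^sup>-\<^sup>1)\<close> along \<open>A + t \<theta>\<close> (\<open>ext_deriv_transgression\<close>,
  \<open>has_real_derivative_trace_form_conn_path\<close>). Since \<open>Tr F\<^sup>m\<close> is a polynomial in \<open>t\<close>, the integral over
  \<open>t\<close> that yields a primitive of the difference of the two end points can be replaced by a quadrature
  formula with finitely many nodes (\<open>quadrature\<close>), and no integral depending on parameters has to be
  differentiated. Forms are handled as antisymmetrisations \<open>alt\<close> of plain tensors: tensor products are
  strictly associative, and every sign comes from a cyclic permutation of the slots.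

  It remains to see that the conformal Pontrjagin form may be computed with the same \<open>g\<close> in all
  charts, although its definition selects a metric of the class in each chart separately. For
  \<open>g' = exp (2 \<omega>) g\<close> the two tractor connections are gauge equivalent, provided that the Schouten
  tensor transforms in the well-known way. This is obtained without computing how the Ricci tensor
  transforms. For an arbitrary tensor \<open>p\<close> in place of the Schouten tensor, an explicit gauge
  transformation leads from the connection of \<open>(g, p)\<close> to that of \<open>(g', p')\<close> with an explicit \<open>p'\<close>
  (\<open>rescale_gauge_scale_tractor\<close>), and it preserves the middle block of the curvature, of Weyl type
  (\<open>weyl_rescaled\<close>). The Schouten tensor is the only \<open>p\<close> for which the Ricci contraction of that block
  vanishes (\<open>contraction_weyl_zero_iff\<close>); hence if \<open>p\<close> is the Schouten tensor of \<open>g\<close>, then \<open>p'\<close> is that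
  of \<open>g'\<close>.
\<close>

section \<open>Smooth functions\<close>

lemma frechet_derivative_eqI: "(f has_derivative f') (at x) \<Longrightarrow> frechet_derivative f (at x) = f'"
  by (metis frechet_derivative_at)

lemma frechet_derivative_cong_open:
  assumes "open S" "x \<in> S" "\<And>y. y \<in> S \<Longrightarrow> f y = g y"
  shows "frechet_derivative f (at x) = frechet_derivative g (at x)"
proof -
  have "(f has_derivative D) (at x) \<longleftrightarrow> (g has_derivative D) (at x)" for D
    using has_derivative_transform_within_open[OF _ assms(1,2), of f D UNIV g]
      has_derivative_transform_within_open[OF _ assms(1,2), of g D UNIV f] assms(3) by auto
  then show ?thesis by (simp add: frechet_derivative_def)
qed

lemma differentiable_cong_open:
  assumes "open S" "x \<in> S" "\<And>y. y \<in> S \<Longrightarrow> f y = g y" "f differentiable (at x)"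
  shows "g differentiable (at x)"
  using assms has_derivative_transform_within_open[OF _ assms(1,2), of f _ UNIV g]
  unfolding differentiable_def by metis

lemma Ck_on_cong:
  assumes "open S" "\<And>y. y \<in> S \<Longrightarrow> f y = g y" "Ck_on k f S"
  shows "Ck_on k g S"
  using assms(2,3)
proof (induction k arbitrary: f g)
  case 0
  then show ?case by (simp add: continuous_on_eq)
next
  case (Suc k)
  have "Ck_on k (\<lambda>x. frechet_derivative g (at x) v) S" for v
    using Suc.IH[of "\<lambda>x. frechet_derivative f (at x) v" "\<lambda>x. frechet_derivative g (at x) v"]
      Suc.prems frechet_derivative_cong_open[OF assms(1)] by (metis Ck_on.simps(2))
  then show ?case
    using Suc.prems differentiable_cong_open[OF assms(1), of _ f g] by auto
qed

lemma smooth_on_cong: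
  assumes "open S" "\<And>y. y \<in> S \<Longrightarrow> f y = g y" "smooth_on f S"
  shows "smooth_on g S"
  using Ck_on_cong[OF assms(1,2)] assms(3) by (auto simp: smooth_on_def)

lemma Ck_on_Suc_imp: "Ck_on (Suc k) f S \<Longrightarrow> Ck_on k f S"
proof (induction k arbitrary: f)
  case 0
  then show ?case
    by (simp add: continuous_at_imp_continuous_on differentiable_imp_continuous_within)
next
  case (Suc k)
  then show ?case by (metis Ck_on.simps(2))
qed

lemma Ck_on_subset: "Ck_on k f S \<Longrightarrow> T \<subseteq> S \<Longrightarrow> Ck_on k f T"
  by (induction k arbitrary: f) (auto intro: continuous_on_subset)

lemma smooth_on_subset: "smooth_on f S \<Longrightarrow> T \<subseteq> S \<Longrightarrow> smooth_on f T"
  by (auto simp: smooth_on_def intro: Ck_on_subset)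

lemma smooth_on_differentiable: "smooth_on f S \<Longrightarrow> x \<in> S \<Longrightarrow> f differentiable (at x)"
  unfolding smooth_on_def by (metis Ck_on.simps(2))

lemma smooth_on_continuous: "smooth_on f S \<Longrightarrow> continuous_on S f"
  unfolding smooth_on_def by (metis Ck_on.simps(1))

lemma smooth_on_has_derivative:
  "smooth_on f S \<Longrightarrow> x \<in> S \<Longrightarrow> (f has_derivative frechet_derivative f (at x)) (at x)"
  using smooth_on_differentiable frechet_derivative_works by blast

lemma smooth_on_frechet: "smooth_on f S \<Longrightarrow> smooth_on (\<lambda>x. frechet_derivative f (at x) v) S"
  unfolding smooth_on_def by (metis Ck_on.simps(2))

lemma Ck_on_SucI:
  assumes "open S" "\<And>x. x \<in> S \<Longrightarrow> (f has_derivative f' x) (at x)"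
    "\<And>v. Ck_on k (\<lambda>x. f' x v) S"
  shows "Ck_on (Suc k) f S"
proof -
  have "Ck_on k (\<lambda>x. frechet_derivative f (at x) v) S" for v
    by (rule Ck_on_cong[OF assms(1) _ assms(3)[of v]]) (use assms(2) frechet_derivative_eqI in metis)
  then show ?thesis using assms(2) by (auto simp: differentiable_def)
qed

lemma Ck_on_has_derivative:
  "Ck_on (Suc k) f S \<Longrightarrow> x \<in> S \<Longrightarrow> (f has_derivative frechet_derivative f (at x)) (at x)"
  using frechet_derivative_works by (metis Ck_on.simps(2))

lemma Ck_on_const: "open S \<Longrightarrow> Ck_on k (\<lambda>x. c) S"
proof (induction k arbitrary: c)
  case (Suc k)
  show ?case by (rule Ck_on_SucI[where f'="\<lambda>x v. 0"]) (use Suc in auto)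
qed auto

lemma smooth_on_const [simp]: "open S \<Longrightarrow> smooth_on (\<lambda>x. c) S"
  by (simp add: smooth_on_def Ck_on_const)

lemma Ck_on_bounded_linear_comp:
  assumes "open S" "bounded_linear L" "Ck_on k f S"
  shows "Ck_on k (\<lambda>x. L (f x)) S"
  using assms(3)
proof (induction k arbitrary: f)
  case 0
  then show ?case by (simp add: bounded_linear.continuous_on[OF assms(2)])
next
  case (Suc k)
  show ?case
  proof (rule Ck_on_SucI[OF assms(1)])
    show "((\<lambda>x. L (f x)) has_derivative (\<lambda>v. L (frechet_derivative f (at x) v))) (at x)" if "x \<in> S" for x
      by (rule bounded_linear.has_derivative[OF assms(2) Ck_on_has_derivative[OF Suc.prems that]])
    show "Ck_on k (\<lambda>x. L (frechet_derivative f (at x) v)) S" for v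
      using Suc by simp
  qed
qed

lemma smooth_on_bounded_linear_comp:
  "open S \<Longrightarrow> bounded_linear L \<Longrightarrow> smooth_on f S \<Longrightarrow> smooth_on (\<lambda>x. L (f x)) S"
  by (simp add: smooth_on_def Ck_on_bounded_linear_comp)

lemma Ck_on_ident: "open S \<Longrightarrow> Ck_on k (\<lambda>x. x) S"
  by (cases k) (auto intro!: Ck_on_SucI[where f'="\<lambda>x v. v"] Ck_on_const simp del: Ck_on.simps(2))

lemma smooth_on_ident [simp]: "open S \<Longrightarrow> smooth_on (\<lambda>x. x) S"
  by (simp add: smooth_on_def Ck_on_ident)

lemma Ck_on_add: "open S \<Longrightarrow> Ck_on k f S \<Longrightarrow> Ck_on k g S \<Longrightarrow> Ck_on k (\<lambda>x. f x + g x) S"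
proof (induction k arbitrary: f g)
  case (Suc k)
  show ?case
    by (rule Ck_on_SucI[OF Suc.prems(1),
          where f'="\<lambda>x v. frechet_derivative f (at x) v + frechet_derivative g (at x) v"])
      (use Suc has_derivative_add Ck_on_has_derivative[of k f S] Ck_on_has_derivative[of k g S] in auto)
qed (auto intro: continuous_on_add)

lemma smooth_on_add: "open S \<Longrightarrow> smooth_on f S \<Longrightarrow> smooth_on g S \<Longrightarrow> smooth_on (\<lambda>x. f x + g x) S"
  by (simp add: smooth_on_def Ck_on_add)

lemma smooth_on_scaleR: "open S \<Longrightarrow> smooth_on f S \<Longrightarrow> smooth_on (\<lambda>x. r *\<^sub>R f x) S"
  by (rule smooth_on_bounded_linear_comp[OF _ bounded_linear_scaleR_right])

lemma smooth_on_minus: "open S \<Longrightarrow> smooth_on f S \<Longrightarrow> smooth_on (\<lambda>x. - f x) S"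
  using smooth_on_scaleR[of S f "-1"] by simp

lemma smooth_on_diff: "open S \<Longrightarrow> smooth_on f S \<Longrightarrow> smooth_on g S \<Longrightarrow> smooth_on (\<lambda>x. f x - g x) S"
  using smooth_on_add[of S f "\<lambda>x. - g x"] smooth_on_minus[of S g] by simp

lemma smooth_on_sum:
  "open S \<Longrightarrow> (\<And>i. i \<in> I \<Longrightarrow> smooth_on (f i) S) \<Longrightarrow> smooth_on (\<lambda>x. \<Sum>i\<in>I. f i x) S"
  by (induction I rule: infinite_finite_induct) (auto intro!: smooth_on_add)

lemma Ck_on_bilinear:
  assumes "bounded_bilinear B" "open S"
  shows "Ck_on k f S \<Longrightarrow> Ck_on k g S \<Longrightarrow> Ck_on k (\<lambda>x. B (f x) (g x)) S"
proof (induction k arbitrary: f g)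
  case 0
  then show ?case by (simp add: bounded_bilinear.continuous_on[OF assms(1)])
next
  case (Suc k)
  show ?case
  proof (rule Ck_on_SucI[OF assms(2)])
    fix x assume "x \<in> S"
    show "((\<lambda>x. B (f x) (g x)) has_derivative
        (\<lambda>v. B (f x) (frechet_derivative g (at x) v) + B (frechet_derivative f (at x) v) (g x))) (at x)"
      by (rule bounded_bilinear.FDERIV[OF assms(1)])
        (use Ck_on_has_derivative Suc.prems \<open>x \<in> S\<close> in blast)+
  next
    fix v
    show "Ck_on k (\<lambda>x. B (f x) (frechet_derivative g (at x) v)
        + B (frechet_derivative f (at x) v) (g x)) S"
      by (intro Ck_on_add[OF assms(2)] Suc.IH)
        (use Ck_on_Suc_imp[OF Suc.prems(1)] Ck_on_Suc_imp[OF Suc.prems(2)] Suc.prems in auto)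
  qed
qed

lemma smooth_on_bilinear:
  "bounded_bilinear B \<Longrightarrow> open S \<Longrightarrow> smooth_on f S \<Longrightarrow> smooth_on g S \<Longrightarrow> smooth_on (\<lambda>x. B (f x) (g x)) S"
  by (simp add: smooth_on_def Ck_on_bilinear)

lemma smooth_on_mult:
  fixes f g :: "_ \<Rightarrow> 'a::real_normed_algebra"
  shows "open S \<Longrightarrow> smooth_on f S \<Longrightarrow> smooth_on g S \<Longrightarrow> smooth_on (\<lambda>x. f x * g x) S"
  by (rule smooth_on_bilinear[OF bounded_bilinear_mult])

lemma smooth_on_scaleR_fun:
  "open S \<Longrightarrow> smooth_on f S \<Longrightarrow> smooth_on g S \<Longrightarrow> smooth_on (\<lambda>x. f x *\<^sub>R g x) S"
  by (rule smooth_on_bilinear[OF bounded_bilinear_scaleR])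

lemma smooth_on_prod:
  fixes f :: "_ \<Rightarrow> _ \<Rightarrow> real"
  shows "open S \<Longrightarrow> (\<And>i. i \<in> I \<Longrightarrow> smooth_on (f i) S) \<Longrightarrow> smooth_on (\<lambda>x. \<Prod>i\<in>I. f i x) S"
  by (induction I rule: infinite_finite_induct) (auto intro!: smooth_on_mult)

text \<open>The predicate \<open>Ck_on\<close> controls derivatives in fixed directions only, whereas the derivative of a
  composite evaluates a varying linear map at a varying vector. Expanding that vector in a basis of
  the intermediate space gives products, to which \<open>Ck_on_bilinear\<close> applies.\<close>

lemma Ck_on_compose:
  fixes g :: "'a::real_normed_vector \<Rightarrow> 'b::euclidean_space" and f :: "'b \<Rightarrow> 'c::real_normed_vector"
  assumes "open S" "open T" "g ` S \<subseteq> T"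
  shows "Ck_on k f T \<Longrightarrow> Ck_on k g S \<Longrightarrow> Ck_on k (\<lambda>x. f (g x)) S"
proof (induction k arbitrary: f)
  case 0
  then show ?case using assms(3) by (auto intro: continuous_on_compose2)
next
  case (Suc k)
  show ?case
  proof (rule Ck_on_SucI[OF assms(1)])
    fix x assume x: "x \<in> S"
    have gx: "g x \<in> T" using x assms(3) by auto
    have fd: "(f has_derivative frechet_derivative f (at (g x))) (at (g x))"
      using Ck_on_has_derivative[OF Suc.prems(1) gx] .
    have lin: "frechet_derivative f (at (g x)) w
        = (\<Sum>b\<in>Basis. (w \<bullet> b) *\<^sub>R frechet_derivative f (at (g x)) b)" for w
    proof -
      have lf: "linear (frechet_derivative f (at (g x)))" using has_derivative_linear[OF fd] .
      have "frechet_derivative f (at (g x)) w = frechet_derivative f (at (g x)) (\<Sum>b\<in>Basis. (w \<bullet> b) *\<^sub>R b)"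
        by (simp add: euclidean_representation)
      then show ?thesis by (simp add: linear_sum[OF lf] linear_cmul[OF lf])
    qed
    have "((\<lambda>x. f (g x)) has_derivative
       (\<lambda>v. frechet_derivative f (at (g x)) (frechet_derivative g (at x) v))) (at x)"
      by (rule has_derivative_compose[OF Ck_on_has_derivative[OF Suc.prems(2) x] fd])
    then show "((\<lambda>x. f (g x)) has_derivative (\<lambda>v. \<Sum>b\<in>Basis. (frechet_derivative g (at x) v \<bullet> b)
      *\<^sub>R frechet_derivative f (at (g x)) b)) (at x)"
      by (rule has_derivative_eq_rhs) (rule ext, rule lin)
  next
    fix v
    have *: "Ck_on k (\<lambda>x. (frechet_derivative g (at x) v \<bullet> b) *\<^sub>R frechet_derivative f (at (g x)) b) S" for b
      by (rule Ck_on_bilinear[OF bounded_bilinear_scaleR assms(1)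
            Ck_on_bounded_linear_comp[OF assms(1) bounded_linear_inner_left]
            Suc.IH[OF _ Ck_on_Suc_imp[OF Suc.prems(2)]]])
        (use Suc.prems in auto)
    have "Ck_on k (\<lambda>x. \<Sum>b\<in>I. (frechet_derivative g (at x) v \<bullet> b)
      *\<^sub>R frechet_derivative f (at (g x)) b) S" if "finite I" for I
      using that by (induction I) (auto simp: Ck_on_const[OF assms(1)] intro!: Ck_on_add[OF assms(1)] *)
    then show "Ck_on k (\<lambda>x. \<Sum>b\<in>Basis. (frechet_derivative g (at x) v \<bullet> b)
      *\<^sub>R frechet_derivative f (at (g x)) b) S" by simp
  qed
qed

lemma smooth_on_compose:
  fixes g :: "'a::real_normed_vector \<Rightarrow> 'b::euclidean_space" and f :: "'b \<Rightarrow> 'c::real_normed_vector"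
  assumes "open S" "open T" "g ` S \<subseteq> T" "smooth_on f T" "smooth_on g S"
  shows "smooth_on (\<lambda>x. f (g x)) S"
  using assms by (simp add: smooth_on_def Ck_on_compose)

lemma Ck_on_inverse: "Ck_on k (inverse :: real \<Rightarrow> real) (- {0})"
proof (induction k)
  case 0
  then show ?case by (auto intro!: continuous_intros)
next
  case (Suc k)
  have o: "open (- {0::real})" by auto
  show ?case
  proof (rule Ck_on_SucI[OF o])
    fix v :: real
    show "Ck_on k (\<lambda>x. - (inverse x * v * inverse x)) (- {0::real})"
      using Ck_on_bilinear[OF bounded_bilinear_mult o Ck_on_bilinear[OF bounded_bilinear_mult o Suc
            Ck_on_const[OF o]] Suc]
        Ck_on_bounded_linear_comp[OF o bounded_linear_minus[OF bounded_linear_ident]] by fast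
  qed (auto intro!: derivative_eq_intros)
qed

lemma smooth_on_inverse:
  fixes f :: "_ \<Rightarrow> real"
  assumes "open S" "smooth_on f S" "\<And>x. x \<in> S \<Longrightarrow> f x \<noteq> 0"
  shows "smooth_on (\<lambda>x. inverse (f x)) S"
  by (rule smooth_on_compose[OF assms(1), of "- {0}"]) (use assms Ck_on_inverse in \<open>auto simp: smooth_on_def\<close>)

lemma smooth_on_divide:
  fixes f g :: "_ \<Rightarrow> real"
  assumes "open S" "smooth_on f S" "smooth_on g S" "\<And>x. x \<in> S \<Longrightarrow> g x \<noteq> 0"
  shows "smooth_on (\<lambda>x. f x / g x) S"
  using smooth_on_mult[OF assms(1,2) smooth_on_inverse[OF assms(1,3,4)]] by (simp add: divide_inverse)

lemma Ck_on_exp: "Ck_on k (exp :: real \<Rightarrow> real) UNIV"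
proof (induction k)
  case (Suc k)
  show ?case
    by (rule Ck_on_SucI[where f'="\<lambda>x v. exp x * v"])
      (auto intro!: derivative_eq_intros Ck_on_bilinear[OF bounded_bilinear_mult] Suc Ck_on_const)
qed (auto intro!: continuous_intros)

lemma smooth_on_exp:
  fixes f :: "_ \<Rightarrow> real"
  assumes "open S" "smooth_on f S"
  shows "smooth_on (\<lambda>x. exp (f x)) S"
  by (rule smooth_on_compose[OF assms(1), of UNIV]) (use assms Ck_on_exp in \<open>auto simp: smooth_on_def\<close>)

lemma has_derivative_ln_abs:
  fixes x :: real
  assumes "x \<noteq> 0"
  shows "((\<lambda>x. ln \<bar>x\<bar>) has_derivative (\<lambda>v. v * inverse x)) (at x)"
proof (cases "x > 0")
  case True
  have "((\<lambda>x::real. ln x) has_derivative (\<lambda>v. v * inverse x)) (at x)"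
    using True by (auto intro!: derivative_eq_intros)
  then show ?thesis
    by (rule has_derivative_transform_within_open[of _ _ _ _ "{0<..}"]) (use True in auto)
next
  case False
  have "((\<lambda>x::real. ln (- x)) has_derivative (\<lambda>v. v * inverse x)) (at x)"
    using False assms by (auto intro!: derivative_eq_intros simp: field_simps)
  then show ?thesis
    by (rule has_derivative_transform_within_open[of _ _ _ _ "{..<0}"]) (use False assms in auto)
qed

lemma smooth_on_ln_abs:
  fixes f :: "_ \<Rightarrow> real"
  assumes "open S" "smooth_on f S" "\<And>x. x \<in> S \<Longrightarrow> f x \<noteq> 0"
  shows "smooth_on (\<lambda>x. ln \<bar>f x\<bar>) S"
proof -
  have o: "open (- {0::real})" by auto
  have "Ck_on (Suc k) (\<lambda>x. ln \<bar>x\<bar>) (- {0::real})" for k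
  proof (rule Ck_on_SucI[OF o])
    show "((\<lambda>x. ln \<bar>x\<bar>) has_derivative (\<lambda>v. v * inverse x)) (at x)" if "x \<in> - {0}" for x :: real
      using that by (intro has_derivative_ln_abs) simp
    show "Ck_on k (\<lambda>x. v * inverse x) (- {0})" for v :: real
      by (rule Ck_on_bilinear[OF bounded_bilinear_mult o Ck_on_const[OF o] Ck_on_inverse])
  qed
  then have "Ck_on k (\<lambda>x. ln \<bar>x\<bar>) (- {0::real})" for k
    by (rule Ck_on_Suc_imp)
  then have "smooth_on (\<lambda>x. ln \<bar>x\<bar>) (- {0::real})" by (simp add: smooth_on_def)
  then show ?thesis
    by (rule smooth_on_compose[OF assms(1) o, of f, rotated]) (use assms in auto)
qed

section \<open>Smooth matrix-valued functions\<close>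

lemma smooth_on_vec_nth: "open S \<Longrightarrow> smooth_on f S \<Longrightarrow> smooth_on (\<lambda>x. f x $ i) S"
  by (rule smooth_on_bounded_linear_comp[OF _ bounded_linear_vec_nth])

lemma smooth_on_vecI:
  fixes f :: "_ \<Rightarrow> 'b::real_normed_vector^'n::finite"
  assumes "open S" "\<And>i. smooth_on (\<lambda>x. f x $ i) S"
  shows "smooth_on f S"
proof -
  have bl: "bounded_linear (axis i :: 'b \<Rightarrow> 'b^'n)" for i
    by (intro bounded_linear_intro[of _ 1]) (auto simp: axis_def vec_eq_iff norm_vec_def L2_set_def if_distrib[of "\<lambda>t. t\<^sup>2"] if_distrib[of norm] cong: if_cong)
  have "smooth_on (\<lambda>x. \<Sum>i\<in>UNIV. axis i (f x $ i)) S"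
    by (intro smooth_on_sum smooth_on_bounded_linear_comp[OF _ bl] assms)
  moreover have "(\<Sum>i\<in>UNIV. axis i (f x $ i)) = f x" for x
    by (simp add: vec_eq_iff axis_def)
  ultimately show ?thesis by simp
qed

lemma smooth_on_matrix_nth:
  "open S \<Longrightarrow> smooth_on f S \<Longrightarrow> smooth_on (\<lambda>x. f x $ a $ b) S"
  by (intro smooth_on_vec_nth)

lemma smooth_on_matrixI:
  fixes f :: "_ \<Rightarrow> 'b::real_normed_vector^'n::finite^'m::finite"
  assumes "open S" "\<And>a b. smooth_on (\<lambda>x. f x $ a $ b) S"
  shows "smooth_on f S"
  by (intro smooth_on_vecI assms)

lemma bounded_bilinear_matrix_mult:
  "bounded_bilinear ((**) :: real^'n::finite^'m::finite \<Rightarrow> real^'p::finite^'n \<Rightarrow> real^'p^'m)"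
  unfolding bilinear_conv_bounded_bilinear[symmetric] bilinear_def
  by (auto intro!: linearI simp: matrix_add_ldistrib matrix_matrix_mult_def vec_eq_iff
        sum.distrib sum_distrib_left algebra_simps)

lemma bounded_bilinear_matrix_vector:
  "bounded_bilinear ((*v) :: real^'n::finite^'m::finite \<Rightarrow> real^'n \<Rightarrow> real^'m)"
  unfolding bilinear_conv_bounded_bilinear[symmetric] bilinear_def
  by (auto intro!: linearI simp: matrix_vector_mult_def vec_eq_iff
        sum.distrib sum_distrib_left algebra_simps)

lemmas smooth_on_matrix_mult = smooth_on_bilinear[OF bounded_bilinear_matrix_mult]
lemmas smooth_on_matrix_vector = smooth_on_bilinear[OF bounded_bilinear_matrix_vector]
lemmas has_derivative_matrix_mult = bounded_bilinear.FDERIV[OF bounded_bilinear_matrix_mult]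

lemma bounded_linear_trace: "bounded_linear (trace :: real^'n::finite^'n \<Rightarrow> real)"
  by (simp add: trace_def[abs_def] bounded_linear_sum bounded_linear_compose[OF bounded_linear_vec_nth bounded_linear_vec_nth])

lemma smooth_on_det:
  fixes M :: "_ \<Rightarrow> real^'n::finite^'n"
  assumes "open S" "smooth_on M S"
  shows "smooth_on (\<lambda>x. det (M x)) S"
  unfolding det_def
  by (intro smooth_on_sum smooth_on_mult smooth_on_prod smooth_on_matrix_nth assms smooth_on_const)

lemma matrix_inv_inverse:
  fixes G :: "real^'n::finite^'n"
  assumes "invertible G"
  shows "matrix_inv G ** G = mat 1" "G ** matrix_inv G = mat 1"
  using someI_ex[of "\<lambda>A'. G ** A' = mat 1 \<and> A' ** G = mat 1"] assms
  by (auto simp: invertible_def matrix_inv_def)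

lemma matrix_inv_unique:
  fixes A B :: "real^'n::finite^'n"
  assumes "A ** B = mat 1"
  shows "matrix_inv A = B" "matrix_inv B = A" "B ** A = mat 1"
proof -
  show 1: "B ** A = mat 1" using assms matrix_left_right_inverse by blast
  have *: "matrix_inv C = D" if "C ** D = mat 1" "D ** C = mat 1" for C D :: "real^'n^'n"
  proof -
    have "invertible C" using that by (auto simp: invertible_def)
    then have "matrix_inv C = matrix_inv C ** (C ** D)"
      by (simp add: that)
    also have "\<dots> = D"
      by (simp add: matrix_mul_assoc matrix_inv_inverse[OF \<open>invertible C\<close>])
    finally show ?thesis .
  qed
  show "matrix_inv A = B" "matrix_inv B = A" by (rule *[OF assms 1], rule *[OF 1 assms])
qed

text \<open>By this formula the entries of the inverse are quotients of polynomials in the entries of the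
  matrix, which is why inversion preserves smoothness.\<close>

lemma matrix_inv_cramer:
  fixes G :: "real^'n::finite^'n"
  assumes "invertible G"
  shows "matrix_inv G $ k $ b = det (\<chi> i j. if j = k then (mat 1 :: real^'n^'n) $ i $ b else G $ i $ j) / det G"
proof -
  have "G *v column b (matrix_inv G) = column b (mat 1)"
    unfolding matrix_inv_inverse(2)[OF assms, symmetric]
    by (simp add: vec_eq_iff column_def matrix_matrix_mult_def matrix_vector_mult_def)
  then have "column b (matrix_inv G) = (\<chi> k. det (\<chi> i j. if j = k then column b (mat 1) $ i else G $ i $ j) / det G)"
    using cramer[of G] assms invertible_det_nz by blast
  then have "column b (matrix_inv G) $ k = det (\<chi> i j. if j = k then column b (mat 1) $ i else G $ i $ j) / det G"
    by simp
  then show ?thesis unfolding column_def vec_lambda_beta .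
qed

lemma smooth_on_matrix_inv:
  fixes M :: "_ \<Rightarrow> real^'n::finite^'n"
  assumes S: "open S" and M: "smooth_on M S" and inv: "\<And>x. x \<in> S \<Longrightarrow> invertible (M x)"
  shows "smooth_on (\<lambda>x. matrix_inv (M x)) S"
proof (rule smooth_on_matrixI[OF S])
  fix k b
  have "smooth_on (\<lambda>x. det (\<chi> i j. if j = k then (mat 1 :: real^'n^'n) $ i $ b else M x $ i $ j)) S"
  proof (rule smooth_on_det[OF S], rule smooth_on_matrixI[OF S])
    show "smooth_on (\<lambda>x. (\<chi> i j. if j = k then (mat 1 :: real^'n^'n) $ i $ b else M x $ i $ j) $ i $ j) S" for i j
      by (cases "j = k") (auto simp: S intro!: smooth_on_matrix_nth M)
  qed
  then have "smooth_on (\<lambda>x. det (\<chi> i j. if j = k then (mat 1 :: real^'n^'n) $ i $ b else M x $ i $ j) / det (M x)) S"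
    using smooth_on_divide[OF S _ smooth_on_det[OF S M]] inv invertible_det_nz by blast
  then show "smooth_on (\<lambda>x. matrix_inv (M x) $ k $ b) S"
    by (rule smooth_on_cong[OF S, rotated]) (simp add: matrix_inv_cramer inv)
qed

section \<open>Symmetry of second derivatives\<close>

text \<open>Two applications of the mean value theorem, along \<open>u\<close> and then along \<open>v\<close>. The second difference on
  the left is symmetric in \<open>u\<close> and \<open>v\<close>, so the two mixed derivatives agree at points arbitrarily
  close to \<open>x\<close>, and by continuity at \<open>x\<close>.\<close>

lemma second_difference:
  fixes f :: "'a::real_normed_vector \<Rightarrow> real"
  assumes d: "\<And>y. y \<in> ball x r \<Longrightarrow> f differentiable (at y)"
    and d2: "\<And>y. y \<in> ball x r \<Longrightarrow> (\<lambda>y. frechet_derivative f (at y) u) differentiable (at y)"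
    and s: "0 < s" "s * (norm u + norm v) < r"
  shows "\<exists>y\<in>ball x r. f (x + s *\<^sub>R u + s *\<^sub>R v) - f (x + s *\<^sub>R u) - f (x + s *\<^sub>R v) + f x
      = s * s * frechet_derivative (\<lambda>y. frechet_derivative f (at y) u) (at y) v"
proof -
  have inb: "x + a *\<^sub>R u + b *\<^sub>R v \<in> ball x r" if "0 \<le> a" "a \<le> s" "0 \<le> b" "b \<le> s" for a b
  proof -
    have "norm (a *\<^sub>R u + b *\<^sub>R v) \<le> a * norm u + b * norm v"
      using that norm_triangle_ineq[of "a *\<^sub>R u" "b *\<^sub>R v"] by simp
    also have "\<dots> \<le> s * norm u + s * norm v"
      using that by (intro add_mono mult_right_mono) auto
    finally have "norm (a *\<^sub>R u + b *\<^sub>R v) < r" using s by (simp add: algebra_simps)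
    moreover have "dist x (x + a *\<^sub>R u + b *\<^sub>R v) = norm (a *\<^sub>R u + b *\<^sub>R v)"
      by (metis add.assoc add_diff_cancel_left' dist_commute dist_norm)
    ultimately show ?thesis by simp
  qed
  have along: "((\<lambda>a. g (p + a *\<^sub>R w)) has_real_derivative frechet_derivative g (at (p + a *\<^sub>R w)) w) (at a)"
    if g: "g differentiable (at (p + a *\<^sub>R w))" for g :: "'a \<Rightarrow> real" and p w a
  proof -
    have "((\<lambda>a. g (p + a *\<^sub>R w)) has_derivative (\<lambda>t. frechet_derivative g (at (p + a *\<^sub>R w)) (t *\<^sub>R w))) (at a)"
      by (rule has_derivative_compose[of _ _ _ _ g])
        (use g frechet_derivative_works in \<open>auto intro!: derivative_eq_intros\<close>)
    moreover have "(\<lambda>t. frechet_derivative g (at (p + a *\<^sub>R w)) (t *\<^sub>R w))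
        = (*) (frechet_derivative g (at (p + a *\<^sub>R w)) w)"
      using linear_cmul[OF linear_frechet_derivative[OF g]] by (auto simp: mult.commute)
    ultimately show ?thesis by (simp add: has_field_derivative_def)
  qed
  define \<phi> where "\<phi> a = f (x + s *\<^sub>R v + a *\<^sub>R u) - f (x + a *\<^sub>R u)" for a
  have "\<exists>z. 0 < z \<and> z < s \<and> \<phi> s - \<phi> 0 = (s - 0) * (frechet_derivative f (at (x + s *\<^sub>R v + z *\<^sub>R u)) u
          - frechet_derivative f (at (x + z *\<^sub>R u)) u)"
  proof (rule MVT2[OF s(1)])
    fix a assume a: "0 \<le> a" "a \<le> s"
    have "x + s *\<^sub>R v + a *\<^sub>R u \<in> ball x r" "x + a *\<^sub>R u \<in> ball x r"
      using inb[of a s] inb[of a 0] a s by (simp_all add: ac_simps)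
    then show "DERIV \<phi> a :> frechet_derivative f (at (x + s *\<^sub>R v + a *\<^sub>R u)) u
          - frechet_derivative f (at (x + a *\<^sub>R u)) u"
      unfolding \<phi>_def using d by (intro DERIV_diff along) auto
  qed
  then obtain z where z: "0 < z" "z < s" "\<phi> s - \<phi> 0 = s * (frechet_derivative f (at (x + s *\<^sub>R v + z *\<^sub>R u)) u
          - frechet_derivative f (at (x + z *\<^sub>R u)) u)" by auto
  define \<psi> where "\<psi> b = frechet_derivative f (at (x + z *\<^sub>R u + b *\<^sub>R v)) u" for b
  have "\<exists>t. 0 < t \<and> t < s \<and> \<psi> s - \<psi> 0 = (s - 0) *
      frechet_derivative (\<lambda>y. frechet_derivative f (at y) u) (at (x + z *\<^sub>R u + t *\<^sub>R v)) v"
  proof (rule MVT2[OF s(1)])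
    fix b assume b: "0 \<le> b" "b \<le> s"
    show "DERIV \<psi> b :> frechet_derivative (\<lambda>y. frechet_derivative f (at y) u) (at (x + z *\<^sub>R u + b *\<^sub>R v)) v"
      unfolding \<psi>_def using inb[of z b] z b d2 by (intro along) auto
  qed
  then obtain t where t: "0 < t" "t < s" "\<psi> s - \<psi> 0 = s *
      frechet_derivative (\<lambda>y. frechet_derivative f (at y) u) (at (x + z *\<^sub>R u + t *\<^sub>R v)) v" by auto
  have "f (x + s *\<^sub>R u + s *\<^sub>R v) - f (x + s *\<^sub>R u) - f (x + s *\<^sub>R v) + f x = \<phi> s - \<phi> 0"
    by (simp add: \<phi>_def ac_simps)
  also have "\<dots> = s * (\<psi> s - \<psi> 0)" using z(3) by (simp add: \<psi>_def ac_simps)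
  finally show ?thesis using t z inb[of z t] by (intro bexI[of _ "x + z *\<^sub>R u + t *\<^sub>R v"]) auto
qed

lemma symmetric_second_derivative_real:
  fixes f :: "'a::real_normed_vector \<Rightarrow> real"
  assumes S: "open S" "x \<in> S" and f: "smooth_on f S"
  shows "frechet_derivative (\<lambda>y. frechet_derivative f (at y) u) (at x) v
       = frechet_derivative (\<lambda>y. frechet_derivative f (at y) v) (at x) u"
proof -
  define P where "P y = frechet_derivative (\<lambda>y. frechet_derivative f (at y) u) (at y) v" for y
  define Q where "Q y = frechet_derivative (\<lambda>y. frechet_derivative f (at y) v) (at y) u" for y
  have sm: "smooth_on P S" "smooth_on Q S"
    unfolding P_def Q_def by (intro smooth_on_frechet f)+
  have cont: "isCont P x" "isCont Q x"
    using smooth_on_continuous[OF sm(1)] smooth_on_continuous[OF sm(2)] S continuous_on_eq_continuous_at by blast+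
  have "P x = Q x"
  proof (rule ccontr)
    define e where "e = dist (P x) (Q x) / 2"
    assume "P x \<noteq> Q x"
    then have e: "e > 0" by (simp add: e_def)
    obtain r0 where r0: "r0 > 0" "ball x r0 \<subseteq> S" using S openE by blast
    obtain r1 where r1: "r1 > 0" "\<And>y. dist y x < r1 \<Longrightarrow> dist (P y) (P x) < e"
      using cont(1) e unfolding continuous_at_eps_delta by metis
    obtain r2 where r2: "r2 > 0" "\<And>y. dist y x < r2 \<Longrightarrow> dist (Q y) (Q x) < e"
      using cont(2) e unfolding continuous_at_eps_delta by metis
    define r where "r = min r0 (min r1 r2)"
    have r: "r > 0" "ball x r \<subseteq> S" using r0 r1 r2 by (auto simp: r_def)
    define s where "s = r / (2 * (1 + norm u + norm v))"
    have den: "1 + norm u + norm v > 0" by (simp add: add_pos_nonneg)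
    have s: "s > 0" using r den by (simp add: s_def)
    have "s * (norm u + norm v) < s * (2 * (1 + norm u + norm v))"
    proof (rule mult_strict_left_mono[OF _ s])
      show "norm u + norm v < 2 * (1 + norm u + norm v)"
        by (auto simp: add.assoc intro!: add_nonneg_pos)
    qed
    also have "\<dots> = r" using den by (simp add: s_def)
    finally have s2: "s * (norm u + norm v) < r" .
    have ds: "y \<in> ball x r \<Longrightarrow> f differentiable (at y)"
      "y \<in> ball x r \<Longrightarrow> (\<lambda>y. frechet_derivative f (at y) w) differentiable (at y)" for y w
      using r smooth_on_differentiable[OF f] smooth_on_differentiable[OF smooth_on_frechet[OF f]] by blast+
    obtain y1 where y1: "y1 \<in> ball x r" "f (x + s *\<^sub>R u + s *\<^sub>R v) - f (x + s *\<^sub>R u) - f (x + s *\<^sub>R v) + f x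
      = s * s * P y1"
      using second_difference[OF ds s s2] unfolding P_def by blast
    obtain y2 where y2: "y2 \<in> ball x r" "f (x + s *\<^sub>R v + s *\<^sub>R u) - f (x + s *\<^sub>R v) - f (x + s *\<^sub>R u) + f x
      = s * s * Q y2"
      using second_difference[where f=f and u=v and v=u, OF ds s] s2
      unfolding Q_def by (metis add.commute)
    have "f (x + s *\<^sub>R u + s *\<^sub>R v) = f (x + s *\<^sub>R v + s *\<^sub>R u)" by (simp add: ac_simps)
    then have "s * s * P y1 = s * s * Q y2" using y1(2) y2(2) by linarith
    then have "P y1 = Q y2" using s by simp
    moreover have "dist (P y1) (P x) < e" "dist (Q y2) (Q x) < e"
        using r1(2)[of y1] r2(2)[of y2] y1(1) y2(1) by (simp_all add: r_def dist_commute)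
    ultimately show False unfolding e_def by (smt (verit) dist_triangle2 dist_commute field_sum_of_halves)
  qed
  then show ?thesis by (simp add: P_def Q_def)
qed

lemma symmetric_second_derivative:
  fixes f :: "'a::real_normed_vector \<Rightarrow> 'b::euclidean_space"
  assumes S: "open S" "x \<in> S" and f: "smooth_on f S"
  shows "frechet_derivative (\<lambda>y. frechet_derivative f (at y) u) (at x) v
       = frechet_derivative (\<lambda>y. frechet_derivative f (at y) v) (at x) u"
proof (rule euclidean_eqI)
  fix b :: 'b
  have inner: "frechet_derivative (\<lambda>y. g y \<bullet> b) (at y) w = frechet_derivative g (at y) w \<bullet> b"
    if "smooth_on g S" "y \<in> S" for g y w
    using frechet_derivative_eqI[OF has_derivative_inner_left[OF smooth_on_has_derivative[OF that]]] by metis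
  have E: "frechet_derivative (\<lambda>y. frechet_derivative f (at y) u) (at x) v \<bullet> b
     = frechet_derivative (\<lambda>y. frechet_derivative (\<lambda>y. f y \<bullet> b) (at y) u) (at x) v" for u v
    unfolding inner[OF smooth_on_frechet[OF f] S(2), symmetric]
    by (rule fun_cong[OF frechet_derivative_cong_open[OF S]]) (rule inner[OF f, symmetric])
  have sm: "smooth_on (\<lambda>y. f y \<bullet> b) S"
    by (rule smooth_on_bounded_linear_comp[OF S(1) bounded_linear_inner_left f])
  show "frechet_derivative (\<lambda>y. frechet_derivative f (at y) u) (at x) v \<bullet> b
       = frechet_derivative (\<lambda>y. frechet_derivative f (at y) v) (at x) u \<bullet> b"
    unfolding E[of u v] E[of v u] by (rule symmetric_second_derivative_real[OF S sm])
qed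

section \<open>Antisymmetrisation of tensors\<close>

text \<open>The sum is not normalised, so that the wedge product of matrix-valued forms is
  \<open>1 / (p! q!)\<close> times the antisymmetrised tensor product, and identities between forms become
  identities between tensors up to permutations of the slots.\<close>

definition alt :: "nat \<Rightarrow> ((nat \<Rightarrow> 'v) \<Rightarrow> 'b::real_vector) \<Rightarrow> (nat \<Rightarrow> 'v) \<Rightarrow> 'b" where
  "alt N f v = (\<Sum>\<pi> | \<pi> permutes {..<N}. real_of_int (sign \<pi>) *\<^sub>R f (\<lambda>i. v (\<pi> i)))"

text \<open>A tensor of degree \<open>q\<close> is a function of an infinite sequence of vectors that looks at the first \<open>q\<close>
  of them.\<close>

definition depends_on_first :: "nat \<Rightarrow> ((nat \<Rightarrow> 'v) \<Rightarrow> 'b) \<Rightarrow> bool" where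
  "depends_on_first q f \<longleftrightarrow> (\<forall>v w. (\<forall>i<q. v i = w i) \<longrightarrow> f v = f w)"

lemma depends_on_firstD: "depends_on_first q f \<Longrightarrow> (\<And>i. i < q \<Longrightarrow> v i = w i) \<Longrightarrow> f v = f w"
  unfolding depends_on_first_def by blast

lemma finite_permutes_lessThan [simp]: "finite {\<pi>. \<pi> permutes {..<N::nat}}"
  by (simp add: finite_permutations)

lemma permutes_lessThan_permutation: "\<pi> permutes {..<N::nat} \<Longrightarrow> permutation \<pi>"
  by (meson finite_lessThan permutation_permutes)

lemma alt_permute:
  assumes "\<sigma> permutes {..<N}"
  shows "alt N (\<lambda>v. f (\<lambda>i. v (\<sigma> i))) v = real_of_int (sign \<sigma>) *\<^sub>R alt N f v"
proof -
  have s: "real_of_int (sign \<sigma>) * real_of_int (sign \<sigma>) = 1"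
    by (metis of_int_1 of_int_mult sign_idempotent)
  have "alt N f v = (\<Sum>\<pi> | \<pi> permutes {..<N}. real_of_int (sign (\<pi> \<circ> \<sigma>)) *\<^sub>R f (\<lambda>i. v ((\<pi> \<circ> \<sigma>) i)))"
    unfolding alt_def by (rule sum_permutations_compose_right[OF assms])
  also have "\<dots> = (\<Sum>\<pi> | \<pi> permutes {..<N}. real_of_int (sign \<sigma>) *\<^sub>R
      (real_of_int (sign \<pi>) *\<^sub>R f (\<lambda>i. v (\<pi> (\<sigma> i)))))"
    using assms by (intro sum.cong) (auto simp: sign_compose permutes_lessThan_permutation)
  also have "\<dots> = real_of_int (sign \<sigma>) *\<^sub>R alt N (\<lambda>v. f (\<lambda>i. v (\<sigma> i))) v"
    by (simp add: alt_def scaleR_sum_right)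
  finally show ?thesis by (simp add: s)
qed

lemma alt_permute_arg:
  assumes "\<sigma> permutes {..<N}"
  shows "alt N f (\<lambda>i. v (\<sigma> i)) = real_of_int (sign \<sigma>) *\<^sub>R alt N f v"
proof -
  have s: "real_of_int (sign \<sigma>) * real_of_int (sign \<sigma>) = 1"
    by (metis of_int_1 of_int_mult sign_idempotent)
  have "alt N f v = (\<Sum>\<pi> | \<pi> permutes {..<N}. real_of_int (sign (\<sigma> \<circ> \<pi>)) *\<^sub>R f (\<lambda>i. v ((\<sigma> \<circ> \<pi>) i)))"
    unfolding alt_def by (rule setum_permutations_compose_left[OF assms])
  also have "\<dots> = (\<Sum>\<pi> | \<pi> permutes {..<N}. real_of_int (sign \<sigma>) *\<^sub>R
      (real_of_int (sign \<pi>) *\<^sub>R f (\<lambda>i. v (\<sigma> (\<pi> i)))))"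
    using assms by (intro sum.cong) (auto simp: sign_compose permutes_lessThan_permutation)
  also have "\<dots> = real_of_int (sign \<sigma>) *\<^sub>R alt N f (\<lambda>i. v (\<sigma> i))"
    by (simp add: alt_def scaleR_sum_right)
  finally show ?thesis by (simp add: s)
qed

lemma alt_add: "alt N (\<lambda>v. f v + g v) v = alt N f v + alt N g v"
  by (simp add: alt_def scaleR_add_right sum.distrib)
lemma alt_diff: "alt N (\<lambda>v. f v - g v) v = alt N f v - alt N g v"
  by (simp add: alt_def scaleR_diff_right sum_subtractf)
lemma alt_scaleR: "alt N (\<lambda>v. c *\<^sub>R f v) v = c *\<^sub>R alt N f v"
  by (simp add: alt_def scaleR_sum_right ac_simps)
lemma alt_zero [simp]: "alt N (\<lambda>v. 0) v = 0"
  by (simp add: alt_def)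
lemma alt_sum: "alt N (\<lambda>v. \<Sum>i\<in>I. f i v) v = (\<Sum>i\<in>I. alt N (f i) v)"
  by (induction I rule: infinite_finite_induct) (auto simp: alt_add)
lemma alt_linear: "linear L \<Longrightarrow> L (alt N f v) = alt N (\<lambda>v. L (f v)) v"
  by (simp add: alt_def linear_sum linear_cmul)

lemma alt_depends: "depends_on_first N f \<Longrightarrow> depends_on_first N (alt N f)"
  unfolding depends_on_first_def[of N "alt N f"] alt_def
  by (intro allI impI sum.cong refl arg_cong[where f="\<lambda>z. _ *\<^sub>R z"] depends_on_firstD[of N f])
    (auto dest: permutes_in_image[of _ "{..<N}"])

text \<open>A permutation of the first slots, transported to the slots from \<open>p\<close> on.\<close>

definition shift_perm :: "nat \<Rightarrow> (nat \<Rightarrow> nat) \<Rightarrow> nat \<Rightarrow> nat" where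
  "shift_perm p \<sigma> i = (if i < p then i else p + \<sigma> (i - p))"

lemma shift_perm_eq_map:
  assumes "\<sigma> permutes {..<q}"
  shows "shift_perm p \<sigma> = map_permutation {..<q} (\<lambda>i. p + i) \<sigma>"
proof
  fix i
  show "shift_perm p \<sigma> i = map_permutation {..<q} (\<lambda>i. p + i) \<sigma> i"
  proof (cases "i \<in> (\<lambda>i. p + i) ` {..<q}")
    case True
    then obtain j where j: "i = p + j" "j < q" by auto
    then have "map_permutation {..<q} (\<lambda>i. p + i) \<sigma> (p + j) = p + \<sigma> j"
      by (intro map_permutation_apply) auto
    then show ?thesis using j by (simp add: shift_perm_def)
  next
    case False
    then have "i < p \<or> i - p \<ge> q"
      by (metis image_eqI lessThan_iff le_add_diff_inverse not_le)
    then show ?thesis using False permutes_not_in[OF assms, of "i - p"]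
      by (auto simp: shift_perm_def map_permutation_def)
  qed
qed

lemma shift_perm_permutes:
  assumes "\<sigma> permutes {..<q}" "p + q \<le> N"
  shows "shift_perm p \<sigma> permutes {..<N}"
proof -
  have "shift_perm p \<sigma> permutes (\<lambda>i. p + i) ` {..<q}"
    unfolding shift_perm_eq_map[OF assms(1)] by (rule map_permutation_permutes) (use assms in auto)
  then show ?thesis by (rule permutes_subset) (use assms in auto)
qed

lemma sign_shift_perm:
  assumes "\<sigma> permutes {..<q}"
  shows "sign (shift_perm p \<sigma>) = sign \<sigma>"
  unfolding shift_perm_eq_map[OF assms] by (rule sign_map_permutation) (use assms in auto)

text \<open>A permutation of the inner block of slots is absorbed by the outer antisymmetrisation, so that
  antisymmetrising the block first only multiplies by the number of its permutations. Consequently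
  a factor of a product may be replaced, under \<open>alt\<close>, by any tensor with the same antisymmetrisation.\<close>

lemma alt_nested:
  assumes N: "p + q \<le> N" and lin: "\<And>v. linear (B v)"
    and B: "\<And>v w. (\<And>i. i < p \<or> p + q \<le> i \<Longrightarrow> v i = w i) \<Longrightarrow> B v = B w"
  shows "alt N (\<lambda>v. B v (alt q g (\<lambda>i. v (p + i)))) v = fact q *\<^sub>R alt N (\<lambda>v. B v (g (\<lambda>i. v (p + i)))) v"
proof -
  define h where "h v = B v (g (\<lambda>i. v (p + i)))" for v
  have s: "real_of_int (sign \<sigma>) * real_of_int (sign \<sigma>) = 1" for \<sigma> :: "nat \<Rightarrow> nat"
    by (metis of_int_1 of_int_mult sign_idempotent)
  have *: "B v (g (\<lambda>i. v (p + \<sigma> i))) = h (\<lambda>i. v (shift_perm p \<sigma> i))"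
    if "\<sigma> permutes {..<q}" for \<sigma> and v :: "nat \<Rightarrow> 'a"
  proof -
    have "B (\<lambda>i. v (shift_perm p \<sigma> i)) = B v"
      using permutes_not_in[OF that] by (intro B) (auto simp: shift_perm_def)
    then show ?thesis by (simp add: h_def shift_perm_def)
  qed
  have "alt N (\<lambda>v. B v (alt q g (\<lambda>i. v (p + i)))) v
     = alt N (\<lambda>v. \<Sum>\<sigma> | \<sigma> permutes {..<q}. real_of_int (sign \<sigma>) *\<^sub>R h (\<lambda>i. v (shift_perm p \<sigma> i))) v"
    by (simp add: alt_def[of q] linear_sum[OF lin] linear_cmul[OF lin] *)
  also have "\<dots> = (\<Sum>\<sigma> | \<sigma> permutes {..<q}. real_of_int (sign \<sigma>) *\<^sub>R
      alt N (\<lambda>v. h (\<lambda>i. v (shift_perm p \<sigma> i))) v)"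
    by (simp add: alt_sum alt_scaleR)
  also have "\<dots> = (\<Sum>\<sigma> | \<sigma> permutes {..<q}. alt N h v)"
    using N by (intro sum.cong) (auto simp: alt_permute[OF shift_perm_permutes] sign_shift_perm s)
  also have "\<dots> = fact q *\<^sub>R alt N h v"
    by (simp add: sum_constant_scaleR card_permutations[of "{..<q}" q])
  finally show ?thesis by (simp add: h_def[abs_def])
qed

definition rot :: "nat \<Rightarrow> nat \<Rightarrow> nat" where
  "rot N i = (if i < N then Suc i mod N else i)"

lemma rot_Suc: "N > 0 \<Longrightarrow> rot (Suc N) = Transposition.transpose 0 N \<circ> rot N"
  by (auto simp: rot_def fun_eq_iff Transposition.transpose_def mod_if not_less less_Suc_eq)

lemma rot_permutes: "rot N permutes {..<N}"
proof (induction N)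
  case 0
  have "rot 0 = id" by (rule ext) (simp add: rot_def)
  then show ?case using permutes_id by metis
next
  case (Suc N)
  show ?case
  proof (cases "N = 0")
    case True
    then have "rot (Suc N) = id" by (auto simp: rot_def)
    then show ?thesis using permutes_id by metis
  next
    case False
    show ?thesis unfolding rot_Suc[OF False[unfolded neq0_conv]]
      by (intro permutes_compose permutes_subset[OF Suc.IH] permutes_swap_id) auto
  qed
qed

lemma sign_rot: "sign (rot (Suc N)) = (-1) ^ N"
proof (induction N)
  case 0
  have "rot (Suc 0) = id" by (auto simp: rot_def)
  then show ?case by simp
next
  case (Suc N)
  then show ?case
    by (subst rot_Suc) (auto simp: sign_compose permutes_lessThan_permutation[OF rot_permutes]
        permutation_swap_id sign_swap_id)
qed

lemma rot_funpow: "i < N \<Longrightarrow> (rot N ^^ q) i = (i + q) mod N"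
  by (induction q) (auto simp: rot_def mod_Suc_eq)

lemma rot_funpow_permutes: "(rot N ^^ q) permutes {..<N}"
proof (induction q)
  case (Suc q)
  then show ?case unfolding funpow.simps by (rule permutes_compose[OF _ rot_permutes])
next
  case 0
  show ?case unfolding funpow.simps by (rule permutes_id)
qed

lemma sign_rot_funpow: "sign (rot N ^^ q) = sign (rot N) ^ q"
proof (induction q)
  case (Suc q)
  then show ?case unfolding funpow.simps
    by (subst sign_compose) (auto intro: permutes_lessThan_permutation[OF rot_permutes]
     permutes_lessThan_permutation[OF rot_funpow_permutes])
qed simp

text \<open>In contrast to wedge products, tensor products in this form are associative on the nose.\<close>

definition tprod :: "nat \<Rightarrow> ((nat \<Rightarrow> 'v) \<Rightarrow> real^'r::finite^'r) \<Rightarrow> ((nat \<Rightarrow> 'v) \<Rightarrow> real^'r^'r) \<Rightarrow> (nat \<Rightarrow> 'v) \<Rightarrow> real^'r^'r" where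
  "tprod p \<alpha> \<beta> v = \<alpha> v ** \<beta> (\<lambda>i. v (p + i))"

lemma tprod_assoc: "tprod (p + q) (tprod p \<alpha> \<beta>) \<gamma> = tprod p \<alpha> (tprod q \<beta> \<gamma>)"
  by (simp add: tprod_def fun_eq_iff matrix_mul_assoc add.assoc)

lemma tprod_diff_left: "tprod p (\<lambda>v. f v - g v) \<beta> = (\<lambda>v. tprod p f \<beta> v - tprod p g \<beta> v)"
  by (simp add: tprod_def fun_eq_iff bounded_bilinear.diff_left[OF bounded_bilinear_matrix_mult])
lemma tprod_diff_right: "tprod p \<beta> (\<lambda>v. f v - g v) = (\<lambda>v. tprod p \<beta> f v - tprod p \<beta> g v)"
  by (simp add: tprod_def fun_eq_iff bounded_bilinear.diff_right[OF bounded_bilinear_matrix_mult])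
lemma tprod_add_left: "tprod p (\<lambda>v. f v + g v) \<beta> = (\<lambda>v. tprod p f \<beta> v + tprod p g \<beta> v)"
  by (simp add: tprod_def fun_eq_iff bounded_bilinear.add_left[OF bounded_bilinear_matrix_mult])
lemma tprod_add_right: "tprod p \<beta> (\<lambda>v. f v + g v) = (\<lambda>v. tprod p \<beta> f v + tprod p \<beta> g v)"
  by (simp add: tprod_def fun_eq_iff bounded_bilinear.add_right[OF bounded_bilinear_matrix_mult])

lemma tprod_depends:
  assumes "depends_on_first p \<alpha>" "depends_on_first q \<beta>"
  shows "depends_on_first (p + q) (tprod p \<alpha> \<beta>)"
  unfolding depends_on_first_def tprod_def
proof (intro allI impI)
  fix v w :: "nat \<Rightarrow> 'a" assume e: "\<forall>i<p + q. v i = w i"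
  have "\<alpha> v = \<alpha> w" by (rule depends_on_firstD[OF assms(1)]) (use e in auto)
  moreover have "\<beta> (\<lambda>i. v (p + i)) = \<beta> (\<lambda>i. w (p + i))"
    by (rule depends_on_firstD[OF assms(2)]) (use e in auto)
  ultimately show "\<alpha> v ** \<beta> (\<lambda>i. v (p + i)) = \<alpha> w ** \<beta> (\<lambda>i. w (p + i))" by simp
qed

lemma matrix_mult_linear_right: "linear (\<lambda>X::real^'r::finite^'r. Y ** X)"
  using bounded_bilinear.bounded_linear_right[OF bounded_bilinear_matrix_mult] bounded_linear.linear by blast
lemma matrix_mult_linear_left: "linear (\<lambda>X::real^'r::finite^'r. X ** Y)"
  using bounded_bilinear.bounded_linear_left[OF bounded_bilinear_matrix_mult] bounded_linear.linear by blast
lemma linear_trace: "linear (trace :: real^'r::finite^'r \<Rightarrow> real)"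
  by (simp add: bounded_linear.linear bounded_linear_trace)

lemma alt_tprod_alt_right:
  assumes "depends_on_first p \<alpha>"
  shows "alt (p + q) (tprod p \<alpha> (alt q g)) v = fact q *\<^sub>R alt (p + q) (tprod p \<alpha> g) v"
  unfolding tprod_def[abs_def]
  by (rule alt_nested[where B="\<lambda>v X. \<alpha> v ** X"])
    (auto intro: matrix_mult_linear_right depends_on_firstD[OF assms] arg_cong[where f="\<lambda>z. (\<lambda>X. z ** X)"])

lemma alt_tprod_alt_left:
  fixes g \<beta> :: "(nat \<Rightarrow> 'v) \<Rightarrow> real^'r::finite^'r"
  shows "alt (p + q) (tprod p (alt p g) \<beta>) v = fact p *\<^sub>R alt (p + q) (tprod p g \<beta>) v"
proof -
  define B where "B v X = X ** \<beta> (\<lambda>i. v (p + i))" for v and X :: "real^'r^'r"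
  have "alt (p + q) (\<lambda>v. B v (alt p g (\<lambda>i. v (0 + i)))) v
      = fact p *\<^sub>R alt (p + q) (\<lambda>v. B v (g (\<lambda>i. v (0 + i)))) v"
  proof (rule alt_nested)
    show "linear (B v)" for v unfolding B_def[abs_def] by (rule matrix_mult_linear_left)
    show "B v = B w" if "\<And>i. i < 0 \<or> 0 + p \<le> i \<Longrightarrow> v i = w i" for v w
      using that by (simp add: B_def[abs_def])
  qed simp
  then show ?thesis by (simp add: B_def tprod_def[abs_def])
qed

lemma alt_tprod_cong_right:
  assumes "depends_on_first p \<alpha>" "\<And>v. alt q g v = alt q h v"
  shows "alt (p + q) (tprod p \<alpha> g) v = alt (p + q) (tprod p \<alpha> h) v"
proof -
  have "alt q g = alt q h" using assms(2) by auto
  then have "fact q *\<^sub>R alt (p + q) (tprod p \<alpha> g) v = fact q *\<^sub>R alt (p + q) (tprod p \<alpha> h) v"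
    using alt_tprod_alt_right[OF assms(1)] by metis
  then show ?thesis by simp
qed

lemma alt_tprod_cong_left:
  assumes "\<And>v. alt p g v = alt p h v"
  shows "alt (p + q) (tprod p g \<beta>) v = alt (p + q) (tprod p h \<beta>) v"
proof -
  have "alt p g = alt p h" using assms by auto
  then have "fact p *\<^sub>R alt (p + q) (tprod p g \<beta>) v = fact p *\<^sub>R alt (p + q) (tprod p h \<beta>) v"
    using alt_tprod_alt_left by metis
  then show ?thesis by simp
qed

text \<open>Graded cyclicity of the trace: the sign is that of the rotation that carries the last \<open>q\<close> slots to
  the front.\<close>

lemma alt_trace_cyclic:
  assumes \<alpha>: "depends_on_first p \<alpha>" and \<beta>: "depends_on_first q \<beta>"
  shows "trace (alt (p + q) (tprod p \<alpha> \<beta>) v) = (-1) ^ (p * q) * trace (alt (p + q) (tprod q \<beta> \<alpha>) v)"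
proof -
  let ?N = "p + q"
  let ?\<rho> = "rot ?N ^^ q"
  define f where "f v = trace (tprod p \<alpha> \<beta> v)" for v
  have "f (\<lambda>i. v (?\<rho> i)) = trace (tprod q \<beta> \<alpha> v)" for v
  proof -
    have "\<alpha> (\<lambda>i. v (?\<rho> i)) = \<alpha> (\<lambda>i. v (q + i))"
      by (rule depends_on_firstD[OF \<alpha>]) (simp add: rot_funpow ac_simps)
    moreover have "\<beta> (\<lambda>i. v (?\<rho> (p + i))) = \<beta> v"
    proof (rule depends_on_firstD[OF \<beta>])
      fix i assume "i < q"
      then have "(p + i + q) mod (p + q) = i"
        by (metis add.commute add.left_commute mod_add_self2 mod_less trans_less_add2)
      then show "v (?\<rho> (p + i)) = v i" using \<open>i < q\<close> by (simp add: rot_funpow)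
    qed
    ultimately have "f (\<lambda>i. v (?\<rho> i)) = trace (\<alpha> (\<lambda>i. v (q + i)) ** \<beta> v)"
      by (simp only: f_def tprod_def)
    also have "\<dots> = trace (\<beta> v ** \<alpha> (\<lambda>i. v (q + i)))" by (rule trace_mul_sym)
    finally show ?thesis by (simp only: tprod_def)
  qed
  then have "alt ?N (\<lambda>v. trace (tprod q \<beta> \<alpha> v)) v = real_of_int (sign ?\<rho>) *\<^sub>R alt ?N f v"
    using alt_permute[OF rot_funpow_permutes[where N="?N" and q=q], of f v] by simp
  moreover have "sign ?\<rho> = (-1) ^ (p * q)"
  proof (cases ?N)
    case 0
    then show ?thesis by (simp add: id_def)
  next
    case (Suc M)
    \<comment> \<open>one rotation step of \<open>p + q = M + 1\<close> slots has the sign \<open>(-1)\<^sup>M\<close>, and \<open>q (q - 1)\<close> is even\<close>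
    have "(-1::int) ^ (M * q) = (-1) ^ (p * q)"
    proof (cases "even q")
      case False
      then have "even M \<longleftrightarrow> even p" using Suc by presburger
      then show ?thesis using False by (simp add: minus_one_power_iff)
    qed simp
    then show ?thesis using Suc sign_rot[of M] by (simp add: sign_rot_funpow power_mult)
  qed
  ultimately have "alt ?N (\<lambda>v. trace (tprod q \<beta> \<alpha> v)) v = (-1) ^ (p * q) * alt ?N f v"
    by simp
  then have "alt ?N f v = (-1) ^ (p * q) * alt ?N (\<lambda>v. trace (tprod q \<beta> \<alpha> v)) v"
    by (simp add: mult.assoc[symmetric] flip: power_mult_distrib)
  then show ?thesis by (simp add: alt_linear[OF linear_trace] f_def[abs_def])
qed

primrec tpow :: "nat \<Rightarrow> ((nat \<Rightarrow> 'v) \<Rightarrow> real^'r::finite^'r) \<Rightarrow> (nat \<Rightarrow> 'v) \<Rightarrow> real^'r^'r" where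
  "tpow 0 \<Phi> = (\<lambda>v. mat 1)"
| "tpow (Suc m) \<Phi> = tprod 2 \<Phi> (tpow m \<Phi>)"

lemma tpow_depends: "depends_on_first 2 \<Phi> \<Longrightarrow> depends_on_first (2 * m) (tpow m \<Phi>)"
proof (induction m)
  case (Suc m)
  then show ?case using tprod_depends[of 2 \<Phi> "2 * m" "tpow m \<Phi>"] by simp
qed (auto simp: depends_on_first_def)

lemma tpow_Suc_right: "tpow (Suc m) \<Phi> = tprod (2 * m) (tpow m \<Phi>) \<Phi>"
proof (induction m)
  case 0
  show ?case by (simp add: tprod_def fun_eq_iff)
next
  case (Suc m)
  have "tpow (Suc (Suc m)) \<Phi> = tprod 2 \<Phi> (tprod (2 * m) (tpow m \<Phi>) \<Phi>)"
    using Suc by simp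
  also have "\<dots> = tprod (2 + 2 * m) (tprod 2 \<Phi> (tpow m \<Phi>)) \<Phi>"
    by (rule tprod_assoc[symmetric])
  finally show ?case by (simp only: tpow.simps mult_Suc_right)
qed

lemma mwedge_eq_alt:
  fixes \<alpha> \<beta> :: "(nat \<Rightarrow> 'v) \<Rightarrow> real^'r::finite^'r"
  shows "mwedge p q \<alpha> \<beta> v = (1 / (fact p * fact q)) *\<^sub>R alt (p + q) (tprod p \<alpha> \<beta>) v"
  by (simp add: mwedge_def alt_def tprod_def)

text \<open>The factors \<open>1/2\<close> in the wedge powers of a 2-form disappear when the 2-form itself is written as an
  antisymmetrisation.\<close>

lemma mwpower_alt:
  assumes "depends_on_first 2 \<Phi>"
  shows "mwpower m (alt 2 \<Phi>) = alt (2 * m) (tpow m \<Phi>)"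
proof (induction m)
  case 0
  have "{\<pi>. \<pi> permutes {..<0::nat}} = {id}" by auto
  then show ?case by (simp add: fun_eq_iff alt_def)
next
  case (Suc m)
  show ?case
  proof
    fix v
    have "mwpower (Suc m) (alt 2 \<Phi>) v = (1 / (fact 2 * fact (2 * m))) *\<^sub>R
        alt (2 + 2 * m) (tprod 2 (alt 2 \<Phi>) (alt (2 * m) (tpow m \<Phi>))) v"
      using Suc by (simp add: mwedge_eq_alt)
    also have "\<dots> = alt (2 + 2 * m) (tprod 2 \<Phi> (tpow m \<Phi>)) v"
      by (subst alt_tprod_alt_right[OF alt_depends[OF assms]], subst alt_tprod_alt_left) simp
    finally show "mwpower (Suc m) (alt 2 \<Phi>) v = alt (2 * Suc m) (tpow (Suc m) \<Phi>) v"
      by (simp only: tpow.simps mult_Suc_right)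
  qed
qed

section \<open>The exterior derivative of an antisymmetrised tensor\<close>

text \<open>The derivative in the direction of the first slot. Antisymmetrised, it is the exterior derivative
  (\<open>ext_deriv_alt\<close> below).\<close>

definition front_deriv :: "(real^'n::finite \<Rightarrow> (nat \<Rightarrow> real^'n) \<Rightarrow> 'b::real_normed_vector) \<Rightarrow> real^'n \<Rightarrow> (nat \<Rightarrow> real^'n) \<Rightarrow> 'b" where
  "front_deriv f x v = frechet_derivative (\<lambda>y. f y (\<lambda>i. v (Suc i))) (at x) (v 0)"

lemma front_deriv_linear:
  assumes "bounded_linear L" "\<And>v. (\<lambda>y. f y v) differentiable (at x)"
  shows "front_deriv (\<lambda>y v. L (f y v)) x v = L (front_deriv f x v)"
proof -
  have "((\<lambda>y. f y (\<lambda>i. v (Suc i))) has_derivative frechet_derivative (\<lambda>y. f y (\<lambda>i. v (Suc i))) (at x)) (at x)"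
    using assms(2) frechet_derivative_works by blast
  from frechet_derivative_eqI[OF bounded_linear.has_derivative[OF assms(1) this]]
  show ?thesis by (simp add: front_deriv_def)
qed

text \<open>The Leibniz rule. In the second term the direction of differentiation is carried past the \<open>p\<close>
  slots of \<open>\<alpha>\<close> by a rotation of \<open>p + 1\<close> slots, which accounts for the sign.\<close>

lemma alt_front_deriv_tprod:
  assumes N: "p < N" and dep: "depends_on_first p (\<alpha> x)"
    and d: "\<And>v. (\<lambda>y. \<alpha> y v) differentiable (at x)" "\<And>v. (\<lambda>y. \<beta> y v) differentiable (at x)"
  shows "alt N (front_deriv (\<lambda>y. tprod p (\<alpha> y) (\<beta> y)) x) v
     = alt N (tprod (Suc p) (front_deriv \<alpha> x) (\<beta> x)) v + (-1) ^ p *\<^sub>R alt N (tprod p (\<alpha> x) (front_deriv \<beta> x)) v"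
proof -
  have *: "front_deriv (\<lambda>y. tprod p (\<alpha> y) (\<beta> y)) x v
     = tprod (Suc p) (front_deriv \<alpha> x) (\<beta> x) v + tprod p (\<alpha> x) (front_deriv \<beta> x) (\<lambda>i. v (rot (Suc p) i))" for v
  proof -
    have a: "((\<lambda>y. \<alpha> y (\<lambda>i. v (Suc i))) has_derivative frechet_derivative (\<lambda>y. \<alpha> y (\<lambda>i. v (Suc i))) (at x)) (at x)"
      and b: "((\<lambda>y. \<beta> y (\<lambda>i. v (Suc (p + i)))) has_derivative frechet_derivative (\<lambda>y. \<beta> y (\<lambda>i. v (Suc (p + i)))) (at x)) (at x)"
      using d frechet_derivative_works by blast+
    have "\<alpha> x (\<lambda>i. v (rot (Suc p) i)) = \<alpha> x (\<lambda>i. v (Suc i))"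
      by (rule depends_on_firstD[OF dep]) (simp add: rot_def)
    then show ?thesis
      using frechet_derivative_eqI[OF has_derivative_matrix_mult[OF a b]]
      by (simp add: front_deriv_def tprod_def rot_def add.commute)
  qed
  have "alt N (\<lambda>v. tprod p (\<alpha> x) (front_deriv \<beta> x) (\<lambda>i. v (rot (Suc p) i))) v
     = (-1) ^ p *\<^sub>R alt N (tprod p (\<alpha> x) (front_deriv \<beta> x)) v"
    using N by (subst alt_permute[OF permutes_subset[OF rot_permutes]]) (auto simp: sign_rot)
  then show ?thesis
    by (simp add: *[abs_def] alt_add)
qed

text \<open>Moves slot \<open>i\<close> to the front and keeps the order of the others; this is the rearrangement that occurs
  in the definition of \<open>ext_deriv\<close>.\<close>

definition front_perm :: "nat \<Rightarrow> nat \<Rightarrow> nat" where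
  "front_perm i = inv (rot (Suc i))"

lemma front_perm_simps: "front_perm i 0 = i" "front_perm i (Suc m) = (if m < i then m else Suc m)"
proof -
  have inj: "inj (rot (Suc i))" using rot_permutes permutes_inj by blast
  show "front_perm i 0 = i"
    unfolding front_perm_def by (rule inv_f_eq[OF inj]) (simp add: rot_def)
  show "front_perm i (Suc m) = (if m < i then m else Suc m)"
    unfolding front_perm_def by (rule inv_f_eq[OF inj]) (auto simp: rot_def)
qed

lemma front_perm_permutes: "i \<le> q \<Longrightarrow> front_perm i permutes {..<Suc q}"
  unfolding front_perm_def by (intro permutes_inv permutes_subset[OF rot_permutes]) auto

lemma sign_front_perm: "sign (front_perm i) = (-1) ^ i"
  unfolding front_perm_def
  by (simp add: sign_inverse permutes_lessThan_permutation[OF rot_permutes] sign_rot)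

text \<open>A permutation of \<open>q + 1\<close> slots is determined by the image \<open>i\<close> of the first slot and a permutation of
  the others. Injectivity of this parametrisation suffices, as both sides have \<open>(q + 1)!\<close> terms.\<close>

lemma sum_permutations_front:
  "sum g {\<pi>. \<pi> permutes {..<Suc q}}
     = (\<Sum>i\<le>q. \<Sum>\<sigma> | \<sigma> permutes {..<q}. g (front_perm i \<circ> shift_perm 1 \<sigma>))"
proof -
  let ?P = "{..q} \<times> {\<sigma>. \<sigma> permutes {..<q}}"
  let ?f = "\<lambda>(i, \<sigma>). front_perm i \<circ> shift_perm 1 \<sigma>"
  have inj: "inj_on ?f ?P"
  proof (rule inj_onI, clarsimp)
    fix i \<sigma> j \<tau>
    assume a: "i \<le> q" "j \<le> q" "\<sigma> permutes {..<q}" "\<tau> permutes {..<q}"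
      and e: "front_perm i \<circ> shift_perm (Suc 0) \<sigma> = front_perm j \<circ> shift_perm (Suc 0) \<tau>"
    have ij: "i = j" using fun_cong[OF e, of 0] by (simp add: shift_perm_def front_perm_simps)
    have "inj (front_perm i)" using front_perm_permutes[OF a(1)] permutes_inj by blast
    then have "shift_perm (Suc 0) \<sigma> (Suc m) = shift_perm (Suc 0) \<tau> (Suc m)" for m
      using fun_cong[OF e, of "Suc m"] by (auto simp: ij dest: injD)
    then show "i = j \<and> \<sigma> = \<tau>" using ij by (auto simp: shift_perm_def)
  qed
  have sub: "?f ` ?P \<subseteq> {\<pi>. \<pi> permutes {..<Suc q}}"
    by (auto intro!: permutes_compose front_perm_permutes shift_perm_permutes[where q=q])
  have "card (?f ` ?P) = card {\<pi>. \<pi> permutes {..<Suc q}}"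
    unfolding card_image[OF inj]
    by (simp add: card_cartesian_product card_permutations[of _ q] card_permutations[of _ "Suc q"])
  then have eq: "?f ` ?P = {\<pi>. \<pi> permutes {..<Suc q}}"
    by (intro card_subset_eq sub) auto
  have "sum g {\<pi>. \<pi> permutes {..<Suc q}} = sum (g \<circ> ?f) ?P"
    unfolding eq[symmetric] by (rule sum.reindex[OF inj])
  also have "\<dots> = (\<Sum>i\<le>q. \<Sum>\<sigma> | \<sigma> permutes {..<q}. g (front_perm i \<circ> shift_perm 1 \<sigma>))"
    by (simp add: sum.cartesian_product split_def)
  finally show ?thesis .
qed

lemma ext_deriv_alt:
  assumes "\<And>v. (\<lambda>y. f y v) differentiable (at x)"
  shows "ext_deriv q (\<lambda>y. alt q (f y)) x v = alt (Suc q) (front_deriv f x) v"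
proof -
  have D: "frechet_derivative (\<lambda>y. alt q (f y) w) (at x) u
      = (\<Sum>\<sigma> | \<sigma> permutes {..<q}. real_of_int (sign \<sigma>) *\<^sub>R frechet_derivative (\<lambda>y. f y (\<lambda>i. w (\<sigma> i))) (at x) u)" for w u
  proof -
    have "((\<lambda>y. alt q (f y) w) has_derivative (\<lambda>u. \<Sum>\<sigma> | \<sigma> permutes {..<q}.
      real_of_int (sign \<sigma>) *\<^sub>R frechet_derivative (\<lambda>y. f y (\<lambda>i. w (\<sigma> i))) (at x) u)) (at x)"
      unfolding alt_def
      by (intro has_derivative_sum has_derivative_scaleR_right) (use assms frechet_derivative_works in blast)
    from frechet_derivative_eqI[OF this] show ?thesis by simp
  qed
  have "alt (Suc q) (front_deriv f x) v = (\<Sum>i\<le>q. \<Sum>\<sigma> | \<sigma> permutes {..<q}.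
      real_of_int (sign (front_perm i \<circ> shift_perm 1 \<sigma>)) *\<^sub>R
        front_deriv f x (\<lambda>m. v ((front_perm i \<circ> shift_perm 1 \<sigma>) m)))"
    unfolding alt_def by (rule sum_permutations_front)
  also have "\<dots> = (\<Sum>i\<le>q. \<Sum>\<sigma> | \<sigma> permutes {..<q}. (-1) ^ i *\<^sub>R real_of_int (sign \<sigma>) *\<^sub>R
      frechet_derivative (\<lambda>y. f y (\<lambda>m. v (if \<sigma> m < i then \<sigma> m else Suc (\<sigma> m)))) (at x) (v i))"
  proof (intro sum.cong refl)
    fix i \<sigma> assume a: "i \<in> {..q}" "\<sigma> \<in> {\<sigma>. \<sigma> permutes {..<q}}"
    have "sign (front_perm i \<circ> shift_perm 1 \<sigma>) = sign (front_perm i) * sign (shift_perm 1 \<sigma>)"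
      using a by (intro sign_compose permutes_lessThan_permutation[OF front_perm_permutes[of i q]]
        permutes_lessThan_permutation[OF shift_perm_permutes[of _ q _ "Suc q"]]) auto
    also have "\<dots> = (-1) ^ i * sign \<sigma>"
      using a by (simp add: sign_front_perm sign_shift_perm[of \<sigma> q])
    finally have sg: "real_of_int (sign (front_perm i \<circ> shift_perm 1 \<sigma>)) = (-1) ^ i * real_of_int (sign \<sigma>)"
      by simp
    show "real_of_int (sign (front_perm i \<circ> shift_perm 1 \<sigma>)) *\<^sub>R
        front_deriv f x (\<lambda>m. v ((front_perm i \<circ> shift_perm 1 \<sigma>) m)) = (-1) ^ i *\<^sub>R real_of_int (sign \<sigma>) *\<^sub>R
      frechet_derivative (\<lambda>y. f y (\<lambda>m. v (if \<sigma> m < i then \<sigma> m else Suc (\<sigma> m)))) (at x) (v i)"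
      unfolding sg by (simp add: front_deriv_def shift_perm_def front_perm_simps)
  qed
  also have "\<dots> = ext_deriv q (\<lambda>y. alt q (f y)) x v"
    unfolding ext_deriv_def D by (simp add: scaleR_sum_right)
  finally show ?thesis by simp
qed

section \<open>The Bianchi identity and transgression\<close>

text \<open>The tensor \<open>dA + A \<otimes> A\<close>, whose antisymmetrisation is the curvature.\<close>

definition precurv :: "('n::finite, 'r::finite) conn_form \<Rightarrow> real^'n \<Rightarrow> (nat \<Rightarrow> real^'n) \<Rightarrow> real^'r^'r" where
  "precurv A x v = frechet_derivative (\<lambda>y. A y (v 1)) (at x) (v 0) + A x (v 0) ** A x (v 1)"

definition one_form :: "('n::finite, 'r::finite) conn_form \<Rightarrow> real^'n \<Rightarrow> (nat \<Rightarrow> real^'n) \<Rightarrow> real^'r^'r" where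
  "one_form A x v = A x (v 0)"

lemma one_form_depends: "depends_on_first 1 (one_form A x)"
  by (simp add: depends_on_first_def one_form_def)

lemma precurv_depends: "depends_on_first 2 (precurv A x)"
  by (simp add: depends_on_first_def precurv_def)

lemma front_deriv_one_form: "front_deriv (one_form A) x v = frechet_derivative (\<lambda>y. A y (v 1)) (at x) (v 0)"
  by (simp add: front_deriv_def one_form_def)

lemma precurv_eq: "precurv A x = (\<lambda>v. front_deriv (one_form A) x v + tprod 1 (one_form A x) (one_form A x) v)"
  by (simp add: fun_eq_iff precurv_def tprod_def front_deriv_one_form) (simp add: one_form_def)

lemma alt_1: "alt 1 f = f"
proof -
  have "{\<pi>. \<pi> permutes {..<1::nat}} = {id}" by (auto simp: lessThan_Suc permutes_sing)
  then show ?thesis by (simp add: fun_eq_iff alt_def)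
qed

lemma alt_2:
  assumes "depends_on_first 2 f"
  shows "alt 2 f v = f v - f (\<lambda>i. v (1 - i))"
proof -
  have s: "{\<pi>. \<pi> permutes {..<Suc 0}} = {id}" by (auto simp: lessThan_Suc permutes_sing)
  have z: "shift_perm (Suc 0) id = id" by (auto simp: shift_perm_def fun_eq_iff)
  have "alt (Suc 1) f v = f (\<lambda>i. v (front_perm 0 i)) - f (\<lambda>i. v (front_perm 1 i))"
    unfolding alt_def sum_permutations_front
    by (simp add: s z sign_front_perm)
  moreover have "f (\<lambda>i. v (front_perm 0 i)) = f v" "f (\<lambda>i. v (front_perm 1 i)) = f (\<lambda>i. v (1 - i))"
    by (rule depends_on_firstD[OF assms], auto simp: less_2_cases_iff front_perm_simps(1) front_perm_simps(2)[of _ 0, simplified])+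
  ultimately show ?thesis by (simp add: numeral_2_eq_2)
qed

lemma curvature_eq_alt:
  assumes "\<And>u. (\<lambda>y. A y u) differentiable (at x)"
  shows "curvature A x = alt 2 (precurv A x)"
proof
  fix v
  have "ext_deriv 1 (\<lambda>y. alt 1 (one_form A y)) x v = alt (Suc 1) (front_deriv (one_form A) x) v"
    by (rule ext_deriv_alt) (simp add: one_form_def assms)
  then have "ext_deriv 1 (one_form A) x v = alt (Suc 1) (front_deriv (one_form A) x) v"
    unfolding alt_1 .
  moreover have "mwedge 1 1 (one_form A x) (one_form A x) v = alt 2 (tprod 1 (one_form A x) (one_form A x)) v"
    by (simp add: mwedge_eq_alt numeral_2_eq_2)
  ultimately show "curvature A x v = alt 2 (precurv A x) v"
    unfolding curvature_def precurv_eq alt_add one_form_def by (simp add: numeral_2_eq_2)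
qed

lemma curvature_explicit:
  assumes "\<And>u. (\<lambda>y. A y u) differentiable (at x)"
  shows "curvature A x v = frechet_derivative (\<lambda>y. A y (v 1)) (at x) (v 0)
     - frechet_derivative (\<lambda>y. A y (v 0)) (at x) (v 1)
     + A x (v 0) ** A x (v 1) - A x (v 1) ** A x (v 0)"
  unfolding curvature_eq_alt[OF assms] alt_2[OF precurv_depends] by (simp add: precurv_def)

lemma alt_vanish:
  assumes "\<sigma> permutes {..<N}" "sign \<sigma> = -1" "\<And>v. f (\<lambda>i. v (\<sigma> i)) = f v"
  shows "alt N f v = (0::'b::real_vector)"
proof -
  have "(\<lambda>v. f (\<lambda>i. v (\<sigma> i))) = f" by (rule ext) (rule assms(3))
  then have *: "alt N f v = - alt N f v"
    using alt_permute[OF assms(1), of f v] unfolding assms(2) by simp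
  have "2 *\<^sub>R alt N f v = alt N f v + alt N f v" by (rule scaleR_2)
  also have "\<dots> = alt N f v + - alt N f v" by (rule arg_cong[OF *])
  finally have "2 *\<^sub>R alt N f v = 0" by simp
  then show ?thesis by simp
qed

lemma smooth_on_one_form: "(\<And>u. smooth_on (\<lambda>y. A y u) U) \<Longrightarrow> smooth_on (\<lambda>y. one_form A y v) U"
  by (simp add: one_form_def)

lemma smooth_on_precurv:
  assumes "open U" "\<And>u. smooth_on (\<lambda>y. A y u) U"
  shows "smooth_on (\<lambda>y. precurv A y v) U"
  unfolding precurv_def
  by (intro smooth_on_add smooth_on_frechet smooth_on_matrix_mult assms)

lemma smooth_on_tpow:
  assumes "open U" "\<And>v. smooth_on (\<lambda>y. \<Phi> y v) U"
  shows "smooth_on (\<lambda>y. tpow m (\<Phi> y) v) U"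
  by (induction m arbitrary: v) (auto simp: tprod_def assms intro!: smooth_on_matrix_mult)

lemma smooth_on_alt:
  assumes "open U" "\<And>v. smooth_on (\<lambda>y. f y v) U"
  shows "smooth_on (\<lambda>y. alt N (f y) v) U"
  unfolding alt_def by (intro smooth_on_sum smooth_on_scaleR assms)

lemma smooth_on_tprod:
  assumes "open U" "\<And>v. smooth_on (\<lambda>y. f y v) U" "\<And>v. smooth_on (\<lambda>y. g y v) U"
  shows "smooth_on (\<lambda>y. tprod p (f y) (g y) v) U"
  unfolding tprod_def by (intro smooth_on_matrix_mult assms)

context
  fixes U :: "(real^'n::finite) set" and A :: "('n, 'r::finite) conn_form" and x :: "real^'n"
  assumes U: "open U" and x: "x \<in> U" and sm: "\<And>u. smooth_on (\<lambda>y. A y u) U"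
begin

text \<open>The second derivatives of \<open>A\<close> are symmetric in two slots and are killed by the antisymmetrisation.
  The Leibniz rule leaves \<open>dA A - A dA\<close>, which is the commutator of \<open>F\<close> and \<open>A\<close> because the cubic terms
  cancel.\<close>

lemma bianchi:
  "alt 3 (front_deriv (precurv A) x) v = alt 3 (tprod 2 (precurv A x) (one_form A x)) v
     - alt 3 (tprod 1 (one_form A x) (precurv A x)) v"
proof -
  let ?a = "one_form A"
  have d1: "\<And>v. (\<lambda>y. ?a y v) differentiable (at x)"
    using smooth_on_differentiable[OF smooth_on_one_form[OF sm] x] .
  have d2: "(\<lambda>y. front_deriv ?a y v) differentiable (at x)" for v
    unfolding front_deriv_one_form by (rule smooth_on_differentiable[OF smooth_on_frechet[OF sm] x])
  have d3: "(\<lambda>y. tprod 1 (?a y) (?a y) v) differentiable (at x)" for v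
    by (rule smooth_on_differentiable[OF smooth_on_tprod[OF U smooth_on_one_form[OF sm] smooth_on_one_form[OF sm]] x])
  have split: "front_deriv (precurv A) x v = front_deriv (front_deriv ?a) x v + front_deriv (\<lambda>y. tprod 1 (?a y) (?a y)) x v" for v
  proof -
    have "((\<lambda>y. precurv A y (\<lambda>i. v (Suc i))) has_derivative
      (\<lambda>w. frechet_derivative (\<lambda>y. front_deriv ?a y (\<lambda>i. v (Suc i))) (at x) w
         + frechet_derivative (\<lambda>y. tprod 1 (?a y) (?a y) (\<lambda>i. v (Suc i))) (at x) w)) (at x)"
      unfolding precurv_eq
      by (intro has_derivative_add) (use d2 d3 frechet_derivative_works in blast)+
    from frechet_derivative_eqI[OF this] show ?thesis by (simp only: front_deriv_def)
  qed
  have dd: "alt 3 (front_deriv (front_deriv ?a) x) v = 0"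
  proof (rule alt_vanish[where \<sigma>="Transposition.transpose 0 1"])
    show "Transposition.transpose 0 1 permutes {..<3::nat}" by (intro permutes_swap_id) auto
    show "sign (Transposition.transpose 0 (1::nat)) = - 1" by (simp add: sign_swap_id)
    fix v :: "nat \<Rightarrow> real^'n"
    show "front_deriv (front_deriv ?a) x (\<lambda>i. v (Transposition.transpose 0 1 i)) = front_deriv (front_deriv ?a) x v"
      unfolding front_deriv_def[of "front_deriv ?a"] front_deriv_one_form
      using symmetric_second_derivative[OF U x sm[of "v 2"], of "v 0" "v 1"]
      by (simp add: Transposition.transpose_def numeral_2_eq_2)
  qed
  have tp: "alt 3 (front_deriv (\<lambda>y. tprod 1 (?a y) (?a y)) x) v
     = alt 3 (tprod 2 (front_deriv ?a x) (?a x)) v - alt 3 (tprod 1 (?a x) (front_deriv ?a x)) v"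
    using alt_front_deriv_tprod[of 1 3 ?a x ?a v, OF _ one_form_depends d1 d1] by (simp add: numeral_2_eq_2)
  have as: "tprod 2 (tprod 1 (?a x) (?a x)) (?a x) = tprod 1 (?a x) (tprod 1 (?a x) (?a x))"
    using tprod_assoc[of 1 1 "?a x" "?a x" "?a x"] by (simp add: numeral_2_eq_2)
  have "alt 3 (front_deriv (precurv A) x) v = alt 3 (front_deriv (\<lambda>y. tprod 1 (?a y) (?a y)) x) v"
    unfolding split[abs_def] alt_add dd by simp
  moreover have "alt 3 (tprod 2 (precurv A x) (?a x)) v - alt 3 (tprod 1 (?a x) (precurv A x)) v
     = alt 3 (tprod 2 (front_deriv ?a x) (?a x)) v - alt 3 (tprod 1 (?a x) (front_deriv ?a x)) v"
    unfolding precurv_eq tprod_add_left tprod_add_right alt_add as by simp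
  ultimately show ?thesis unfolding tp by simp
qed

lemma differentiable_tpow_precurv: "(\<lambda>y. tpow m (precurv A y) v) differentiable (at x)"
  by (rule smooth_on_differentiable[OF smooth_on_tpow[OF U smooth_on_precurv[OF U sm]] x])

text \<open>By the Leibniz rule and the Bianchi identity, a sum of commutators of \<open>A\<close> with the single factors;
  it telescopes to the commutator with the whole power.\<close>

lemma alt_front_deriv_tpow:
  "alt (2 * m + 1) (front_deriv (\<lambda>y. tpow m (precurv A y)) x) v
     = alt (2 * m + 1) (tprod (2 * m) (tpow m (precurv A x)) (one_form A x)) v
       - alt (2 * m + 1) (tprod 1 (one_form A x) (tpow m (precurv A x))) v"
proof (induction m arbitrary: v)
  case 0
  show ?case by (simp add: front_deriv_def[abs_def] tprod_def[abs_def] one_form_def)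
next
  case (Suc m)
  let ?P = "precurv A x" and ?a = "one_form A x" and ?N = "2 * Suc m + 1"
  let ?T = "tpow m ?P"
  have N: "3 + 2 * m = ?N" "2 + (2 * m + 1) = ?N" and three: "1 + 2 = (3::nat)" "2 + 1 = (3::nat)"
    by simp_all
  have dP: "\<And>v. (\<lambda>y. precurv A y v) differentiable (at x)"
    by (rule smooth_on_differentiable[OF smooth_on_precurv[OF U sm] x])
  have "alt ?N (front_deriv (\<lambda>y. tpow (Suc m) (precurv A y)) x) v
     = alt ?N (tprod 3 (front_deriv (precurv A) x) ?T) v + alt ?N (tprod 2 ?P (front_deriv (\<lambda>y. tpow m (precurv A y)) x)) v"
    using alt_front_deriv_tprod[of 2 ?N "precurv A" x "\<lambda>y. tpow m (precurv A y)" v,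
        OF _ precurv_depends dP differentiable_tpow_precurv] by (simp add: numeral_3_eq_3)
  also have "alt ?N (tprod 3 (front_deriv (precurv A) x) ?T) v
     = alt ?N (tprod 3 (\<lambda>v. tprod 2 ?P ?a v - tprod 1 ?a ?P v) ?T) v"
    unfolding N(1)[symmetric] by (rule alt_tprod_cong_left) (simp add: bianchi alt_diff)
  also have "\<dots> = alt ?N (tprod 2 ?P (tprod 1 ?a ?T)) v - alt ?N (tprod 1 ?a (tprod 2 ?P ?T)) v"
    using tprod_assoc[of 2 1 ?P ?a ?T] tprod_assoc[of 1 2 ?a ?P ?T]
    unfolding three tprod_diff_left alt_diff by simp
  also have "alt ?N (tprod 2 ?P (front_deriv (\<lambda>y. tpow m (precurv A y)) x)) v
     = alt ?N (tprod 2 ?P (\<lambda>v. tprod (2 * m) ?T ?a v - tprod 1 ?a ?T v)) v"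
    unfolding N(2)[symmetric] by (rule alt_tprod_cong_right[OF precurv_depends]) (simp only: Suc alt_diff)
  also have "\<dots> = alt ?N (tprod (2 + 2 * m) (tprod 2 ?P ?T) ?a) v - alt ?N (tprod 2 ?P (tprod 1 ?a ?T)) v"
    by (simp only: tprod_diff_right alt_diff tprod_assoc)
  finally show ?case by simp
qed

lemma trace_form_eq_alt:
  "trace_form m (curvature A x) = (\<lambda>v. trace (alt (2 * m) (tpow m (precurv A x)) v))"
  using curvature_eq_alt[OF smooth_on_differentiable[OF sm x]]
  by (simp add: trace_form_def[abs_def] mwpower_alt[OF precurv_depends])

end

lemma ext_deriv_cong:
  assumes "open U" "x \<in> U" "\<And>y. y \<in> U \<Longrightarrow> f y = g y"
  shows "ext_deriv q f x v = ext_deriv q g x v"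
proof -
  have "frechet_derivative (\<lambda>y. f y w) (at x) = frechet_derivative (\<lambda>y. g y w) (at x)" for w
    by (rule frechet_derivative_cong_open[OF assms(1,2)]) (simp add: assms(3))
  then show ?thesis unfolding ext_deriv_def by simp
qed

lemma ext_deriv_trace_alt:
  fixes f :: "real^'n::finite \<Rightarrow> (nat \<Rightarrow> real^'n) \<Rightarrow> real^'r::finite^'r"
  assumes U: "open U" "x \<in> U" and sm: "\<And>v. smooth_on (\<lambda>y. f y v) U"
  shows "ext_deriv q (\<lambda>y v. trace (alt q (f y) v)) x v = trace (alt (Suc q) (front_deriv f x) v)"
proof -
  have d: "(\<lambda>y. f y v) differentiable (at x)" for v
    by (rule smooth_on_differentiable[OF sm U(2)])
  have dt: "(\<lambda>y. trace (f y v)) differentiable (at x)" for v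
    by (rule smooth_on_differentiable[OF smooth_on_bounded_linear_comp[OF U(1) bounded_linear_trace sm] U(2)])
  have "ext_deriv q (\<lambda>y v. trace (alt q (f y) v)) x v = ext_deriv q (\<lambda>y. alt q (\<lambda>v. trace (f y v))) x v"
    by (simp add: alt_linear[OF linear_trace])
  also have "\<dots> = alt (Suc q) (front_deriv (\<lambda>y v. trace (f y v)) x) v"
    by (rule ext_deriv_alt[OF dt])
  also have "front_deriv (\<lambda>y v. trace (f y v)) x = (\<lambda>v. trace (front_deriv f x v))"
    by (rule ext, rule front_deriv_linear[OF bounded_linear_trace d])
  finally show ?thesis by (simp add: alt_linear[OF linear_trace])
qed

text \<open>The derivative of \<open>Tr F\<^sup>m\<close> is the trace of a commutator of \<open>F\<^sup>m\<close> and \<open>A\<close>, and \<open>F\<^sup>m\<close> has even degree.\<close>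

lemma trace_form_closed:
  assumes U: "open U" "x \<in> U" and sm: "\<And>u. smooth_on (\<lambda>y. A y u) U"
  shows "ext_deriv (2 * m) (\<lambda>y. trace_form m (curvature A y)) x v = 0"
proof -
  let ?a = "one_form A x" and ?T = "tpow m (precurv A x)"
  have "ext_deriv (2 * m) (\<lambda>y. trace_form m (curvature A y)) x v
     = ext_deriv (2 * m) (\<lambda>y v. trace (alt (2 * m) (tpow m (precurv A y)) v)) x v"
    by (rule ext_deriv_cong[OF U]) (rule trace_form_eq_alt[OF U(1) _ sm])
  also have "\<dots> = trace (alt (2 * m + 1) (front_deriv (\<lambda>y. tpow m (precurv A y)) x) v)"
    using ext_deriv_trace_alt[OF U smooth_on_tpow[OF U(1) smooth_on_precurv[OF U(1) sm]]] by simp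
  also have "\<dots> = trace (alt (2 * m + 1) (tprod (2 * m) ?T ?a) v) - trace (alt (2 * m + 1) (tprod 1 ?a ?T) v)"
    by (simp only: alt_front_deriv_tpow[OF U sm] trace_sub)
  also have "\<dots> = 0"
    using alt_trace_cyclic[OF tpow_depends[OF precurv_depends] one_form_depends, of m A x A x v]
    by (simp add: add.commute)
  finally show ?thesis .
qed

text \<open>The form \<open>Tr (\<theta> F\<^sup>m)\<close>.\<close>

definition transgression ::
  "nat \<Rightarrow> ('n::finite, 'r::finite) conn_form \<Rightarrow> ('n, 'r) conn_form \<Rightarrow> real^'n \<Rightarrow> (nat \<Rightarrow> real^'n) \<Rightarrow> real" where
  "transgression m \<theta> A x v = trace (mwedge 1 (2 * m) (one_form \<theta> x) (mwpower m (curvature A x)) v)"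

text \<open>The derivative of \<open>precurv (A + t \<theta>)\<close> with respect to \<open>t\<close> at \<open>t = 0\<close>.\<close>

definition precurv_variation :: "('n::finite, 'r::finite) conn_form \<Rightarrow> ('n, 'r) conn_form
    \<Rightarrow> real^'n \<Rightarrow> (nat \<Rightarrow> real^'n) \<Rightarrow> real^'r^'r" where
  "precurv_variation \<theta> A x v = front_deriv (one_form \<theta>) x v
     + tprod 1 (one_form \<theta> x) (one_form A x) v + tprod 1 (one_form A x) (one_form \<theta> x) v"

lemma transgression_eq_alt:
  assumes U: "open U" "x \<in> U" and sm: "\<And>u. smooth_on (\<lambda>y. A y u) U"
  shows "transgression m \<theta> A x = (\<lambda>v. trace (alt (2 * m + 1) (tprod 1 (one_form \<theta> x) (tpow m (precurv A x))) v))"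
proof
  fix v
  have "mwpower m (curvature A x) = alt (2 * m) (tpow m (precurv A x))"
    unfolding curvature_eq_alt[OF smooth_on_differentiable[OF sm U(2)]]
    by (rule mwpower_alt[OF precurv_depends])
  then have "transgression m \<theta> A x v = trace ((1 / fact (2 * m)) *\<^sub>R
      alt (1 + 2 * m) (tprod 1 (one_form \<theta> x) (alt (2 * m) (tpow m (precurv A x)))) v)"
    by (simp add: transgression_def mwedge_eq_alt)
  then show "transgression m \<theta> A x v = trace (alt (2 * m + 1) (tprod 1 (one_form \<theta> x) (tpow m (precurv A x))) v)"
    using alt_tprod_alt_right[OF one_form_depends, of "2 * m" \<theta> x "tpow m (precurv A x)" v] by simp
qed

text \<open>The Leibniz rule gives \<open>Tr (d\<theta> F\<^sup>m) - Tr (\<theta> (F\<^sup>m A - A F\<^sup>m))\<close>. Rotating \<open>A\<close> to the front of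
  \<open>\<theta> F\<^sup>m A\<close>, past an odd number of slots, changes the sign, and all terms combine to the variation
  of \<open>F\<close> times \<open>F\<^sup>m\<close>.\<close>

lemma ext_deriv_transgression:
  assumes U: "open U" "x \<in> U" and sm: "\<And>u. smooth_on (\<lambda>y. A y u) U" "\<And>u. smooth_on (\<lambda>y. \<theta> y u) U"
  shows "ext_deriv (2 * m + 1) (transgression m \<theta> A) x v
     = trace (alt (2 * m + 2) (tprod 2 (precurv_variation \<theta> A x) (tpow m (precurv A x))) v)"
proof -
  let ?a = "one_form A x" and ?b = "one_form \<theta> x" and ?T = "tpow m (precurv A x)"
    and ?N = "2 * m + 2"
  have N: "1 + (2 * m + 1) = ?N" "(1 + 2 * m) + 1 = ?N" "Suc (2 * m + 1) = ?N" by simp_all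
  have smT: "smooth_on (\<lambda>y. tpow m (precurv A y) v) U" for v
    by (rule smooth_on_tpow[OF U(1) smooth_on_precurv[OF U(1) sm(1)]])
  have d: "(\<lambda>y. one_form \<theta> y v) differentiable (at x)" for v
    by (rule smooth_on_differentiable[OF smooth_on_one_form[OF sm(2)] U(2)])
  have "ext_deriv (2 * m + 1) (transgression m \<theta> A) x v = ext_deriv (2 * m + 1)
     (\<lambda>y v. trace (alt (2 * m + 1) (tprod 1 (one_form \<theta> y) (tpow m (precurv A y))) v)) x v"
    by (rule ext_deriv_cong[OF U]) (rule transgression_eq_alt[OF U(1) _ sm(1)])
  also have "\<dots> = trace (alt ?N (front_deriv (\<lambda>y. tprod 1 (one_form \<theta> y) (tpow m (precurv A y))) x) v)"
    unfolding N(3)[symmetric]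
    by (rule ext_deriv_trace_alt[OF U smooth_on_tprod[OF U(1) smooth_on_one_form[OF sm(2)] smT]])
  also have "alt ?N (front_deriv (\<lambda>y. tprod 1 (one_form \<theta> y) (tpow m (precurv A y))) x) v
     = alt ?N (tprod 2 (front_deriv (one_form \<theta>) x) ?T) v - alt ?N (tprod 1 ?b (front_deriv (\<lambda>y. tpow m (precurv A y)) x)) v"
    using alt_front_deriv_tprod[of 1 ?N "one_form \<theta>" x "\<lambda>y. tpow m (precurv A y)" v, OF _ one_form_depends d
        smooth_on_differentiable[OF smT U(2)]] by (simp add: numeral_2_eq_2)
  also have "alt ?N (tprod 1 ?b (front_deriv (\<lambda>y. tpow m (precurv A y)) x)) v
     = alt ?N (tprod 1 ?b (\<lambda>v. tprod (2 * m) ?T ?a v - tprod 1 ?a ?T v)) v"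
    unfolding N(1)[symmetric] by (rule alt_tprod_cong_right[OF one_form_depends])
      (simp only: alt_front_deriv_tpow[OF U sm(1)] alt_diff)
  also have "\<dots> = alt ?N (tprod (1 + 2 * m) (tprod 1 ?b ?T) ?a) v - alt ?N (tprod (1 + 1) (tprod 1 ?b ?a) ?T) v"
    by (simp only: tprod_diff_right alt_diff tprod_assoc)
  finally have 1: "ext_deriv (2 * m + 1) (transgression m \<theta> A) x v = trace (alt ?N (tprod 2 (front_deriv (one_form \<theta>) x) ?T) v)
      - trace (alt ?N (tprod (1 + 2 * m) (tprod 1 ?b ?T) ?a) v) + trace (alt ?N (tprod (1 + 1) (tprod 1 ?b ?a) ?T) v)"
    by (simp only: trace_sub)
  have "trace (alt ((1 + 2 * m) + 1) (tprod (1 + 2 * m) (tprod 1 ?b ?T) ?a) v)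
     = (-1) ^ ((1 + 2 * m) * 1) * trace (alt ((1 + 2 * m) + 1) (tprod 1 ?a (tprod 1 ?b ?T)) v)"
    by (rule alt_trace_cyclic[OF tprod_depends[OF one_form_depends tpow_depends[OF precurv_depends]] one_form_depends])
  then have 2: "trace (alt ?N (tprod (1 + 2 * m) (tprod 1 ?b ?T) ?a) v)
     = - trace (alt ?N (tprod (1 + 1) (tprod 1 ?a ?b) ?T) v)"
    unfolding N(2) tprod_assoc by simp
  show ?thesis unfolding 1 2 precurv_variation_def[abs_def] tprod_add_left alt_add trace_add
    by (simp add: numeral_2_eq_2)
qed

primrec dtpow :: "nat \<Rightarrow> ((nat \<Rightarrow> 'v) \<Rightarrow> real^'r::finite^'r) \<Rightarrow> ((nat \<Rightarrow> 'v) \<Rightarrow> real^'r^'r) \<Rightarrow> (nat \<Rightarrow> 'v) \<Rightarrow> real^'r^'r" where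
  "dtpow 0 \<Phi> \<Psi> = (\<lambda>v. 0)"
| "dtpow (Suc m) \<Phi> \<Psi> = (\<lambda>v. tprod 2 \<Psi> (tpow m \<Phi>) v + tprod 2 \<Phi> (dtpow m \<Phi> \<Psi>) v)"

lemma has_vector_derivative_tpow:
  assumes "\<And>v. ((\<lambda>t. \<Phi> t v) has_vector_derivative \<Psi> v) (at t)"
  shows "((\<lambda>t. tpow m (\<Phi> t) v) has_vector_derivative dtpow m (\<Phi> t) \<Psi> v) (at t)"
proof (induction m arbitrary: v)
  case (Suc m)
  show ?case
    using bounded_bilinear.has_vector_derivative[OF bounded_bilinear_matrix_mult assms Suc]
    by (simp add: tprod_def add.commute)
qed simp

lemma dtpow_depends:
  assumes "depends_on_first 2 \<Phi>" "depends_on_first 2 \<Psi>"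
  shows "depends_on_first (2 * m) (dtpow m \<Phi> \<Psi>)"
proof (induction m)
  case (Suc m)
  have "depends_on_first (2 + 2 * m) (tprod 2 \<Psi> (tpow m \<Phi>))" "depends_on_first (2 + 2 * m) (tprod 2 \<Phi> (dtpow m \<Phi> \<Psi>))"
    by (intro tprod_depends assms tpow_depends Suc)+
  then show ?case unfolding depends_on_first_def dtpow.simps mult_Suc_right by metis
qed (simp add: depends_on_first_def)

lemma tprod_tpow: "tprod (2 * i) (tpow i \<Phi>) (tpow j \<Phi>) = tpow (i + j) \<Phi>"
proof (induction i)
  case 0
  show ?case by (simp add: tprod_def fun_eq_iff)
next
  case (Suc i)
  have "tprod (2 * Suc i) (tpow (Suc i) \<Phi>) (tpow j \<Phi>) = tprod (2 + 2 * i) (tprod 2 \<Phi> (tpow i \<Phi>)) (tpow j \<Phi>)"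
    by simp
  also have "\<dots> = tpow (Suc i + j) \<Phi>" by (simp only: tprod_assoc Suc) simp
  finally show ?case .
qed

text \<open>The derivative of a power is a sum of \<open>m\<close> words in which one factor \<open>\<Phi>\<close> is replaced by \<open>\<Psi>\<close>. Under the
  trace, the factors in front of \<open>\<Psi>\<close> can be rotated to the end at no cost in sign, so all \<open>m\<close> words
  contribute equally. The additional factor \<open>tpow j \<Phi>\<close> collects the rotated factors in the induction.\<close>

lemma trace_alt_dtpow:
  assumes \<Phi>: "depends_on_first 2 \<Phi>" and \<Psi>: "depends_on_first 2 \<Psi>"
  shows "trace (alt (2 * m + 2 * j) (tprod (2 * m) (dtpow m \<Phi> \<Psi>) (tpow j \<Phi>)) v)
    = m * trace (alt (2 * m + 2 * j) (tprod 2 \<Psi> (tpow (m - 1 + j) \<Phi>)) v)"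
proof (induction m arbitrary: j)
  case 0
  show ?case by (simp add: tprod_def[abs_def] trace_def)
next
  case (Suc m)
  let ?N = "2 * Suc m + 2 * j"
  have N: "2 + (2 * m + 2 * j) = ?N" "2 * m + 2 * Suc j = ?N" "(2 * m + 2 * j) + 2 = ?N" by simp_all
  have "tprod (2 + 2 * m) (dtpow (Suc m) \<Phi> \<Psi>) (tpow j \<Phi>)
     = (\<lambda>v. tprod 2 \<Psi> (tpow (m + j) \<Phi>) v + tprod 2 \<Phi> (tprod (2 * m) (dtpow m \<Phi> \<Psi>) (tpow j \<Phi>)) v)"
    by (simp only: dtpow.simps tprod_add_left tprod_assoc tprod_tpow)
  then have "trace (alt ?N (tprod (2 * Suc m) (dtpow (Suc m) \<Phi> \<Psi>) (tpow j \<Phi>)) v)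
     = trace (alt ?N (tprod 2 \<Psi> (tpow (m + j) \<Phi>)) v)
       + trace (alt ?N (tprod 2 \<Phi> (tprod (2 * m) (dtpow m \<Phi> \<Psi>) (tpow j \<Phi>))) v)"
    by (simp only: mult_Suc_right alt_add trace_add)
  also have "trace (alt ?N (tprod 2 \<Phi> (tprod (2 * m) (dtpow m \<Phi> \<Psi>) (tpow j \<Phi>))) v)
      = trace (alt ?N (tprod (2 * m + 2 * j) (tprod (2 * m) (dtpow m \<Phi> \<Psi>) (tpow j \<Phi>)) \<Phi>) v)"
    using alt_trace_cyclic[OF \<Phi> tprod_depends[OF dtpow_depends[OF \<Phi> \<Psi>] tpow_depends[OF \<Phi>]], of m j v]
    unfolding N by simp
  also have "\<dots> = trace (alt (2 * m + 2 * Suc j) (tprod (2 * m) (dtpow m \<Phi> \<Psi>) (tpow (Suc j) \<Phi>)) v)"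
    unfolding tprod_assoc tpow_Suc_right N ..
  also have "\<dots> = m * trace (alt ?N (tprod 2 \<Psi> (tpow (m - 1 + Suc j) \<Phi>)) v)"
    using Suc.IH[of "Suc j"] unfolding N .
  also have "\<dots> = m * trace (alt ?N (tprod 2 \<Psi> (tpow (m + j) \<Phi>)) v)"
    by (cases m) auto
  finally show ?case by (simp add: algebra_simps)
qed

definition conn_path :: "('n::finite, 'r::finite) conn_form \<Rightarrow> ('n, 'r) conn_form \<Rightarrow> real \<Rightarrow> ('n, 'r) conn_form" where
  "conn_path A \<theta> t x u = A x u + t *\<^sub>R \<theta> x u"

lemma smooth_on_conn_path:
  assumes "open U" "\<And>u. smooth_on (\<lambda>y. A y u) U" "\<And>u. smooth_on (\<lambda>y. \<theta> y u) U"
  shows "smooth_on (\<lambda>y. conn_path A \<theta> t y u) U"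
  unfolding conn_path_def by (intro smooth_on_add smooth_on_scaleR assms)

context
  fixes U :: "(real^'n::finite) set" and A \<theta> :: "('n, 'r::finite) conn_form" and x :: "real^'n"
  assumes U: "open U" "x \<in> U" and sm: "\<And>u. smooth_on (\<lambda>y. A y u) U" "\<And>u. smooth_on (\<lambda>y. \<theta> y u) U"
begin

lemma precurv_conn_path:
  "precurv (conn_path A \<theta> t) x v = precurv A x v + t *\<^sub>R precurv_variation \<theta> A x v
     + (t * t) *\<^sub>R tprod 1 (one_form \<theta> x) (one_form \<theta> x) v"
proof -
  have "((\<lambda>y. conn_path A \<theta> t y u) has_derivative (\<lambda>w. frechet_derivative (\<lambda>y. A y u) (at x) w
      + t *\<^sub>R frechet_derivative (\<lambda>y. \<theta> y u) (at x) w)) (at x)" for u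
    unfolding conn_path_def
    by (intro has_derivative_add has_derivative_scaleR_right smooth_on_has_derivative[OF sm(1) U(2)]
        smooth_on_has_derivative[OF sm(2) U(2)])
  from frechet_derivative_eqI[OF this]
  show ?thesis
    by (simp add: precurv_def precurv_variation_def front_deriv_one_form tprod_def one_form_def)
       (simp add: conn_path_def algebra_simps
        bounded_bilinear.add_left[OF bounded_bilinear_matrix_mult] bounded_bilinear.add_right[OF bounded_bilinear_matrix_mult]
        bounded_bilinear.scaleR_left[OF bounded_bilinear_matrix_mult] bounded_bilinear.scaleR_right[OF bounded_bilinear_matrix_mult])
qed

lemma has_vector_derivative_precurv_conn_path:
  "((\<lambda>t. precurv (conn_path A \<theta> t) x v) has_vector_derivative precurv_variation \<theta> (conn_path A \<theta> t) x v) (at t)"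
proof -
  have e: "precurv_variation \<theta> (conn_path A \<theta> t) x v = precurv_variation \<theta> A x v
     + (t + t) *\<^sub>R tprod 1 (one_form \<theta> x) (one_form \<theta> x) v"
    by (simp add: precurv_variation_def tprod_def one_form_def)
       (simp add: conn_path_def scaleR_add_left ac_simps
        bounded_bilinear.add_left[OF bounded_bilinear_matrix_mult] bounded_bilinear.add_right[OF bounded_bilinear_matrix_mult]
        bounded_bilinear.scaleR_left[OF bounded_bilinear_matrix_mult] bounded_bilinear.scaleR_right[OF bounded_bilinear_matrix_mult],
       simp add: vec_eq_iff)
  show ?thesis unfolding precurv_conn_path e
    by (auto intro!: derivative_eq_intros)
qed

lemma has_real_derivative_trace_form_conn_path:
  "((\<lambda>t. trace_form (Suc m) (curvature (conn_path A \<theta> t) x) v) has_real_derivative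
     (real (Suc m) * ext_deriv (2 * m + 1) (transgression m \<theta> (conn_path A \<theta> t)) x v)) (at t)"
proof -
  let ?P = "\<lambda>t. precurv (conn_path A \<theta> t) x" and ?V = "precurv_variation \<theta> (conn_path A \<theta> t) x"
  have smt: "smooth_on (\<lambda>y. conn_path A \<theta> t y u) U" for t u
    by (rule smooth_on_conn_path[OF U(1) sm])
  have V: "depends_on_first 2 ?V"
    by (auto simp: depends_on_first_def precurv_variation_def front_deriv_one_form tprod_def one_form_def)
  have "((\<lambda>t. alt (2 * Suc m) (tpow (Suc m) (?P t)) v) has_vector_derivative
      alt (2 * Suc m) (dtpow (Suc m) (?P t) ?V) v) (at t)"
    unfolding alt_def
    by (intro has_vector_derivative_sum bounded_linear.has_vector_derivative[OF bounded_linear_scaleR_right]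
        has_vector_derivative_tpow has_vector_derivative_precurv_conn_path)
  from bounded_linear.has_vector_derivative[OF bounded_linear_trace this]
  have "((\<lambda>t. trace_form (Suc m) (curvature (conn_path A \<theta> t) x) v) has_real_derivative
     trace (alt (2 * Suc m) (dtpow (Suc m) (?P t) ?V) v)) (at t)"
    unfolding trace_form_eq_alt[OF U smt] has_real_derivative_iff_has_vector_derivative .
  moreover have "trace (alt (2 * Suc m) (dtpow (Suc m) (?P t) ?V) v)
      = real (Suc m) * trace (alt (2 * Suc m) (tprod 2 ?V (tpow m (?P t))) v)"
  proof -
    have "tprod (2 * Suc m) (dtpow (Suc m) (?P t) ?V) (tpow 0 (?P t)) = dtpow (Suc m) (?P t) ?V"
      unfolding tprod_def tpow.simps matrix_mul_rid ..
    then show ?thesis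
      using trace_alt_dtpow[OF precurv_depends V, of "Suc m" 0 "conn_path A \<theta> t" x v]
      by (simp only: diff_Suc_1 add_0_right mult_0_right)
  qed
  ultimately show ?thesis
    unfolding ext_deriv_transgression[OF U smt sm(2)] by simp
qed

end

section \<open>Quadrature along a path of connections\<close>

definition poly_fun :: "nat \<Rightarrow> (real \<Rightarrow> real) \<Rightarrow> bool" where
  "poly_fun d f \<longleftrightarrow> (\<exists>p. degree p \<le> d \<and> f = poly p)"

lemma poly_fun_const: "poly_fun d (\<lambda>t. c)"
  unfolding poly_fun_def by (intro exI[of _ "[:c:]"]) auto
lemma poly_fun_add: "poly_fun d f \<Longrightarrow> poly_fun d g \<Longrightarrow> poly_fun d (\<lambda>t. f t + g t)"
  unfolding poly_fun_def using degree_add_le poly_add by (metis (no_types, lifting) ext)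
lemma poly_fun_mult: "poly_fun d f \<Longrightarrow> poly_fun e g \<Longrightarrow> poly_fun (d + e) (\<lambda>t. f t * g t)"
proof -
  assume "poly_fun d f" "poly_fun e g"
  then obtain p q where "degree p \<le> d" "f = poly p" "degree q \<le> e" "g = poly q"
    by (auto simp: poly_fun_def)
  then show ?thesis unfolding poly_fun_def
    by (intro exI[of _ "p * q"]) (auto simp: fun_eq_iff intro: order.trans[OF degree_mult_le])
qed
lemma poly_fun_sum: "(\<And>i. i \<in> I \<Longrightarrow> poly_fun d (f i)) \<Longrightarrow> poly_fun d (\<lambda>t. \<Sum>i\<in>I. f i t)"
  by (induction I rule: infinite_finite_induct) (auto intro: poly_fun_const poly_fun_add)
lemma poly_fun_cmult: "poly_fun d f \<Longrightarrow> poly_fun d (\<lambda>t. c * f t)"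
  using poly_fun_mult[OF poly_fun_const[of 0 c]] by simp

lemma poly_fun_tpow:
  assumes "\<And>v a b. poly_fun 2 (\<lambda>t. \<Phi> t v $ a $ b)"
  shows "poly_fun (2 * m) (\<lambda>t. tpow m (\<Phi> t) v $ a $ b)"
proof (induction m arbitrary: v a b)
  case (Suc m)
  have "poly_fun (2 + 2 * m) (\<lambda>t. \<Sum>c\<in>UNIV. \<Phi> t v $ a $ c * tpow m (\<Phi> t) (\<lambda>i. v (2 + i)) $ c $ b)"
    by (intro poly_fun_sum poly_fun_mult assms Suc)
  then show ?case by (simp add: tprod_def matrix_matrix_mult_def)
qed (simp add: poly_fun_const)

text \<open>The curvature of \<open>A + t \<theta>\<close> is quadratic in \<open>t\<close>.\<close>

lemma poly_fun_trace_form_conn_path: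
  assumes U: "open U" "x \<in> U" and sm: "\<And>u. smooth_on (\<lambda>y. A y u) U" "\<And>u. smooth_on (\<lambda>y. \<theta> y u) U"
  shows "poly_fun (2 * m) (\<lambda>t. trace_form m (curvature (conn_path A \<theta> t) x) v)"
proof -
  have *: "poly_fun 2 (\<lambda>t. precurv (conn_path A \<theta> t) x v $ a $ b)" for v a b
  proof -
    have "poly_fun 2 (\<lambda>t. c + t * d + t * t * e)" for c d e :: real
      unfolding poly_fun_def by (intro exI[of _ "[:c, d, e:]"]) (auto simp: fun_eq_iff algebra_simps)
    then show ?thesis unfolding precurv_conn_path[OF U sm] by simp
  qed
  show ?thesis
    unfolding trace_form_eq_alt[OF U smooth_on_conn_path[OF U(1) sm]] alt_def trace_def
    by (simp, intro poly_fun_sum poly_fun_cmult poly_fun_tpow *)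
qed

definition lagrange_basis :: "nat \<Rightarrow> nat \<Rightarrow> real poly" where
  "lagrange_basis N j = (\<Prod>i\<in>{..<N} - {j}. smult (1 / (real j - real i)) [:- real i, 1:])"

text \<open>The weights of the quadrature formula on \<open>[0, 1]\<close> with the nodes \<open>0, \<dots>, N - 1\<close>. The nodes need not
  lie in the interval: the formula is used only for polynomials, for which it is exact.\<close>

definition quad_weight :: "nat \<Rightarrow> nat \<Rightarrow> real" where
  "quad_weight N j = integral {0..1} (poly (lagrange_basis N j))"

lemma degree_lagrange_basis: "j < N \<Longrightarrow> degree (lagrange_basis N j) < N"
proof -
  assume j: "j < N"
  have "degree (lagrange_basis N j) \<le> (\<Sum>i\<in>{..<N} - {j}. degree (smult (1 / (real j - real i)) [:- real i, 1:]))"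
    unfolding lagrange_basis_def by (rule degree_prod_sum_le[unfolded o_def]) simp
  also have "\<dots> \<le> (\<Sum>i\<in>{..<N} - {j}. 1)"
    by (intro sum_mono) simp
  also have "\<dots> < N" using j by simp
  finally show ?thesis .
qed

lemma poly_lagrange_basis:
  assumes "k < N" "j < N"
  shows "poly (lagrange_basis N j) (real k) = (if k = j then 1 else 0)"
proof (cases "k = j")
  case True
  have "poly (smult (1 / (real j - real i)) [:- real i, 1:]) (real j) = 1" if "i \<noteq> j" for i
  proof -
    have "real j - real i \<noteq> 0" using that by simp
    then show ?thesis by (simp add: divide_simps)
  qed
  then show ?thesis using True by (simp add: lagrange_basis_def poly_prod prod.neutral)
next
  case False
  then show ?thesis using assms by (auto simp: lagrange_basis_def poly_prod)
qed

lemma quadrature: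
  assumes "degree p \<le> N"
  shows "poly p 1 - poly p 0 = (\<Sum>j<N. quad_weight N j * poly (pderiv p) (real j))"
proof (cases "N = 0")
  case True
  then obtain c where "p = [:c:]" using assms degree_eq_zeroE by blast
  then show ?thesis using True by simp
next
  case False
  let ?q = "\<Sum>j<N. smult (poly (pderiv p) (real j)) (lagrange_basis N j)"
  have "pderiv p = ?q"
  proof (rule poly_eqI_degree[of "real ` {..<N}"])
    fix x assume "x \<in> real ` {..<N}"
    then obtain k where k: "x = real k" "k < N" by auto
    show "poly (pderiv p) x = poly ?q x"
    proof -
      have "poly ?q x = (\<Sum>j<N. if k = j then poly (pderiv p) (real j) else 0)"
        unfolding poly_sum using k by (intro sum.cong) (auto simp: poly_lagrange_basis)
      then show ?thesis using k by simp
    qed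
  next
    show "degree (pderiv p) < card (real ` {..<N})"
      using assms False by (simp add: card_image degree_pderiv)
    show "degree ?q < card (real ` {..<N})"
    proof -
      have "degree ?q \<le> N - 1"
        by (intro degree_sum_le) (use degree_lagrange_basis in \<open>force intro: order.trans[OF degree_smult_le]\<close>)+
      then show ?thesis using False by (simp add: card_image)
    qed
  qed
  have int: "(poly r has_integral integral {0..1} (poly r)) {0..1}" for r :: "real poly"
    by (intro integrable_integral integrable_continuous_real continuous_intros)
  have "(poly (pderiv p) has_integral (poly p 1 - poly p 0)) {0..1}"
    by (rule fundamental_theorem_of_calculus)
      (auto intro!: DERIV_subset[OF poly_DERIV]
        simp flip: has_real_derivative_iff_has_vector_derivative)
  moreover have "(poly ?q has_integral (\<Sum>j<N. quad_weight N j * poly (pderiv p) (real j))) {0..1}"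
  proof -
    have "((\<lambda>x. \<Sum>j<N. poly (pderiv p) (real j) * poly (lagrange_basis N j) x) has_integral
       (\<Sum>j<N. poly (pderiv p) (real j) * quad_weight N j)) {0..1}"
      unfolding quad_weight_def by (intro has_integral_sum has_integral_mult_right int) auto
    moreover have "poly ?q = (\<lambda>x. \<Sum>j<N. poly (pderiv p) (real j) * poly (lagrange_basis N j) x)"
      by (simp add: fun_eq_iff poly_sum)
    ultimately show ?thesis by (simp only: mult.commute[of "quad_weight N _"])
  qed
  ultimately show ?thesis
    using \<open>pderiv p = ?q\<close> has_integral_unique by metis
qed

lemma ext_deriv_sum:
  fixes f :: "'j \<Rightarrow> real^'n::finite \<Rightarrow> (nat \<Rightarrow> real^'n) \<Rightarrow> real"
  assumes "\<And>j v. (\<lambda>y. f j y v) differentiable (at x)"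
  shows "ext_deriv q (\<lambda>y v. \<Sum>j\<in>J. c j * f j y v) x v = (\<Sum>j\<in>J. c j * ext_deriv q (f j) x v)"
proof -
  have "frechet_derivative (\<lambda>y. \<Sum>j\<in>J. c j * f j y w) (at x) u
      = (\<Sum>j\<in>J. c j * frechet_derivative (\<lambda>y. f j y w) (at x) u)" for w u
  proof -
    have "((\<lambda>y. \<Sum>j\<in>J. c j * f j y w) has_derivative
        (\<lambda>u. \<Sum>j\<in>J. c j * frechet_derivative (\<lambda>y. f j y w) (at x) u)) (at x)"
      by (intro has_derivative_sum has_derivative_mult_right)
        (use assms frechet_derivative_works in blast)
    from frechet_derivative_eqI[OF this] show ?thesis by simp
  qed
  then have "ext_deriv q (\<lambda>y v. \<Sum>j\<in>J. c j * f j y v) x v = (\<Sum>i\<le>q. \<Sum>j\<in>J.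
      c j * ((-1) ^ i *\<^sub>R frechet_derivative (\<lambda>y. f j y (\<lambda>m. v (if m < i then m else Suc m))) (at x) (v i)))"
    unfolding ext_deriv_def by (simp only: scaleR_sum_right mult_scaleR_right)
  then show ?thesis
    unfolding ext_deriv_def sum_distrib_left by (subst sum.swap) simp
qed

text \<open>The integral of \<open>(m + 1) Tr (\<theta> F\<^sup>m)\<close> along the path from \<open>A\<close> to \<open>A + \<theta>\<close>, as a finite sum. There are
  as many nodes as the degree \<open>2 (m + 1)\<close> of \<open>Tr F\<^sup>m\<^sup>+\<^sup>1\<close> in \<open>t\<close>.\<close>

definition total_transgression ::
  "nat \<Rightarrow> ('n::finite, 'r::finite) conn_form \<Rightarrow> ('n, 'r) conn_form \<Rightarrow> real^'n \<Rightarrow> (nat \<Rightarrow> real^'n) \<Rightarrow> real" where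
  "total_transgression m A \<theta> x v = (\<Sum>j<2 * Suc m. quad_weight (2 * Suc m) j * real (Suc m)
      * transgression m \<theta> (conn_path A \<theta> (real j)) x v)"

lemma smooth_on_transgression:
  assumes U: "open U" and sm: "\<And>u. smooth_on (\<lambda>y. A y u) U" "\<And>u. smooth_on (\<lambda>y. \<theta> y u) U"
  shows "smooth_on (\<lambda>y. transgression m \<theta> A y v) U"
proof -
  have "smooth_on (\<lambda>y. trace (alt (2 * m + 1) (tprod 1 (one_form \<theta> y) (tpow m (precurv A y))) v)) U"
    by (intro smooth_on_bounded_linear_comp[OF U bounded_linear_trace] smooth_on_alt[OF U] smooth_on_tprod[OF U]
        smooth_on_one_form sm smooth_on_tpow[OF U] smooth_on_precurv[OF U])
  then show ?thesis
    by (rule smooth_on_cong[OF U, rotated]) (simp add: transgression_eq_alt[OF U _ sm(1)])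
qed

lemma smooth_on_total_transgression:
  assumes U: "open U" and sm: "\<And>u. smooth_on (\<lambda>y. A y u) U" "\<And>u. smooth_on (\<lambda>y. \<theta> y u) U"
  shows "smooth_on (\<lambda>y. total_transgression m A \<theta> y v) U"
  unfolding total_transgression_def
  by (intro smooth_on_sum smooth_on_mult smooth_on_const smooth_on_transgression[OF U] smooth_on_conn_path[OF U] sm U)

lemma smooth_on_trace_form:
  assumes U: "open U" and sm: "\<And>u. smooth_on (\<lambda>y. A y u) U"
  shows "smooth_on (\<lambda>y. trace_form m (curvature A y) v) U"
proof -
  have "smooth_on (\<lambda>y. trace (alt (2 * m) (tpow m (precurv A y)) v)) U"
    by (intro smooth_on_bounded_linear_comp[OF U bounded_linear_trace] smooth_on_alt[OF U]
        sm smooth_on_tpow[OF U] smooth_on_precurv[OF U])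
  then show ?thesis
    by (rule smooth_on_cong[OF U, rotated]) (simp add: trace_form_eq_alt[OF U _ sm(1)])
qed

lemma transgression_formula:
  assumes U: "open U" "x \<in> U" and sm: "\<And>u. smooth_on (\<lambda>y. A y u) U" "\<And>u. smooth_on (\<lambda>y. \<theta> y u) U"
  shows "trace_form (Suc m) (curvature (conn_path A \<theta> 1) x) v - trace_form (Suc m) (curvature A x) v
     = ext_deriv (2 * m + 1) (total_transgression m A \<theta>) x v"
proof -
  let ?E = "\<lambda>t. ext_deriv (2 * m + 1) (transgression m \<theta> (conn_path A \<theta> t)) x v"
  let ?N = "2 * Suc m"
  obtain p where p: "degree p \<le> ?N" "(\<lambda>t. trace_form (Suc m) (curvature (conn_path A \<theta> t) x) v) = poly p"
    using poly_fun_trace_form_conn_path[where A=A and \<theta>=\<theta> and m="Suc m" and v=v, OF U sm] by (auto simp: poly_fun_def)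
  have pd: "poly (pderiv p) t = real (Suc m) * ?E t" for t
    using has_real_derivative_trace_form_conn_path[where A=A and \<theta>=\<theta> and m=m and v=v and t=t, OF U sm] poly_DERIV[of p t] DERIV_unique
    unfolding p(2) by blast
  have "conn_path A \<theta> 0 = A" by (simp add: conn_path_def fun_eq_iff)
  then have "trace_form (Suc m) (curvature (conn_path A \<theta> 1) x) v - trace_form (Suc m) (curvature A x) v
     = poly p 1 - poly p 0"
    using fun_cong[OF p(2), of 0] fun_cong[OF p(2), of 1] by simp
  also have "\<dots> = (\<Sum>j<?N. quad_weight ?N j * real (Suc m) * ?E (real j))"
    unfolding quadrature[OF p(1)] pd by (simp only: mult.assoc)
  also have "\<dots> = ext_deriv (2 * m + 1) (total_transgression m A \<theta>) x v"
    unfolding total_transgression_def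
    by (rule ext_deriv_sum[symmetric], rule smooth_on_differentiable[OF _ U(2)])
      (intro smooth_on_transgression[OF U(1)] smooth_on_conn_path[OF U(1)] sm)
  finally show ?thesis .
qed

section \<open>Gauge transformations\<close>

lemmas matrix_ring_simps =
  bounded_bilinear.add_left[OF bounded_bilinear_matrix_mult] bounded_bilinear.add_right[OF bounded_bilinear_matrix_mult]
  bounded_bilinear.diff_left[OF bounded_bilinear_matrix_mult] bounded_bilinear.diff_right[OF bounded_bilinear_matrix_mult]
  bounded_bilinear.minus_left[OF bounded_bilinear_matrix_mult] bounded_bilinear.minus_right[OF bounded_bilinear_matrix_mult]
  bounded_bilinear.scaleR_left[OF bounded_bilinear_matrix_mult] bounded_bilinear.scaleR_right[OF bounded_bilinear_matrix_mult]
  matrix_mul_assoc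

lemma linear_Basis_expansion:
  assumes "linear f"
  shows "f w = (\<Sum>b\<in>Basis. (w \<bullet> b) *\<^sub>R f (b::'a::euclidean_space))"
proof -
  have "f w = f (\<Sum>b\<in>Basis. (w \<bullet> b) *\<^sub>R b)" by (simp add: euclidean_representation)
  then show ?thesis by (simp add: linear_sum[OF assms] linear_cmul[OF assms])
qed

lemma frechet_derivative_linear_family:
  fixes E :: "real^'n::finite \<Rightarrow> real^'n \<Rightarrow> 'b::real_normed_vector"
  assumes U: "open U" "x \<in> U" and lin: "\<And>y. y \<in> U \<Longrightarrow> linear (E y)"
    and d: "\<And>u. (\<lambda>y. E y u) differentiable (at x)"
  shows "frechet_derivative (\<lambda>y. E y w) (at x) v = (\<Sum>b\<in>Basis. (w \<bullet> b) *\<^sub>R frechet_derivative (\<lambda>y. E y b) (at x) v)"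
proof -
  have "((\<lambda>y. \<Sum>b\<in>Basis. (w \<bullet> b) *\<^sub>R E y b) has_derivative
     (\<lambda>v. \<Sum>b\<in>Basis. (w \<bullet> b) *\<^sub>R frechet_derivative (\<lambda>y. E y b) (at x) v)) (at x)"
    by (intro has_derivative_sum has_derivative_scaleR_right) (use d frechet_derivative_works in blast)
  then have "((\<lambda>y. E y w) has_derivative
     (\<lambda>v. \<Sum>b\<in>Basis. (w \<bullet> b) *\<^sub>R frechet_derivative (\<lambda>y. E y b) (at x) v)) (at x)"
    by (rule has_derivative_transform_within_open[OF _ U]) (rule linear_Basis_expansion[OF lin, symmetric])
  from frechet_derivative_eqI[OF this] show ?thesis by simp
qed

lemma linear_frechet_derivative_family:
  fixes E :: "real^'n::finite \<Rightarrow> real^'n \<Rightarrow> 'b::real_normed_vector"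
  assumes U: "open U" "x \<in> U" and lin: "\<And>y. y \<in> U \<Longrightarrow> linear (E y)"
    and d: "\<And>u. (\<lambda>y. E y u) differentiable (at x)"
  shows "linear (\<lambda>w. frechet_derivative (\<lambda>y. E y w) (at x) v)"
proof -
  have "(\<lambda>w. frechet_derivative (\<lambda>y. E y w) (at x) v)
      = (\<lambda>w. \<Sum>b\<in>Basis. (w \<bullet> b) *\<^sub>R frechet_derivative (\<lambda>y. E y b) (at x) v)"
    by (intro ext) (rule frechet_derivative_linear_family[where E=E, OF assms])
  then show ?thesis
    by (simp only:) (rule linearI, simp_all add: inner_add_left scaleR_add_left sum.distrib scaleR_sum_right)
qed

text \<open>As in \<open>Ck_on_compose\<close>, the linear map and its argument vary at the same time, and a basis separates
  the two.\<close>

lemma has_derivative_family_compose: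
  fixes E :: "real^'n::finite \<Rightarrow> real^'n \<Rightarrow> 'b::real_normed_vector" and \<phi> \<psi> :: "real^'k::finite \<Rightarrow> real^'n"
  assumes U: "open U" "x \<in> U" and U': "open U'" "\<phi> ` U \<subseteq> U'"
    and lin: "\<And>y. y \<in> U' \<Longrightarrow> linear (E y)"
    and d: "\<And>u. (\<lambda>y. E y u) differentiable (at (\<phi> x))"
    and \<phi>: "(\<phi> has_derivative d\<phi>) (at x)" and \<psi>: "(\<psi> has_derivative d\<psi>) (at x)"
  shows "((\<lambda>y. E (\<phi> y) (\<psi> y)) has_derivative
     (\<lambda>v. frechet_derivative (\<lambda>z. E z (\<psi> x)) (at (\<phi> x)) (d\<phi> v) + E (\<phi> x) (d\<psi> v))) (at x)"
proof -
  have x': "\<phi> x \<in> U'" using U U' by auto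
  have comp: "((\<lambda>y. E (\<phi> y) b) has_derivative (\<lambda>v. frechet_derivative (\<lambda>z. E z b) (at (\<phi> x)) (d\<phi> v))) (at x)" for b
    by (rule has_derivative_compose[OF \<phi>, of "\<lambda>z. E z b"]) (use d frechet_derivative_works in blast)
  have "((\<lambda>y. \<Sum>b\<in>Basis. (\<psi> y \<bullet> b) *\<^sub>R E (\<phi> y) b) has_derivative (\<lambda>v. \<Sum>b\<in>Basis.
      (\<psi> x \<bullet> b) *\<^sub>R frechet_derivative (\<lambda>z. E z b) (at (\<phi> x)) (d\<phi> v) + (d\<psi> v \<bullet> b) *\<^sub>R E (\<phi> x) b)) (at x)"
    by (intro has_derivative_sum has_derivative_scaleR has_derivative_inner_left \<psi> comp)
  moreover have "(\<Sum>b\<in>Basis. (\<psi> x \<bullet> b) *\<^sub>R frechet_derivative (\<lambda>z. E z b) (at (\<phi> x)) (d\<phi> v)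
      + (d\<psi> v \<bullet> b) *\<^sub>R E (\<phi> x) b)
    = frechet_derivative (\<lambda>z. E z (\<psi> x)) (at (\<phi> x)) (d\<phi> v) + E (\<phi> x) (d\<psi> v)" for v
    by (simp add: sum.distrib linear_Basis_expansion[OF lin[OF x'], of "d\<psi> v"]
        frechet_derivative_linear_family[where E=E, OF U'(1) x' lin d, of "\<psi> x" "d\<phi> v"])
  ultimately have "((\<lambda>y. \<Sum>b\<in>Basis. (\<psi> y \<bullet> b) *\<^sub>R E (\<phi> y) b) has_derivative
     (\<lambda>v. frechet_derivative (\<lambda>z. E z (\<psi> x)) (at (\<phi> x)) (d\<phi> v) + E (\<phi> x) (d\<psi> v))) (at x)"
    by simp
  then show ?thesis
    by (rule has_derivative_transform_within_open[OF _ U])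
      (use U' in \<open>auto simp: linear_Basis_expansion[OF lin, symmetric]\<close>)
qed

text \<open>Differentiate the gauge equation once more and antisymmetrise. The second derivatives of \<open>h\<close> and
  \<open>\<phi>\<close> cancel by symmetry, and the first derivatives of \<open>h\<close> are eliminated with the gauge equation
  itself. The statement covers changes of coordinates \<open>\<phi>\<close> and, for the identity \<open>\<phi>\<close>, mere changes of
  the frame.\<close>

lemma curvature_gauge:
  fixes D D' :: "('n::finite, 'r::finite) conn_form" and \<phi> :: "real^'n \<Rightarrow> real^'n"
  assumes U: "open U" "x \<in> U" and U': "open U'" "\<phi> ` U \<subseteq> U'"
    and \<phi>: "smooth_on \<phi> U" and h: "smooth_on h U"
    and D: "\<And>u. smooth_on (\<lambda>y. D y u) U" and D': "\<And>u. smooth_on (\<lambda>y. D' y u) U'"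
    and lin: "\<And>y. y \<in> U' \<Longrightarrow> linear (D' y)"
    and eq: "\<And>y u. y \<in> U \<Longrightarrow>
      h y ** D y u = frechet_derivative h (at y) u + D' (\<phi> y) (frechet_derivative \<phi> (at y) u) ** h y"
  shows "h x ** curvature D x v = curvature D' (\<phi> x) (\<lambda>i. frechet_derivative \<phi> (at x) (v i)) ** h x"
proof -
  have x': "\<phi> x \<in> U'" using U U' by auto
  have dD: "(\<lambda>y. D y u) differentiable (at x)" and dD': "(\<lambda>y. D' y u) differentiable (at (\<phi> x))" for u
    using smooth_on_differentiable[OF D U(2)] smooth_on_differentiable[OF D' x'] .
  let ?w = "\<lambda>i. frechet_derivative \<phi> (at x) (v i)"
  let ?dh = "\<lambda>i. frechet_derivative h (at x) (v i)"
  have R: "frechet_derivative h (at x) a ** D x b + h x ** frechet_derivative (\<lambda>y. D y b) (at x) a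
     = frechet_derivative (\<lambda>y. frechet_derivative h (at y) b) (at x) a
      + (frechet_derivative (\<lambda>z. D' z (frechet_derivative \<phi> (at x) b)) (at (\<phi> x)) (frechet_derivative \<phi> (at x) a)
         + D' (\<phi> x) (frechet_derivative (\<lambda>y. frechet_derivative \<phi> (at y) b) (at x) a)) ** h x
      + D' (\<phi> x) (frechet_derivative \<phi> (at x) b) ** frechet_derivative h (at x) a" for a b
  proof -
    have l: "((\<lambda>y. h y ** D y b) has_derivative
      (\<lambda>a. h x ** frechet_derivative (\<lambda>y. D y b) (at x) a + frechet_derivative h (at x) a ** D x b)) (at x)"
      by (intro has_derivative_matrix_mult smooth_on_has_derivative[OF h U(2)] smooth_on_has_derivative[OF D U(2)])
    have f: "((\<lambda>y. D' (\<phi> y) (frechet_derivative \<phi> (at y) b)) has_derivative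
       (\<lambda>a. frechet_derivative (\<lambda>z. D' z (frechet_derivative \<phi> (at x) b)) (at (\<phi> x)) (frechet_derivative \<phi> (at x) a)
         + D' (\<phi> x) (frechet_derivative (\<lambda>y. frechet_derivative \<phi> (at y) b) (at x) a))) (at x)"
      by (rule has_derivative_family_compose[OF U U' lin dD' smooth_on_has_derivative[OF \<phi> U(2)]
            smooth_on_has_derivative[OF smooth_on_frechet[OF \<phi>] U(2)]])
    have r: "((\<lambda>y. frechet_derivative h (at y) b + D' (\<phi> y) (frechet_derivative \<phi> (at y) b) ** h y) has_derivative
      (\<lambda>a. frechet_derivative (\<lambda>y. frechet_derivative h (at y) b) (at x) a
        + (D' (\<phi> x) (frechet_derivative \<phi> (at x) b) ** frechet_derivative h (at x) a
         + (frechet_derivative (\<lambda>z. D' z (frechet_derivative \<phi> (at x) b)) (at (\<phi> x)) (frechet_derivative \<phi> (at x) a)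
         + D' (\<phi> x) (frechet_derivative (\<lambda>y. frechet_derivative \<phi> (at y) b) (at x) a)) ** h x))) (at x)"
      by (intro has_derivative_add has_derivative_matrix_mult f smooth_on_has_derivative[OF h U(2)]
          smooth_on_has_derivative[OF smooth_on_frechet[OF h] U(2)])
    have "frechet_derivative (\<lambda>y. h y ** D y b) (at x)
        = frechet_derivative (\<lambda>y. frechet_derivative h (at y) b + D' (\<phi> y) (frechet_derivative \<phi> (at y) b) ** h y) (at x)"
      by (rule frechet_derivative_cong_open[OF U eq])
    from fun_cong[OF this, of a] show ?thesis
      unfolding frechet_derivative_eqI[OF l] frechet_derivative_eqI[OF r] by (simp add: algebra_simps)
  qed
  have sh: "frechet_derivative (\<lambda>y. frechet_derivative h (at y) (v 1)) (at x) (v 0)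
      = frechet_derivative (\<lambda>y. frechet_derivative h (at y) (v 0)) (at x) (v 1)"
    by (rule symmetric_second_derivative[OF U h])
  have sp: "frechet_derivative (\<lambda>y. frechet_derivative \<phi> (at y) (v 1)) (at x) (v 0)
      = frechet_derivative (\<lambda>y. frechet_derivative \<phi> (at y) (v 0)) (at x) (v 1)"
    by (rule symmetric_second_derivative[OF U \<phi>])
  have dh: "?dh i = h x ** D x (v i) - D' (\<phi> x) (?w i) ** h x" for i
    using eq[OF U(2), of "v i"] by simp
  show ?thesis
    using arg_cong2[OF R[of "v 0" "v 1"] R[of "v 1" "v 0"], of "(-)"]
    unfolding curvature_explicit[OF dD] curvature_explicit[OF dD'] sh sp dh
    by (simp add: matrix_ring_simps algebra_simps)
qed

lemma mwedge_intertwine: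
  fixes h :: "real^'r::finite^'r"
  assumes "\<And>v. h ** \<alpha> v = \<alpha>' (\<lambda>i. T (v i)) ** h" "\<And>v. h ** \<beta> v = \<beta>' (\<lambda>i. T (v i)) ** h"
  shows "h ** mwedge p q \<alpha> \<beta> v = mwedge p q \<alpha>' \<beta>' (\<lambda>i. T (v i)) ** h"
proof -
  have "h ** (\<alpha> v ** \<beta> w) = \<alpha>' (\<lambda>i. T (v i)) ** \<beta>' (\<lambda>i. T (w i)) ** h" for v w
    by (metis assms matrix_mul_assoc)
  then show ?thesis
    unfolding mwedge_def
    by (simp add: linear_cmul[OF matrix_mult_linear_right] linear_cmul[OF matrix_mult_linear_left]
        linear_sum[OF matrix_mult_linear_right] linear_sum[OF matrix_mult_linear_left])
qed

lemma mwpower_intertwine: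
  fixes h :: "real^'r::finite^'r"
  assumes "\<And>v. h ** F v = F' (\<lambda>i. T (v i)) ** h"
  shows "h ** mwpower m F v = mwpower m F' (\<lambda>i. T (v i)) ** h"
proof (induction m arbitrary: v)
  case (Suc m)
  show ?case unfolding mwpower.simps by (rule mwedge_intertwine) (use assms Suc in auto)
qed simp

lemma trace_intertwine:
  fixes h :: "real^'r::finite^'r"
  assumes "invertible h" "h ** X = Y ** h"
  shows "trace X = trace Y"
proof -
  have "trace X = trace (matrix_inv h ** (h ** X))"
    by (simp add: matrix_mul_assoc matrix_inv_inverse[OF assms(1)])
  also have "\<dots> = trace ((h ** X) ** matrix_inv h)" by (rule trace_mul_sym)
  also have "\<dots> = trace Y"
    unfolding assms(2) by (simp add: matrix_mul_assoc[symmetric] matrix_inv_inverse[OF assms(1)])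
  finally show ?thesis .
qed

lemma trace_form_intertwine:
  fixes h :: "real^'r::finite^'r"
  assumes "invertible h" "\<And>v. h ** F v = F' (\<lambda>i. T (v i)) ** h"
  shows "trace_form m F v = trace_form m F' (\<lambda>i. T (v i))"
  unfolding trace_form_def by (rule trace_intertwine[OF assms(1) mwpower_intertwine[where T=T and F=F and F'=F', OF assms(2)]])

lemma transgression_intertwine:
  fixes h :: "real^'r::finite^'r"
  assumes "invertible h" "\<And>v. h ** curvature A x v = curvature A' x' (\<lambda>i. T (v i)) ** h"
    and "\<And>u. h ** \<theta> x u = \<theta>' x' (T u) ** h"
  shows "transgression m \<theta> A x v = transgression m \<theta>' A' x' (\<lambda>i. T (v i))"
proof -
  have 1: "h ** one_form \<theta> x v = one_form \<theta>' x' (\<lambda>i. T (v i)) ** h" for v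
    by (simp add: one_form_def assms(3))
  have 2: "h ** mwpower m (curvature A x) v = mwpower m (curvature A' x') (\<lambda>i. T (v i)) ** h" for v
    by (rule mwpower_intertwine) (rule assms(2))
  show ?thesis
    unfolding transgression_def
    by (rule trace_intertwine[OF assms(1)], rule mwedge_intertwine) (rule 1, rule 2)
qed

section \<open>Trace forms as alternating forms\<close>

definition multilinear :: "nat \<Rightarrow> ((nat \<Rightarrow> 'v::real_vector) \<Rightarrow> 'b::real_vector) \<Rightarrow> bool" where
  "multilinear q f \<longleftrightarrow> (\<forall>v. \<forall>i<q. linear (\<lambda>u. f (v(i := u))))"

lemma multilinear_linear: "linear L \<Longrightarrow> multilinear q f \<Longrightarrow> multilinear q (\<lambda>v. L (f v))"
  unfolding multilinear_def using linear_compose[of _ L] by (auto simp: o_def)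

lemma depends_on_first_comp: "depends_on_first q f \<Longrightarrow> depends_on_first q (\<lambda>v. L (f v))"
  unfolding depends_on_first_def by metis

lemma linear_scaleR_fun: "linear f \<Longrightarrow> linear (\<lambda>u. c *\<^sub>R f u)"
  by (rule linear_compose_scale_right)

lemma alternating_alt:
  assumes dep: "depends_on_first N f" and lin: "multilinear N f"
  shows "alternating N (alt N f)"
  unfolding alternating_def
proof (intro conjI allI impI)
  show "alt N f v = alt N f w" if "\<forall>i<N. v i = w i" for v w
    by (rule depends_on_firstD[OF alt_depends[OF dep]]) (use that in auto)
  fix v :: "nat \<Rightarrow> 'a" and i assume i: "i < N"
  show "linear (\<lambda>u. alt N f (v(i := u)))"
    unfolding alt_def
  proof (intro linear_compose_sum ballI linear_scaleR_fun)
    fix \<pi> assume "\<pi> \<in> {\<pi>. \<pi> permutes {..<N}}"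
    then have \<pi>: "\<pi> permutes {..<N}" by simp
    have "(\<lambda>k. (v(i := u)) (\<pi> k)) = (\<lambda>k. v (\<pi> k))(inv \<pi> i := u)" for u
      using permutes_inverses[OF \<pi>] by (auto simp: fun_eq_iff)
    moreover have "inv \<pi> i < N" using permutes_in_image[OF permutes_inv[OF \<pi>], of i] i by simp
    ultimately show "linear (\<lambda>u. f (\<lambda>k. (v(i := u)) (\<pi> k)))"
      using lin by (simp add: multilinear_def)
  qed
next
  fix v :: "nat \<Rightarrow> 'a" and i j assume a: "i < N" "j < N" "i \<noteq> j \<and> v i = v j"
  let ?t = "Transposition.transpose i j"
  have "(\<lambda>k. v (?t k)) = v" using a by (auto simp: fun_eq_iff Transposition.transpose_def)
  then have *: "alt N f v = - alt N f v"
    using alt_permute_arg[of ?t N f v] a by (simp add: permutes_swap_id sign_swap_id)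
  have "2 *\<^sub>R alt N f v = alt N f v + alt N f v" by (rule scaleR_2)
  also have "\<dots> = alt N f v + - alt N f v" by (rule arg_cong[OF *])
  finally show "alt N f v = 0" by simp
qed

lemma alternating_scale_sum:
  fixes f :: "'j \<Rightarrow> (nat \<Rightarrow> 'v::real_vector) \<Rightarrow> real"
  assumes "\<And>j. j \<in> J \<Longrightarrow> alternating q (f j)"
  shows "alternating q (\<lambda>v. \<Sum>j\<in>J. c j * f j v)"
  unfolding alternating_def
proof (intro conjI allI impI)
  show "(\<Sum>j\<in>J. c j * f j v) = (\<Sum>j\<in>J. c j * f j w)" if "\<forall>i<q. v i = w i" for v w
    using assms that by (intro sum.cong refl) (auto simp: alternating_def)
  show "linear (\<lambda>u. \<Sum>j\<in>J. c j * f j (v(i := u)))" if "i < q" for v i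
    using assms that
    by (intro linear_compose_sum ballI linear_scaleR_fun[where 'b=real, unfolded real_scaleR_def]) (auto simp: alternating_def)
  show "(\<Sum>j\<in>J. c j * f j v) = 0" if "i < q" "j < q" "i \<noteq> j \<and> v i = v j" for v i j
    using assms that by (intro sum.neutral) (auto simp: alternating_def)
qed

lemma multilinear_tprod:
  assumes "depends_on_first p \<alpha>" "multilinear p \<alpha>" "multilinear q \<beta>"
  shows "multilinear (p + q) (tprod p \<alpha> \<beta>)"
  unfolding multilinear_def
proof (intro allI impI)
  fix v :: "nat \<Rightarrow> 'a" and i assume i: "i < p + q"
  show "linear (\<lambda>u. tprod p \<alpha> \<beta> (v(i := u)))"
  proof (cases "i < p")
    case True
    then have "(\<lambda>k. (v(i := u)) (p + k)) = (\<lambda>k. v (p + k))" for u by auto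
    moreover have "linear (\<lambda>u. \<alpha> (v(i := u)))" using assms(2) True by (auto simp: multilinear_def)
    ultimately show ?thesis
      unfolding tprod_def using linear_compose[OF _ matrix_mult_linear_left] by (auto simp: o_def)
  next
    case False
    have a: "\<alpha> (v(i := u)) = \<alpha> v" for u
      by (rule depends_on_firstD[OF assms(1)]) (use False in auto)
    have b: "(\<lambda>k. (v(i := u)) (p + k)) = (\<lambda>k. v (p + k))(i - p := u)" for u
      using False by (auto simp: fun_eq_iff)
    have "i - p < q" using i False by auto
    then have "linear (\<lambda>u. \<beta> ((\<lambda>k. v (p + k))(i - p := u)))"
      using assms(3) by (simp add: multilinear_def)
    then show ?thesis
      unfolding tprod_def a b using linear_compose[OF _ matrix_mult_linear_right] by (auto simp: o_def)
  qed
qed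

lemma multilinear_tpow:
  "depends_on_first 2 \<Phi> \<Longrightarrow> multilinear 2 \<Phi> \<Longrightarrow> multilinear (2 * m) (tpow m \<Phi>)"
proof (induction m)
  case (Suc m)
  then show ?case unfolding tpow.simps mult_Suc_right by (intro multilinear_tprod) auto
qed (simp add: multilinear_def)

lemma multilinear_one_form: "linear (A x) \<Longrightarrow> multilinear 1 (one_form A x)"
  by (simp add: multilinear_def one_form_def)

lemma multilinear_precurv:
  assumes U: "open U" "x \<in> U" and sm: "\<And>u. smooth_on (\<lambda>y. A y u) U" and lin: "\<And>y. y \<in> U \<Longrightarrow> linear (A y)"
  shows "multilinear 2 (precurv A x)"
proof -
  have d: "(\<lambda>y. A y u) differentiable (at x)" for u by (rule smooth_on_differentiable[OF sm U(2)])
  have "linear (\<lambda>u. frechet_derivative (\<lambda>y. A y u) (at x) (v 0) + A x (v 0) ** A x u)" for v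
    by (intro linear_compose_add linear_frechet_derivative_family[OF U lin d]
        linear_compose[OF lin[OF U(2)] matrix_mult_linear_right, unfolded o_def])
  moreover have "linear (\<lambda>u. frechet_derivative (\<lambda>y. A y (v 1)) (at x) u + A x u ** A x (v 1))" for v
    by (intro linear_compose_add linear_frechet_derivative d
        linear_compose[OF lin[OF U(2)] matrix_mult_linear_left, unfolded o_def])
  ultimately show ?thesis by (auto simp: multilinear_def precurv_def less_2_cases_iff)
qed

lemma alternating_trace_form:
  assumes U: "open U" "x \<in> U" and sm: "\<And>u. smooth_on (\<lambda>y. A y u) U" and lin: "\<And>y. y \<in> U \<Longrightarrow> linear (A y)"
  shows "alternating (2 * m) (trace_form m (curvature A x))"
proof -
  have "alternating (2 * m) (alt (2 * m) (\<lambda>v. trace (tpow m (precurv A x) v)))"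
    by (intro alternating_alt multilinear_linear[OF linear_trace] depends_on_first_comp[where L=trace]
        tpow_depends multilinear_tpow precurv_depends multilinear_precurv[OF U sm lin])
  then show ?thesis unfolding trace_form_eq_alt[OF U sm] alt_linear[OF linear_trace] .
qed

lemma alternating_transgression:
  assumes U: "open U" "x \<in> U" and sm: "\<And>u. smooth_on (\<lambda>y. A y u) U" and lin: "\<And>y. y \<in> U \<Longrightarrow> linear (A y)"
    and \<theta>: "linear (\<theta> x)"
  shows "alternating (2 * m + 1) (transgression m \<theta> A x)"
proof -
  have "depends_on_first (1 + 2 * m) (tprod 1 (one_form \<theta> x) (tpow m (precurv A x)))"
    by (intro tprod_depends one_form_depends tpow_depends precurv_depends)
  moreover have "multilinear (1 + 2 * m) (tprod 1 (one_form \<theta> x) (tpow m (precurv A x)))"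
    by (intro multilinear_tprod one_form_depends multilinear_one_form \<theta> multilinear_tpow precurv_depends
        multilinear_precurv[OF U sm lin])
  ultimately have "alternating (2 * m + 1) (alt (2 * m + 1) (\<lambda>v. trace (tprod 1 (one_form \<theta> x) (tpow m (precurv A x)) v)))"
    by (intro alternating_alt multilinear_linear[OF linear_trace] depends_on_first_comp[where L=trace])
      (simp_all add: add.commute)
  then show ?thesis unfolding transgression_eq_alt[OF U sm] alt_linear[OF linear_trace] .
qed

lemma cscale_mult: "cscale z M ** cscale w N = cscale (z * w) (M ** N)"
  by (simp add: cscale_def matrix_matrix_mult_def vec_eq_iff sum_distrib_left ac_simps)

lemma cscale_scaleR: "r *\<^sub>R cscale z M = cscale z (r *\<^sub>R M)"
  by (simp add: cscale_def vec_eq_iff scaleR_conv_of_real[where 'a=complex])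

lemma cscale_sum: "(\<Sum>i\<in>I. cscale z (M i)) = cscale z (\<Sum>i\<in>I. M i)"
  by (induction I rule: infinite_finite_induct) (auto simp: cscale_def vec_eq_iff algebra_simps)

lemma mwpower_cscale: "mwpower m (\<lambda>w. cscale z (F w)) v = cscale (z ^ m) (mwpower m F v)"
proof (induction m arbitrary: v)
  case 0
  show ?case by (simp add: cscale_def vec_eq_iff mat_def)
next
  case (Suc m)
  show ?case by (simp add: mwedge_def Suc cscale_mult cscale_scaleR cscale_sum)
qed

lemma trace_form_cscale: "trace_form m (\<lambda>w. cscale z (F w)) v = z ^ m * complex_of_real (trace_form m F v)"
  by (simp add: trace_form_def mwpower_cscale) (simp add: trace_def cscale_def sum_distrib_left)

definition pontrjagin_const :: "nat \<Rightarrow> real" where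
  "pontrjagin_const k = Re (1 / fact (2 * k) * (-1 / (2 * complex_of_real pi * \<i>)) ^ (2 * k))"

definition triv_over :: "('m, 'n::finite, 'i, 'r::finite) bundle_data \<Rightarrow> ('m, 'n) chart \<Rightarrow> 'i" where
  "triv_over V c = (SOME i. i \<in> triv V \<and> chart_of V i = c)"

text \<open>The scalar factor \<open>-1 / (2 \<pi> \<i>)\<close> can be pulled out of the trace form with its power \<open>2 k\<close>, and what
  remains is the trace form of a real curvature.\<close>

lemma pontrjagin_form_eq:
  "pontrjagin_form V D k c x v = pontrjagin_const k * trace_form (2 * k) (curvature (D (triv_over V c)) x) v"
proof -
  have "Re (a * (b * complex_of_real t)) = Re (a * b) * t" for a b t
    by (simp add: mult.assoc[symmetric])
  then show ?thesis
    unfolding pontrjagin_form_def triv_over_def[symmetric] trace_form_cscale pontrjagin_const_def Let_def .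
qed

section \<open>The Chern--Weil theorem on a manifold\<close>

lemma atlas_chart:
  assumes "smooth_atlas A" "c \<in> A"
  shows "open (dom c)" "open (img c)" "homeomorphism (dom c) (img c) (coord c) (param c)" "inj_on (coord c) (dom c)"
proof -
  show "open (dom c)" "open (img c)" and h: "homeomorphism (dom c) (img c) (coord c) (param c)"
    using assms by (simp_all add: smooth_atlas_def)
  show "inj_on (coord c) (dom c)"
    by (rule inj_on_inverseI[of _ "param c"]) (rule homeomorphism_apply1[OF h])
qed

lemma param_coord: "smooth_atlas A \<Longrightarrow> c \<in> A \<Longrightarrow> p \<in> dom c \<Longrightarrow> param c (coord c p) = p"
  by (meson atlas_chart(4) inv_into_f_f)

lemma open_overlap:
  assumes "smooth_atlas A" "c \<in> A" "c' \<in> A"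
  shows "open (coord c ` (dom c \<inter> dom c'))"
proof -
  have "openin (top_of_set (dom c)) (dom c \<inter> dom c')"
    using atlas_chart(1)[OF assms(1,3)] by (simp add: openin_open_Int)
  then have "openin (top_of_set (img c)) (coord c ` (dom c \<inter> dom c'))"
    using homeomorphism_imp_open_map[OF atlas_chart(3)[OF assms(1,2)]] by blast
  then show ?thesis using atlas_chart(2)[OF assms(1,2)] openin_open_trans by blast
qed

lemma smooth_change:
  "smooth_atlas A \<Longrightarrow> c \<in> A \<Longrightarrow> c' \<in> A \<Longrightarrow> smooth_on (coord c' \<circ> param c) (coord c ` (dom c \<inter> dom c'))"
  unfolding smooth_atlas_def by blast

lemma jac_works:
  assumes "smooth_atlas A" "c \<in> A" "c' \<in> A" "p \<in> dom c \<inter> dom c'"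
  shows "jac c c' p *v u = frechet_derivative (coord c' \<circ> param c) (at (coord c p)) u"
proof -
  have "(coord c' \<circ> param c) differentiable (at (coord c p))"
    by (rule smooth_on_differentiable[OF smooth_change[OF assms(1-3)]]) (use assms(4) in auto)
  then show ?thesis
    unfolding jac_def using jacobian_works frechet_derivative_eqI by metis
qed

lemma triv_over:
  assumes "chart_of V ` triv V = A" "c \<in> A"
  shows "triv_over V c \<in> triv V" "chart_of V (triv_over V c) = c"
proof -
  have "\<exists>i. i \<in> triv V \<and> chart_of V i = c" using assms by auto
  from someI_ex[OF this] show "triv_over V c \<in> triv V" "chart_of V (triv_over V c) = c"
    by (auto simp: triv_over_def)
qed

lemma connection_local:
  assumes "connection A V D" "i \<in> triv V"
  shows "chart_of V i \<in> A" "x \<in> img (chart_of V i) \<Longrightarrow> linear (D i x)"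
    "smooth_on (\<lambda>x. D i x u) (img (chart_of V i))"
  using assms unfolding connection_def vector_bundle_def by auto

lemma connection_gauge:
  assumes "connection A V D" "i \<in> triv V" "j \<in> triv V" "p \<in> dom (chart_of V i) \<inter> dom (chart_of V j)"
  shows "transition V i j p ** D i (coord (chart_of V i) p) u =
            frechet_derivative (transition V i j \<circ> param (chart_of V i)) (at (coord (chart_of V i) p)) u
              + D j (coord (chart_of V j) p) (jac (chart_of V i) (chart_of V j) p *v u) ** transition V i j p"
  using assms unfolding connection_def Let_def by blast

lemma transition_invertible:
  assumes "vector_bundle A V" "i \<in> triv V" "j \<in> triv V" "p \<in> dom (chart_of V i) \<inter> dom (chart_of V j)"
  shows "invertible (transition V i j p)"
proof -
  have "transition V j i p ** transition V i j p = transition V i i p"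
    "transition V i j p ** transition V j i p = transition V j j p"
    using assms unfolding vector_bundle_def by blast+
  then show ?thesis using assms unfolding vector_bundle_def invertible_def by (metis IntD1 IntD2)
qed

text \<open>On an overlap, \<open>curvature_gauge\<close> with the change of coordinates and the transition function.\<close>

lemma connection_curvature:
  assumes A: "smooth_atlas A" and D: "connection A V D" and ij: "i \<in> triv V" "j \<in> triv V"
    and p: "p \<in> dom (chart_of V i) \<inter> dom (chart_of V j)"
  shows "transition V i j p ** curvature (D i) (coord (chart_of V i) p) v
     = curvature (D j) (coord (chart_of V j) p) (\<lambda>k. jac (chart_of V i) (chart_of V j) p *v v k) ** transition V i j p"
proof -
  let ?c = "chart_of V i" and ?c' = "chart_of V j"
  let ?U = "coord ?c ` (dom ?c \<inter> dom ?c')" and ?\<phi> = "coord ?c' \<circ> param ?c" and ?h = "transition V i j \<circ> param ?c"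
  have c: "?c \<in> A" "?c' \<in> A" using connection_local(1)[OF D] ij by auto
  have U: "open ?U" "coord ?c p \<in> ?U" using open_overlap[OF A c] p by auto
  have pc: "param ?c (coord ?c q) = q" if "q \<in> dom ?c" for q using param_coord[OF A c(1) that] .
  have sub: "?\<phi> ` ?U \<subseteq> img ?c'" using pc by auto
  have sh: "smooth_on ?h ?U" using D ij by (simp add: connection_def vector_bundle_def)
  have "?h (coord ?c p) ** curvature (D i) (coord ?c p) v
     = curvature (D j) (?\<phi> (coord ?c p)) (\<lambda>k. frechet_derivative ?\<phi> (at (coord ?c p)) (v k)) ** ?h (coord ?c p)"
  proof (rule curvature_gauge[OF U atlas_chart(2)[OF A c(2)] sub smooth_change[OF A c] sh])
    show "smooth_on (\<lambda>y. D i y u) ?U" for u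
      by (rule smooth_on_subset[OF connection_local(3)[OF D ij(1)]]) auto
    show "smooth_on (\<lambda>y. D j y u) (img ?c')" for u
      by (rule connection_local(3)[OF D ij(2)])
    show "linear (D j y)" if "y \<in> img ?c'" for y
      by (rule connection_local(2)[OF D ij(2) that])
    fix y u assume "y \<in> ?U"
    then obtain q where q: "q \<in> dom ?c \<inter> dom ?c'" "y = coord ?c q" by auto
    show "?h y ** D i y u = frechet_derivative ?h (at y) u + D j (?\<phi> y) (frechet_derivative ?\<phi> (at y) u) ** ?h y"
      using connection_gauge[OF D ij q(1), of u] q pc
      by (simp add: jac_works[OF A c q(1)])
  qed
  then show ?thesis using p pc by (simp add: jac_works[OF A c p])
qed

lemma connection_trace_form:
  assumes A: "smooth_atlas A" and D: "connection A V D" and ij: "i \<in> triv V" "j \<in> triv V"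
    and p: "p \<in> dom (chart_of V i) \<inter> dom (chart_of V j)"
  shows "trace_form m (curvature (D i) (coord (chart_of V i) p)) v
     = trace_form m (curvature (D j) (coord (chart_of V j) p)) (\<lambda>k. jac (chart_of V i) (chart_of V j) p *v v k)"
proof -
  have "vector_bundle A V" using D by (simp add: connection_def)
  show ?thesis
    by (rule trace_form_intertwine[OF transition_invertible[OF \<open>vector_bundle A V\<close> ij p]])
      (rule connection_curvature[OF A D ij p])
qed

lemma ext_deriv_lincomb:
  fixes f g :: "real^'n::finite \<Rightarrow> (nat \<Rightarrow> real^'n) \<Rightarrow> real"
  assumes "\<And>v. (\<lambda>y. f y v) differentiable (at x)" "\<And>v. (\<lambda>y. g y v) differentiable (at x)"
  shows "ext_deriv q (\<lambda>y v. a * f y v + b * g y v) x v = a * ext_deriv q f x v + b * ext_deriv q g x v"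
  using ext_deriv_sum[where f="\<lambda>j. if j then f else g" and x=x and q=q and J=UNIV and c="\<lambda>j. if j then a else b" and v=v] assms
  by (simp add: UNIV_bool add.commute)

lemma diff_formD:
  assumes "diff_form A q \<omega>"
  shows "\<And>c x. c \<in> A \<Longrightarrow> x \<in> img c \<Longrightarrow> alternating q (\<omega> c x)"
    "\<And>c v. c \<in> A \<Longrightarrow> smooth_on (\<lambda>x. \<omega> c x v) (img c)"
    "\<And>c c' p v. c \<in> A \<Longrightarrow> c' \<in> A \<Longrightarrow> p \<in> dom c \<inter> dom c'
      \<Longrightarrow> \<omega> c (coord c p) v = \<omega> c' (coord c' p) (\<lambda>i. jac c c' p *v v i)"
  using assms unfolding diff_form_def by blast+

lemma diff_form_lincomb:
  assumes A: "smooth_atlas A" and f: "diff_form A q \<omega>" and g: "diff_form A q \<omega>'"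
  shows "diff_form A q (\<lambda>c x v. a * \<omega> c x v + b * \<omega>' c x v)"
proof -
  have alt: "alternating q (\<lambda>v. a * \<omega> c x v + b * \<omega>' c x v)" if "c \<in> A" "x \<in> img c" for c x
  proof -
    have "alternating q (if j then \<omega> c x else \<omega>' c x)" for j
      using diff_formD(1)[OF f that] diff_formD(1)[OF g that] by simp
    then have "alternating q (\<lambda>v. \<Sum>j\<in>UNIV. (if j then a else b) * (if j then \<omega> c x else \<omega>' c x) v)"
      by (rule alternating_scale_sum)
    then show ?thesis by (simp add: UNIV_bool add.commute)
  qed
  have sm: "smooth_on (\<lambda>x. a * \<omega> c x v + b * \<omega>' c x v) (img c)" if "c \<in> A" for c v
    using atlas_chart(2)[OF A that] diff_formD(2)[OF f that] diff_formD(2)[OF g that]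
    by (intro smooth_on_add smooth_on_mult smooth_on_const)
  note tr = diff_formD(3)[OF f] diff_formD(3)[OF g]
  show ?thesis unfolding diff_form_def
  proof (intro conjI ballI allI)
    fix c c' p v assume c: "c \<in> A" "c' \<in> A" "p \<in> dom c \<inter> dom c'"
    show "a * \<omega> c (coord c p) v + b * \<omega>' c (coord c p) v =
       a * \<omega> c' (coord c' p) (\<lambda>i. jac c c' p *v v i) + b * \<omega>' c' (coord c' p) (\<lambda>i. jac c c' p *v v i)"
      using tr(1)[OF c, of v] tr(2)[OF c, of v] by (simp only:)
  qed (rule alt sm; assumption)+
qed

lemma diff_form_differentiable:
  "smooth_atlas A \<Longrightarrow> diff_form A q \<omega> \<Longrightarrow> c \<in> A \<Longrightarrow> x \<in> img c \<Longrightarrow> (\<lambda>y. \<omega> c y v) differentiable (at x)"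
  by (rule smooth_on_differentiable[OF diff_formD(2)])

lemma cohomologous_Suc_iff:
  "(\<omega>, \<omega>') \<in> cohomologous A (Suc r) \<longleftrightarrow> \<omega> \<in> closed_forms A (Suc r) \<and> \<omega>' \<in> closed_forms A (Suc r) \<and>
     (\<exists>\<eta>. diff_form A r \<eta> \<and> (\<forall>c\<in>A. \<forall>x\<in>img c. \<forall>v. \<omega>' c x v - \<omega> c x v = ext_deriv r (\<eta> c) x v))"
  by (simp add: cohomologous_def)

text \<open>Primitives can be combined linearly; symmetry and transitivity of the relation are special cases.\<close>

lemma cohomologous_lincomb:
  assumes A: "smooth_atlas A" and 1: "(\<omega>\<^sub>1, \<omega>\<^sub>1') \<in> cohomologous A (Suc r)" and 2: "(\<omega>\<^sub>2, \<omega>\<^sub>2') \<in> cohomologous A (Suc r)"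
    and cl: "\<omega> \<in> closed_forms A (Suc r)" "\<omega>' \<in> closed_forms A (Suc r)"
    and eq: "\<And>c x v. c \<in> A \<Longrightarrow> x \<in> img c \<Longrightarrow> \<omega>' c x v - \<omega> c x v
        = a * (\<omega>\<^sub>1' c x v - \<omega>\<^sub>1 c x v) + b * (\<omega>\<^sub>2' c x v - \<omega>\<^sub>2 c x v)"
  shows "(\<omega>, \<omega>') \<in> cohomologous A (Suc r)"
proof -
  obtain \<eta>\<^sub>1 \<eta>\<^sub>2 where \<eta>: "diff_form A r \<eta>\<^sub>1" "diff_form A r \<eta>\<^sub>2"
    and e: "\<forall>c\<in>A. \<forall>x\<in>img c. \<forall>v. \<omega>\<^sub>1' c x v - \<omega>\<^sub>1 c x v = ext_deriv r (\<eta>\<^sub>1 c) x v"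
      "\<forall>c\<in>A. \<forall>x\<in>img c. \<forall>v. \<omega>\<^sub>2' c x v - \<omega>\<^sub>2 c x v = ext_deriv r (\<eta>\<^sub>2 c) x v"
    using 1 2 unfolding cohomologous_Suc_iff by blast
  have "\<omega>' c x v - \<omega> c x v = ext_deriv r (\<lambda>x v. a * \<eta>\<^sub>1 c x v + b * \<eta>\<^sub>2 c x v) x v"
    if "c \<in> A" "x \<in> img c" for c x v
  proof -
    have "ext_deriv r (\<lambda>x v. a * \<eta>\<^sub>1 c x v + b * \<eta>\<^sub>2 c x v) x v
        = a * ext_deriv r (\<eta>\<^sub>1 c) x v + b * ext_deriv r (\<eta>\<^sub>2 c) x v"
      by (rule ext_deriv_lincomb) (rule diff_form_differentiable[OF A \<eta>(1) that]
        diff_form_differentiable[OF A \<eta>(2) that])+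
    then show ?thesis using e that eq[OF that] by (simp only:)
  qed
  then show ?thesis unfolding cohomologous_Suc_iff
    using cl diff_form_lincomb[OF A \<eta>, of a b] by blast
qed

lemma cohomologous_sym:
  assumes A: "smooth_atlas A" and 1: "(\<omega>, \<omega>') \<in> cohomologous A (Suc r)"
  shows "(\<omega>', \<omega>) \<in> cohomologous A (Suc r)"
  by (rule cohomologous_lincomb[OF A 1 1, of _ _ "-1" 0]) (use 1 in \<open>auto simp: cohomologous_Suc_iff\<close>)

lemma cohomologous_trans:
  assumes A: "smooth_atlas A" and 1: "(\<omega>, \<omega>') \<in> cohomologous A (Suc r)" and 2: "(\<omega>', \<omega>'') \<in> cohomologous A (Suc r)"
  shows "(\<omega>, \<omega>'') \<in> cohomologous A (Suc r)"
  by (rule cohomologous_lincomb[OF A 1 2, of _ _ 1 1]) (use 1 2 in \<open>auto simp: cohomologous_Suc_iff\<close>)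

lemma de_rham_class_eqI:
  assumes "smooth_atlas A" "(\<omega>, \<omega>') \<in> cohomologous A (Suc r)"
  shows "de_rham_class A (Suc r) \<omega> = de_rham_class A (Suc r) \<omega>'"
  unfolding de_rham_class_def
  using cohomologous_sym[OF assms(1)] cohomologous_trans[OF assms(1)] assms(2) by blast

text \<open>Two families of local expressions describe the same form if they agree on the images of the charts.\<close>

lemma closed_forms_cong:
  assumes A: "smooth_atlas A" and cl: "\<omega> \<in> closed_forms A q"
    and eq: "\<And>c x v. c \<in> A \<Longrightarrow> x \<in> img c \<Longrightarrow> \<omega>' c x v = \<omega> c x v"
  shows "\<omega>' \<in> closed_forms A q"
proof -
  have f: "diff_form A q \<omega>" and z: "\<And>c x v. c \<in> A \<Longrightarrow> x \<in> img c \<Longrightarrow> ext_deriv q (\<omega> c) x v = 0"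
    using cl by (auto simp: closed_forms_def)
  have "ext_deriv q (\<omega>' c) x v = ext_deriv q (\<omega> c) x v" if "c \<in> A" "x \<in> img c" for c x v
    by (rule ext_deriv_cong[OF atlas_chart(2)[OF A that(1)] that(2)]) (rule ext, erule eq[OF that(1)])
  moreover have "diff_form A q \<omega>'"
    unfolding diff_form_def
  proof (intro conjI ballI allI)
    fix c x assume c: "c \<in> A" "x \<in> img c"
    have "\<omega>' c x = \<omega> c x" using eq[OF c] by auto
    then show "alternating q (\<omega>' c x)" using diff_formD(1)[OF f c] by simp
  next
    fix c v assume c: "c \<in> A"
    show "smooth_on (\<lambda>x. \<omega>' c x v) (img c)"
      by (rule smooth_on_cong[OF atlas_chart(2)[OF A c], of "\<lambda>x. \<omega> c x v"]) (erule eq[OF c, symmetric], rule diff_formD(2)[OF f c])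
  next
    fix c c' p v assume c: "c \<in> A" "c' \<in> A" "p \<in> dom c \<inter> dom c'"
    have "coord c p \<in> img c" "coord c' p \<in> img c'" using c by auto
    with diff_formD(3)[OF f c, of v] show "\<omega>' c (coord c p) v = \<omega>' c' (coord c' p) (\<lambda>i. jac c c' p *v v i)"
      by (simp only: eq[OF c(1)] eq[OF c(2)])
  qed
  ultimately show ?thesis using z by (simp add: closed_forms_def)
qed

lemma cohomologous_cong:
  assumes A: "smooth_atlas A" and 1: "(\<omega>, \<omega>\<^sub>1) \<in> cohomologous A (Suc r)"
    and eq: "\<And>c x v. c \<in> A \<Longrightarrow> x \<in> img c \<Longrightarrow> \<omega>' c x v = \<omega>\<^sub>1 c x v"
  shows "(\<omega>, \<omega>') \<in> cohomologous A (Suc r)"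
proof (rule cohomologous_lincomb[OF A 1 1, of _ _ 1 0])
  show "\<omega> \<in> closed_forms A (Suc r)" using 1 by (simp add: cohomologous_Suc_iff)
  show "\<omega>' \<in> closed_forms A (Suc r)"
    by (rule closed_forms_cong[OF A _ eq]) (use 1 in \<open>auto simp: cohomologous_Suc_iff\<close>)
qed (simp add: eq)

lemma pontrjagin_form_closed:
  assumes A: "smooth_atlas A" and D: "connection A V D"
  shows "pontrjagin_form V D k \<in> closed_forms A (4 * k)"
proof -
  have V: "chart_of V ` triv V = A" using D by (simp add: connection_def vector_bundle_def)
  note t = triv_over[OF V]
  have lin: "linear (D (triv_over V c) x)" if "c \<in> A" "x \<in> img c" for c x
    using connection_local(2)[OF D t(1)[OF that(1)]] t(2)[OF that(1)] that(2) by simp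
  have sm: "smooth_on (\<lambda>x. D (triv_over V c) x u) (img c)" if "c \<in> A" for c u
    using connection_local(3)[OF D t(1)[OF that]] t(2)[OF that] by simp
  have four: "4 * k = 2 * (2 * k)" by simp
  have f: "diff_form A (4 * k) (pontrjagin_form V D k)"
    unfolding diff_form_def
  proof (intro conjI ballI allI)
    fix c x assume c: "c \<in> A" "x \<in> img c"
    have "alternating (4 * k) (trace_form (2 * k) (curvature (D (triv_over V c)) x))"
      unfolding four by (rule alternating_trace_form[OF atlas_chart(2)[OF A c(1)] c(2) sm[OF c(1)] lin[OF c(1)]])
    from alternating_scale_sum[of "{0::nat}", OF this, of "\<lambda>_. pontrjagin_const k"]
    show "alternating (4 * k) (pontrjagin_form V D k c x)"
      by (simp add: pontrjagin_form_eq[abs_def])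
  next
    fix c v assume c: "c \<in> A"
    show "smooth_on (\<lambda>x. pontrjagin_form V D k c x v) (img c)"
      unfolding pontrjagin_form_eq
      by (intro smooth_on_mult smooth_on_const smooth_on_trace_form atlas_chart(2)[OF A c] sm[OF c])
  next
    fix c c' p v assume c: "c \<in> A" "c' \<in> A" and p: "p \<in> dom c \<inter> dom c'"
    show "pontrjagin_form V D k c (coord c p) v = pontrjagin_form V D k c' (coord c' p) (\<lambda>i. jac c c' p *v v i)"
      unfolding pontrjagin_form_eq
      using connection_trace_form[OF A D t(1)[OF c(1)] t(1)[OF c(2)], of p "2 * k" v] p
      by (simp add: t(2) c)
  qed
  moreover have "ext_deriv (4 * k) (pontrjagin_form V D k c) x v = 0" if c: "c \<in> A" "x \<in> img c" for c x v
  proof -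
    let ?T = "\<lambda>y. trace_form (2 * k) (curvature (D (triv_over V c)) y)"
    have d: "(\<lambda>y. ?T y v) differentiable (at x)" for v
      by (rule smooth_on_differentiable[OF smooth_on_trace_form[OF atlas_chart(2)[OF A c(1)] sm[OF c(1)]] c(2)])
    have "ext_deriv (4 * k) (pontrjagin_form V D k c) x v = ext_deriv (4 * k) (\<lambda>y v. pontrjagin_const k * ?T y v + 0 * ?T y v) x v"
      by (simp add: pontrjagin_form_eq[abs_def])
    also have "\<dots> = pontrjagin_const k * ext_deriv (2 * (2 * k)) ?T x v"
      unfolding ext_deriv_lincomb[OF d d] four by simp
    also have "ext_deriv (2 * (2 * k)) ?T x v = 0"
      by (rule trace_form_closed[OF atlas_chart(2)[OF A c(1)] c(2) sm[OF c(1)]])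
    finally show ?thesis by simp
  qed
  ultimately show ?thesis by (simp add: closed_forms_def)
qed

text \<open>The gauge equation of a connection form is affine, so the connections form an affine space.\<close>

lemma connection_path:
  assumes A: "smooth_atlas A" and D: "connection A V D" and D': "connection A V D'"
  shows "connection A V (\<lambda>i. conn_path (D i) (\<lambda>x u. D' i x u - D i x u) t)"
  unfolding connection_def
proof (intro conjI ballI allI)
  show "vector_bundle A V" using D by (simp add: connection_def)
  fix i assume i: "i \<in> triv V"
  note l = connection_local[OF D i] connection_local[OF D' i]
  have o: "open (img (chart_of V i))" using atlas_chart(2)[OF A l(1)] .
  show "linear (conn_path (D i) (\<lambda>x u. D' i x u - D i x u) t x)" if "x \<in> img (chart_of V i)" for x
    unfolding conn_path_def[abs_def]
    by (intro linear_compose_add linear_compose_scale_right linear_compose_sub l that)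
  show "smooth_on (\<lambda>x. conn_path (D i) (\<lambda>x u. D' i x u - D i x u) t x u) (img (chart_of V i))" for u
    by (intro smooth_on_conn_path smooth_on_diff o l)
  fix j p u assume j: "j \<in> triv V" and p: "p \<in> dom (chart_of V i) \<inter> dom (chart_of V j)"
  show "let c = chart_of V i; c' = chart_of V j; h = transition V i j in
          h p ** conn_path (D i) (\<lambda>x u. D' i x u - D i x u) t (coord c p) u =
            frechet_derivative (h \<circ> param c) (at (coord c p)) u
              + conn_path (D j) (\<lambda>x u. D' j x u - D j x u) t (coord c' p) (jac c c' p *v u) ** h p"
    unfolding Let_def conn_path_def
    using connection_gauge[OF D i j p, of u] connection_gauge[OF D' i j p, of u]
    by (simp add: matrix_ring_simps)
qed

text \<open>The difference \<open>\<theta>\<close> of the connections transforms without an inhomogeneous term. The local primitives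
  from \<open>transgression_formula\<close> are traces of products of \<open>\<theta>\<close> with curvatures of connections on the same
  bundle, and therefore agree on overlaps.\<close>

theorem chern_weil:
  assumes A: "smooth_atlas A" and D: "connection A V D" and D': "connection A V D'" and k: "k \<ge> 1"
  shows "(pontrjagin_form V D k, pontrjagin_form V D' k) \<in> cohomologous A (4 * k)"
proof -
  have V: "chart_of V ` triv V = A" and VB: "vector_bundle A V"
    using D by (simp_all add: connection_def vector_bundle_def)
  note t = triv_over[OF V]
  define m where "m = 2 * k - 1"
  have m: "2 * k = Suc m" "4 * k = Suc (2 * m + 1)" using k by (auto simp: m_def)
  define \<theta> where "\<theta> i x u = D' i x u - D i x u" for i x u
  define E where "E s i = conn_path (D i) (\<theta> i) s" for s i
  have E: "connection A V (E s)" for s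
    unfolding E_def \<theta>_def[abs_def] by (rule connection_path[OF A D D'])
  have \<theta>_gauge: "transition V i j p ** \<theta> i (coord (chart_of V i) p) u
      = \<theta> j (coord (chart_of V j) p) (jac (chart_of V i) (chart_of V j) p *v u) ** transition V i j p"
    if "i \<in> triv V" "j \<in> triv V" "p \<in> dom (chart_of V i) \<inter> dom (chart_of V j)" for i j p u
    using connection_gauge[OF D that, of u] connection_gauge[OF D' that, of u]
    by (simp add: \<theta>_def matrix_ring_simps)
  have lin: "linear (D (triv_over V c) x)" "linear (D' (triv_over V c) x)" "linear (E s (triv_over V c) x)" if "c \<in> A" "x \<in> img c" for c x s
    using connection_local(2)[OF D t(1)[OF that(1)]] connection_local(2)[OF D' t(1)[OF that(1)]]
      connection_local(2)[OF E t(1)[OF that(1)]] t(2)[OF that(1)] that(2) by auto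
  have sm: "smooth_on (\<lambda>x. D (triv_over V c) x u) (img c)" "smooth_on (\<lambda>x. D' (triv_over V c) x u) (img c)"
     "smooth_on (\<lambda>x. E s (triv_over V c) x u) (img c)" if "c \<in> A" for c u s
    using connection_local(3)[OF D t(1)[OF that]] connection_local(3)[OF D' t(1)[OF that]]
      connection_local(3)[OF E t(1)[OF that]] t(2)[OF that] by auto
  have sm\<theta>: "smooth_on (\<lambda>x. \<theta> (triv_over V c) x u) (img c)" if "c \<in> A" for c u
    unfolding \<theta>_def by (intro smooth_on_diff sm[OF that] atlas_chart(2)[OF A that])
  have lin\<theta>: "linear (\<theta> (triv_over V c) x)" if "c \<in> A" "x \<in> img c" for c x
    unfolding \<theta>_def[abs_def] by (intro linear_compose_sub lin[OF that])
  define \<eta> where "\<eta> c x v = pontrjagin_const k * total_transgression m (D (triv_over V c)) (\<theta> (triv_over V c)) x v" for c x v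
  have "diff_form A (2 * m + 1) \<eta>"
    unfolding diff_form_def
  proof (intro conjI ballI allI)
    fix c x assume c: "c \<in> A" "x \<in> img c"
    let ?i = "triv_over V c"
    have "alternating (2 * m + 1) (transgression m (\<theta> ?i) (E s ?i) x)" for s
      by (rule alternating_transgression[where A="E s ?i" and \<theta>="\<theta> ?i",
            OF atlas_chart(2)[OF A c(1)] c(2) sm(3)[OF c(1)] lin(3)[OF c(1)] lin\<theta>[OF c]])
    then have "alternating (2 * m + 1) (total_transgression m (D ?i) (\<theta> ?i) x)"
      unfolding total_transgression_def[abs_def] E_def by (intro alternating_scale_sum)
    from alternating_scale_sum[of "{0::nat}", OF this, of "\<lambda>_. pontrjagin_const k"]
    show "alternating (2 * m + 1) (\<eta> c x)" by (simp add: \<eta>_def[abs_def])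
  next
    fix c v assume c: "c \<in> A"
    show "smooth_on (\<lambda>x. \<eta> c x v) (img c)"
      unfolding \<eta>_def
      by (intro smooth_on_mult smooth_on_const smooth_on_total_transgression atlas_chart(2)[OF A c] sm[OF c] sm\<theta>[OF c])
  next
    fix c c' p v assume c: "c \<in> A" "c' \<in> A" and p: "p \<in> dom c \<inter> dom c'"
    let ?i = "triv_over V c" and ?j = "triv_over V c'"
    have i: "?i \<in> triv V" "?j \<in> triv V" using t(1) c by auto
    have p': "p \<in> dom (chart_of V ?i) \<inter> dom (chart_of V ?j)" using p t(2) c by simp
    have "transgression m (\<theta> ?i) (E s ?i) (coord (chart_of V ?i) p) v
        = transgression m (\<theta> ?j) (E s ?j) (coord (chart_of V ?j) p) (\<lambda>k. jac (chart_of V ?i) (chart_of V ?j) p *v v k)" for s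
      by (rule transgression_intertwine[where T="\<lambda>u. jac (chart_of V ?i) (chart_of V ?j) p *v u",
            OF transition_invertible[OF VB i p']])
        (rule connection_curvature[OF A E i p'], rule \<theta>_gauge[OF i p'])
    then show "\<eta> c (coord c p) v = \<eta> c' (coord c' p) (\<lambda>i. jac c c' p *v v i)"
      unfolding \<eta>_def total_transgression_def E_def by (simp add: t(2) c)
  qed
  moreover have "pontrjagin_form V D' k c x v - pontrjagin_form V D k c x v = ext_deriv (2 * m + 1) (\<eta> c) x v"
    if c: "c \<in> A" "x \<in> img c" for c x v
  proof -
    let ?i = "triv_over V c"
    note U = atlas_chart(2)[OF A c(1)] c(2)
    have d: "(\<lambda>y. total_transgression m (D ?i) (\<theta> ?i) y v) differentiable (at x)" for v
      by (rule smooth_on_differentiable[OF smooth_on_total_transgression[OF U(1) sm(1)[OF c(1)] sm\<theta>[OF c(1)]] U(2)])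
    have e1: "conn_path (D ?i) (\<theta> ?i) 1 = D' ?i" by (simp add: conn_path_def \<theta>_def fun_eq_iff)
    have "ext_deriv (2 * m + 1) (\<eta> c) x v = ext_deriv (2 * m + 1)
        (\<lambda>y v. pontrjagin_const k * total_transgression m (D ?i) (\<theta> ?i) y v + 0 * total_transgression m (D ?i) (\<theta> ?i) y v) x v"
      by (simp add: \<eta>_def[abs_def])
    also have "\<dots> = pontrjagin_const k * ext_deriv (2 * m + 1) (total_transgression m (D ?i) (\<theta> ?i)) x v"
      unfolding ext_deriv_lincomb[OF d d] by simp
    also have "\<dots> = pontrjagin_const k * (trace_form (Suc m) (curvature (D' ?i) x) v - trace_form (Suc m) (curvature (D ?i) x) v)"
      using transgression_formula[where A="D ?i" and \<theta>="\<theta> ?i" and m=m and v=v,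
          OF U sm(1)[OF c(1)] sm\<theta>[OF c(1)]] unfolding e1 by simp
    finally show ?thesis unfolding pontrjagin_form_eq m by (simp add: algebra_simps)
  qed
  ultimately show ?thesis
    using pontrjagin_form_closed[OF A D, of k] pontrjagin_form_closed[OF A D', of k]
    unfolding m cohomologous_Suc_iff by blast
qed

section \<open>The Levi-Civita connection\<close>

definition outer :: "real^'m::finite \<Rightarrow> real^'n::finite \<Rightarrow> real^'n^'m" where
  "outer a b = (\<chi> i j. a $ i * b $ j)"

lemma outer_vector: "outer a b *v w = (b \<bullet> w) *\<^sub>R a"
  by (simp add: outer_def matrix_vector_mult_def vec_eq_iff inner_vec_def sum_distrib_right sum_distrib_left ac_simps)
lemma matrix_outer: "M ** outer a b = outer (M *v a) b"
  by (simp add: outer_def matrix_matrix_mult_def matrix_vector_mult_def vec_eq_iff sum_distrib_right sum_distrib_left ac_simps)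
lemma outer_matrix: "outer a b ** M = outer a (transpose M *v b)"
  by (simp add: outer_def matrix_matrix_mult_def matrix_vector_mult_def transpose_def vec_eq_iff sum_distrib_left ac_simps)
lemma transpose_outer: "transpose (outer a b) = outer b a"
  by (simp add: outer_def transpose_def vec_eq_iff ac_simps)
lemma outer_algebra:
  "outer (a + a') b = outer a b + outer a' b" "outer (a - a') b = outer a b - outer a' b"
  "outer a (b + b') = outer a b + outer a b'" "outer a (b - b') = outer a b - outer a b'"
  "outer (- a) b = - outer a b" "outer a (- b) = - outer a b"
  "outer (r *\<^sub>R a) b = r *\<^sub>R outer a b" "outer a (r *\<^sub>R b) = r *\<^sub>R outer a b"
  "outer 0 b = 0" "outer a 0 = 0"
  by (simp_all add: outer_def vec_eq_iff algebra_simps)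

lemma transpose_algebra:
  fixes M N :: "real^'n::finite^'m::finite"
  shows "transpose (M + N) = transpose M + transpose N" "transpose (M - N) = transpose M - transpose N"
    "transpose (- M) = - transpose M" "transpose (r *\<^sub>R M) = r *\<^sub>R transpose M"
  by (simp_all add: transpose_def vec_eq_iff)

lemma matrix_inner: "(M *v a) \<bullet> b = a \<bullet> (transpose M *v (b::real^'m::finite))"
  by (metis dot_lmul_matrix inner_commute transpose_matrix_vector)

lemma bounded_linear_transpose: "bounded_linear (transpose :: real^'n::finite^'m::finite \<Rightarrow> real^'m^'n)"
  by (rule linear_conv_bounded_linear[THEN iffD1]) (rule linearI, simp_all add: transpose_algebra)

lemma matrix_vector_simps:
  fixes M N :: "real^'n::finite^'m::finite"
  shows "(M + N) *v a = M *v a + N *v a" "(M - N) *v a = M *v a - N *v a" "(- M) *v a = - (M *v a)"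
    "(r *\<^sub>R M) *v a = r *\<^sub>R (M *v a)" "M *v (a + b) = M *v a + M *v b" "M *v (a - b) = M *v a - M *v b"
    "M *v (- a) = - (M *v a)" "M *v (r *\<^sub>R a) = r *\<^sub>R (M *v a)"
  using bounded_bilinear.minus_left[OF bounded_bilinear_matrix_vector, of M a]
    bounded_bilinear.minus_right[OF bounded_bilinear_matrix_vector, of M a]
    bounded_bilinear.scaleR_left[OF bounded_bilinear_matrix_vector, of r M a]
    bounded_bilinear.scaleR_right[OF bounded_bilinear_matrix_vector, of M r a]
    bounded_bilinear.add_left[OF bounded_bilinear_matrix_vector, of M N a]
    bounded_bilinear.add_right[OF bounded_bilinear_matrix_vector, of M a b]
    bounded_bilinear.diff_left[OF bounded_bilinear_matrix_vector, of M N a]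
    bounded_bilinear.diff_right[OF bounded_bilinear_matrix_vector, of M a b] by auto

lemma linear_matrix_vector: "linear ((*v) (M::real^'n::finite^'m::finite))"
  by (rule linearI) (simp_all add: matrix_vector_simps)

lemma matrix_eqI:
  fixes M N :: "real^'n::finite^'m::finite"
  assumes "\<And>v. M *v v = N *v v" shows "M = N"
  using assms matrix_eq[of M N] by blast

lemma vector_inner_eqI:
  fixes a b :: "'a::real_inner"
  assumes "\<And>w. w \<bullet> a = w \<bullet> b" shows "a = b"
  using assms[of "a - b"] by (metis eq_iff_diff_eq_0 inner_diff_right inner_eq_zero_iff)

text \<open>The matrices \<open>\<Gamma> u\<close> are torsion-free and compatible with the metric at the single point \<open>x\<close>.\<close>

definition levi_civita_at :: "(real^'n \<Rightarrow> real^'n^'n) \<Rightarrow> real^'n \<Rightarrow> (real^'n \<Rightarrow> real^'n^'n::finite) \<Rightarrow> bool" where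
  "levi_civita_at G x \<Gamma> \<longleftrightarrow> (\<forall>u w. \<Gamma> u *v w = \<Gamma> w *v u) \<and>
     (\<forall>u. frechet_derivative G (at x) u = G x ** \<Gamma> u + transpose (\<Gamma> u) ** G x)"

text \<open>For the difference \<open>\<Delta>\<close> of two solutions, \<open>G (\<Delta> u v, w)\<close> is symmetric in \<open>u, v\<close> and
  skew in \<open>v, w\<close>; such a trilinear form vanishes.\<close>

lemma levi_civita_at_unique:
  assumes sym: "transpose (G x) = G x" and inv: "invertible (G x)"
    and 1: "levi_civita_at G x \<Gamma>" and 2: "levi_civita_at G x \<Gamma>'"
  shows "\<Gamma> u = \<Gamma>' u"
proof -
  define \<Delta> where "\<Delta> u = \<Gamma> u - \<Gamma>' u" for u
  define B where "B u v w = w \<bullet> (G x *v (\<Delta> u *v v))" for u v w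
  have s: "B u v w = B v u w" for u v w
    using 1 2 by (simp add: B_def \<Delta>_def levi_civita_at_def matrix_vector_simps)
  have z: "G x ** \<Delta> u = - (transpose (\<Delta> u) ** G x)" for u
  proof -
    have "G x ** \<Gamma> u + transpose (\<Gamma> u) ** G x = G x ** \<Gamma>' u + transpose (\<Gamma>' u) ** G x"
      using 1 2 unfolding levi_civita_at_def by metis
    then show ?thesis by (simp add: \<Delta>_def matrix_ring_simps transpose_algebra algebra_simps)
  qed
  have a: "B u v w = - B u w v" for u v w
  proof -
    have "B u v w = w \<bullet> ((G x ** \<Delta> u) *v v)" by (simp add: B_def matrix_vector_mul_assoc)
    also have "\<dots> = - (w \<bullet> (transpose (\<Delta> u) *v (G x *v v)))"
      by (simp add: z matrix_vector_simps matrix_vector_mul_assoc)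
    also have "w \<bullet> (transpose (\<Delta> u) *v (G x *v v)) = (\<Delta> u *v w) \<bullet> (G x *v v)"
      by (simp add: matrix_inner)
    also have "\<dots> = B u w v" by (simp add: B_def matrix_inner[of "G x" v] inner_commute sym)
    finally show ?thesis .
  qed
  have B0: "B u v w = 0" for u v w
    using s[of u v w] a[of v u w] s[of v w u] a[of w v u] s[of w u v] a[of u w v] by linarith
  have "G x *v (\<Delta> u *v v) = 0" for u v
    by (rule vector_inner_eqI) (simp add: B0[unfolded B_def])
  then have "(matrix_inv (G x) ** G x) *v (\<Delta> u *v v) = 0" for u v
    unfolding matrix_vector_mul_assoc[symmetric, of "matrix_inv (G x)" "G x"] by simp
  then have "\<Delta> u *v v = 0 *v v" for u v by (simp add: matrix_inv_inverse[OF inv])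
  then have "\<Delta> u = 0" for u by (rule matrix_eqI)
  then show ?thesis by (simp add: \<Delta>_def)
qed

lemma linear_axis_expansion:
  assumes "linear f"
  shows "f (u::real^'n::finite) = (\<Sum>b\<in>UNIV. u $ b *\<^sub>R f (axis b 1))"
proof -
  have "f u = f (\<Sum>b\<in>UNIV. u $ b *\<^sub>R axis b 1)"
    using basis_expansion[of u] by (simp add: scalar_mult_eq_scaleR)
  then show ?thesis by (simp add: linear_sum[OF assms] linear_cmul[OF assms])
qed

lemma pd_entry:
  assumes "G differentiable (at x)"
  shows "pd b (\<lambda>y. G y $ d $ c) x = frechet_derivative G (at x) (axis b 1) $ d $ c"
proof -
  have "(G has_derivative frechet_derivative G (at x)) (at x)" using assms frechet_derivative_works by blast
  from bounded_linear.has_derivative[OF bounded_linear_vec_nth bounded_linear.has_derivative[OF bounded_linear_vec_nth this]]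
  have "((\<lambda>y. G y $ d $ c) has_derivative (\<lambda>h. frechet_derivative G (at x) h $ d $ c)) (at x)" .
  from frechet_derivative_eqI[OF this] show ?thesis by (simp add: pd_def)
qed

lemma levi_civita_at_levi_civita:
  assumes U: "open U" "x \<in> U" and sm: "smooth_on G U" and sym: "\<And>y. y \<in> U \<Longrightarrow> transpose (G y) = G y"
    and inv: "invertible (G x)"
  shows "levi_civita_at G x (levi_civita G x)"
proof -
  have d: "G differentiable (at x)" by (rule smooth_on_differentiable[OF sm U(2)])
  define D where "D b = frechet_derivative G (at x) (axis b 1)" for b
  have Dsym: "D b $ c $ d = D b $ d $ c" for b c d
  proof -
    have "frechet_derivative (\<lambda>y. transpose (G y)) (at x) = frechet_derivative G (at x)"
      by (rule frechet_derivative_cong_open[OF U sym])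
    moreover have "frechet_derivative (\<lambda>y. transpose (G y)) (at x) = (\<lambda>u. transpose (frechet_derivative G (at x) u))"
      by (rule frechet_derivative_eqI[OF bounded_linear.has_derivative[OF bounded_linear_transpose smooth_on_has_derivative[OF sm U(2)]]])
    ultimately have "transpose (D b) = D b" unfolding D_def by metis
    from arg_cong[where f="\<lambda>X. X $ d $ c", OF this] show ?thesis by (simp add: transpose_def)
  qed
  \<comment> \<open>twice the Christoffel symbols with all indices lowered\<close>
  define K where "K e b c = D b $ e $ c + D c $ e $ b - D e $ b $ c" for e b c
  define M where "M u = (\<chi> e c. \<Sum>b\<in>UNIV. u $ b * (1/2 * K e b c))" for u
  have chr: "christoffel G x a b c = 1/2 * (\<Sum>e\<in>UNIV. matrix_inv (G x) $ a $ e * K e b c)" for a b c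
    unfolding christoffel_def K_def D_def by (simp add: pd_entry[OF d])
  have lc: "levi_civita G x u = matrix_inv (G x) ** M u" for u
  proof -
    have "(\<Sum>b\<in>UNIV. u $ b * (1/2 * (\<Sum>e\<in>UNIV. matrix_inv (G x) $ a $ e * K e b c)))
      = (\<Sum>e\<in>UNIV. matrix_inv (G x) $ a $ e * (\<Sum>b\<in>UNIV. u $ b * (1/2 * K e b c)))" for a c
      unfolding sum_distrib_left by (subst sum.swap) (simp add: ac_simps)
    then show ?thesis
      unfolding levi_civita_def chr M_def matrix_matrix_mult_def by (simp add: vec_eq_iff)
  qed
  have GM: "G x ** levi_civita G x u = M u" for u
    unfolding lc by (simp add: matrix_mul_assoc matrix_inv_inverse[OF inv])
  have dG: "frechet_derivative G (at x) u $ e $ c = (\<Sum>b\<in>UNIV. u $ b * D b $ e $ c)" for u e c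
    using arg_cong[where f="\<lambda>X. X $ e $ c", OF linear_axis_expansion[OF linear_frechet_derivative[OF d], of u]]
    by (simp add: D_def)
  have met: "frechet_derivative G (at x) u = M u + transpose (M u)" for u
  proof -
    have "(\<Sum>b\<in>UNIV. u $ b * D b $ e $ c) = (\<Sum>b\<in>UNIV. u $ b * (1/2 * K e b c)) + (\<Sum>b\<in>UNIV. u $ b * (1/2 * K c b e))" for e c
    proof -
      have "D b $ e $ c = 1/2 * K e b c + 1/2 * K c b e" for b
        using Dsym[of b c e] Dsym[of e c b] Dsym[of c b e] by (simp add: K_def field_simps)
      then show ?thesis by (simp only: distrib_left sum.distrib)
    qed
    then show ?thesis by (simp add: vec_eq_iff dG M_def transpose_def)
  qed
  have Ksym: "K e b c = K e c b" for e b c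
    unfolding K_def using Dsym[of e b c] by simp
  have "M u *v w = M w *v u" for u w
  proof -
    have "(\<Sum>c\<in>UNIV. (\<Sum>b\<in>UNIV. u $ b * (1/2 * K e b c)) * w $ c) = (\<Sum>c\<in>UNIV. (\<Sum>b\<in>UNIV. w $ b * (1/2 * K e b c)) * u $ c)" for e
      unfolding sum_distrib_right by (subst sum.swap) (simp add: Ksym[of e] ac_simps)
    then show ?thesis by (simp add: M_def matrix_vector_mult_def vec_eq_iff)
  qed
  then have tors: "levi_civita G x u *v w = levi_civita G x w *v u" for u w
    unfolding lc matrix_vector_mul_assoc[symmetric] by simp
  have "transpose (levi_civita G x u) ** G x = transpose (M u)" for u
    unfolding GM[symmetric] matrix_transpose_mul sym[OF U(2)] ..
  then show ?thesis using met tors by (simp add: levi_civita_at_def GM)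
qed

lemma linear_levi_civita: "linear (levi_civita G x)"
  by (rule linearI) (simp_all add: levi_civita_def vec_eq_iff algebra_simps sum.distrib sum_distrib_left)

lemma smooth_on_levi_civita:
  assumes U: "open U" and sm: "smooth_on G U" and inv: "\<And>y. y \<in> U \<Longrightarrow> invertible (G y)"
  shows "smooth_on (\<lambda>y. levi_civita G y u) U"
proof -
  have pd: "smooth_on (\<lambda>x. pd b (\<lambda>y. G y $ d $ c) x) U" for b c d
    unfolding pd_def by (intro smooth_on_frechet smooth_on_matrix_nth U sm)
  have "smooth_on (\<lambda>x. christoffel G x a b c) U" for a b c
    unfolding christoffel_def
    by (intro smooth_on_mult smooth_on_sum smooth_on_diff smooth_on_add smooth_on_const pd U
        smooth_on_matrix_nth smooth_on_matrix_inv sm inv)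
  then show ?thesis
    by (intro smooth_on_matrixI[OF U]) (auto simp: levi_civita_def U intro!: smooth_on_sum smooth_on_mult)
qed

lemma matrix_entry_axis: "(M::real^'n::finite^'m::finite) $ a $ b = (M *v axis b 1) $ a"
  by (simp add: matrix_vector_mult_basis column_def)

lemma vector_bundle_tangent_bundle:
  assumes A: "smooth_atlas A"
  shows "vector_bundle A (tangent_bundle A)"
proof -
  have "smooth_on (jac c c' \<circ> param c) (coord c ` (dom c \<inter> dom c'))" if c: "c \<in> A" "c' \<in> A" for c c'
  proof (rule smooth_on_matrixI[OF open_overlap[OF A c]])
    fix a b
    let ?U = "coord c ` (dom c \<inter> dom c')"
    have "smooth_on (\<lambda>x. frechet_derivative (coord c' \<circ> param c) (at x) (axis b 1) $ a) ?U"
      by (intro smooth_on_vec_nth smooth_on_frechet smooth_change[OF A c] open_overlap[OF A c])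
    then show "smooth_on (\<lambda>x. (jac c c' \<circ> param c) x $ a $ b) ?U"
      by (rule smooth_on_cong[OF open_overlap[OF A c], rotated])
        (auto simp: param_coord[OF A c(1)] matrix_entry_axis[of "jac _ _ _"] jac_works[OF A c])
  qed
  moreover have "jac c c p = mat 1" if c: "c \<in> A" and p: "p \<in> dom c" for c p
  proof (rule matrix_eqI)
    fix v
    have "frechet_derivative (coord c \<circ> param c) (at (coord c p)) = frechet_derivative (\<lambda>x. x) (at (coord c p))"
      by (rule frechet_derivative_cong_open[OF atlas_chart(2)[OF A c]]) (use p param_coord[OF A c] in auto)
    then show "jac c c p *v v = mat 1 *v v" using jac_works[OF A c c, of p v] p by simp
  qed
  moreover have "jac c' c'' p ** jac c c' p = jac c c'' p"
    if c: "c \<in> A" "c' \<in> A" "c'' \<in> A" and p: "p \<in> dom c \<inter> dom c' \<inter> dom c''" for c c' c'' p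
  proof (rule matrix_eqI)
    fix v
    let ?U = "coord c ` (dom c \<inter> (dom c' \<inter> dom c''))"
    have "openin (top_of_set (dom c)) (dom c \<inter> (dom c' \<inter> dom c''))"
      by (intro openin_open_Int open_Int atlas_chart(1)[OF A] c)
    then have "openin (top_of_set (img c)) ?U"
      using homeomorphism_imp_open_map[OF atlas_chart(3)[OF A c(1)]] by blast
    then have U: "open ?U" using atlas_chart(2)[OF A c(1)] openin_open_trans by blast
    have pU: "coord c p \<in> ?U" using p by auto
    have d1: "(coord c' \<circ> param c has_derivative (\<lambda>u. jac c c' p *v u)) (at (coord c p))"
      and d2: "(coord c'' \<circ> param c' has_derivative (\<lambda>u. jac c' c'' p *v u)) (at (coord c' p))"
      using smooth_on_has_derivative[OF smooth_change[OF A c(1,2)], of "coord c p"]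
        smooth_on_has_derivative[OF smooth_change[OF A c(2,3)], of "coord c' p"] p
      by (auto simp: jac_works[OF A c(1,2)] jac_works[OF A c(2,3)])
    have "(coord c' \<circ> param c) (coord c p) = coord c' p" using param_coord[OF A c(1)] p by auto
    with d2 have "((coord c'' \<circ> param c') \<circ> (coord c' \<circ> param c) has_derivative
        (\<lambda>u. jac c' c'' p *v u) \<circ> (\<lambda>u. jac c c' p *v u)) (at (coord c p))"
      by (intro diff_chain_at d1) simp
    then have "(coord c'' \<circ> param c has_derivative (\<lambda>u. jac c' c'' p *v u) \<circ> (\<lambda>u. jac c c' p *v u)) (at (coord c p))"
      by (rule has_derivative_transform_within_open[OF _ U pU])
        (auto simp: param_coord[OF A c(1)] param_coord[OF A c(2)])
    from frechet_derivative_eqI[OF this]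
    show "(jac c' c'' p ** jac c c' p) *v v = jac c c'' p *v v"
      using jac_works[OF A c(1,3), of p v] p by (simp add: matrix_vector_mul_assoc)
  qed
  ultimately show ?thesis by (auto simp: vector_bundle_def tangent_bundle_def)
qed

lemma pseudo_riemannian_local:
  assumes "pseudo_riemannian A g" "c \<in> A"
  shows "smooth_on (g c) (img c)" "\<And>x. x \<in> img c \<Longrightarrow> transpose (g c x) = g c x" "\<And>x. x \<in> img c \<Longrightarrow> invertible (g c x)"
  using assms unfolding pseudo_riemannian_def by blast+

lemma pseudo_riemannian_change:
  assumes "pseudo_riemannian A g" "c \<in> A" "c' \<in> A" "p \<in> dom c \<inter> dom c'"
  shows "g c (coord c p) = transpose (jac c c' p) ** g c' (coord c' p) ** jac c c' p"
  using assms unfolding pseudo_riemannian_def by blast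

lemma jac_inverse:
  assumes A: "smooth_atlas A" and c: "c \<in> A" "c' \<in> A" and p: "p \<in> dom c \<inter> dom c'"
  shows "jac c' c p ** jac c c' p = mat 1" "jac c c' p ** jac c' c p = mat 1"
  using vector_bundle_tangent_bundle[OF A] c p by (simp_all add: vector_bundle_def tangent_bundle_def)

text \<open>By uniqueness it is enough that the transformed matrices are torsion-free, which is the symmetry of
  the second derivatives of the change of coordinates, and metric, which is the derivative of the
  transformation law of the metric.\<close>

lemma levi_civita_change:
  assumes A: "smooth_atlas A" and g: "pseudo_riemannian A g" and c: "c \<in> A" "c' \<in> A" and p: "p \<in> dom c \<inter> dom c'"
  shows "jac c c' p ** levi_civita (g c) (coord c p) u
    = frechet_derivative (jac c c' \<circ> param c) (at (coord c p)) u
      + levi_civita (g c') (coord c' p) (jac c c' p *v u) ** jac c c' p"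
proof -
  let ?x = "coord c p" and ?\<phi> = "coord c' \<circ> param c" and ?U = "coord c ` (dom c \<inter> dom c')"
  let ?J = "jac c c' p" and ?I = "jac c' c p" and ?dJ = "frechet_derivative (jac c c' \<circ> param c) (at (coord c p))"
  let ?G = "g c ?x" and ?G' = "g c' (coord c' p)" and ?L = "\<lambda>u. levi_civita (g c') (coord c' p) (?J *v u)"
  note inv = jac_inverse[OF A c p]
  note pc = param_coord[OF A c(1)]
  have U: "open ?U" "?x \<in> ?U" using open_overlap[OF A c] p by auto
  have smJ: "smooth_on (jac c c' \<circ> param c) ?U"
    using vector_bundle_tangent_bundle[OF A] c by (simp add: vector_bundle_def tangent_bundle_def)
  have x: "?x \<in> img c" and x': "coord c' p \<in> img c'" using p by auto
  have \<phi>x: "?\<phi> ?x = coord c' p" using pc p by auto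
  have lc': "levi_civita_at (g c') (coord c' p) (levi_civita (g c') (coord c' p))"
    by (rule levi_civita_at_levi_civita[OF atlas_chart(2)[OF A c(2)] x' pseudo_riemannian_local[OF g c(2)]])
      (assumption, rule x')
  have lc: "levi_civita_at (g c) ?x (levi_civita (g c) ?x)"
    by (rule levi_civita_at_levi_civita[OF atlas_chart(2)[OF A c(1)] x pseudo_riemannian_local[OF g c(1)]])
      (assumption, rule x)
  define \<Gamma> where "\<Gamma> u = ?I ** (?dJ u + ?L u ** ?J)" for u
  have J\<Gamma>: "?J ** \<Gamma> u = ?dJ u + ?L u ** ?J" for u
    by (simp add: \<Gamma>_def matrix_mul_assoc inv)
  have dJsym: "?dJ u *v w = ?dJ w *v u" for u w
  proof -
    have d: "frechet_derivative (\<lambda>y. frechet_derivative ?\<phi> (at y) w) (at ?x) u = ?dJ u *v w" for u w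
    proof -
      have "((\<lambda>y. (jac c c' \<circ> param c) y *v w) has_derivative (\<lambda>u. ?dJ u *v w)) (at ?x)"
        by (rule bounded_linear.has_derivative[OF bounded_bilinear.bounded_linear_left[OF bounded_bilinear_matrix_vector]
              smooth_on_has_derivative[OF smJ U(2)]])
      then have "((\<lambda>y. frechet_derivative ?\<phi> (at y) w) has_derivative (\<lambda>u. ?dJ u *v w)) (at ?x)"
        by (rule has_derivative_transform_within_open[OF _ U]) (auto simp: pc jac_works[OF A c])
      from frechet_derivative_eqI[OF this] show ?thesis by simp
    qed
    show ?thesis
      using symmetric_second_derivative[OF U smooth_change[OF A c], of w u] unfolding d .
  qed
  have tors: "\<Gamma> u *v w = \<Gamma> w *v u" for u w
    using lc' dJsym[of u w] by (simp add: \<Gamma>_def levi_civita_at_def matrix_vector_simps flip: matrix_vector_mul_assoc)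
  have dG: "frechet_derivative (g c) (at ?x) u = transpose (?dJ u) ** ?G' ** ?J
      + transpose ?J ** (frechet_derivative (g c') (at (coord c' p)) (?J *v u)) ** ?J + transpose ?J ** ?G' ** ?dJ u" for u
  proof -
    have gd: "(g c' has_derivative frechet_derivative (g c') (at (coord c' p))) (at (?\<phi> ?x))"
      unfolding \<phi>x by (rule smooth_on_has_derivative[OF pseudo_riemannian_local(1)[OF g c(2)] x'])
    have \<phi>d: "(?\<phi> has_derivative (\<lambda>u. ?J *v u)) (at ?x)"
      using smooth_on_has_derivative[OF smooth_change[OF A c] U(2)] p by (simp add: jac_works[OF A c p])
    have Jd: "(jac c c' \<circ> param c has_derivative ?dJ) (at ?x)" by (rule smooth_on_has_derivative[OF smJ U(2)])
    have Jx: "(jac c c' \<circ> param c) ?x = ?J" using pc p by simp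
    have "((\<lambda>y. transpose ((jac c c' \<circ> param c) y) ** g c' (?\<phi> y) ** (jac c c' \<circ> param c) y) has_derivative
      (\<lambda>u. transpose ((jac c c' \<circ> param c) ?x) ** g c' (?\<phi> ?x) ** ?dJ u
        + (transpose ((jac c c' \<circ> param c) ?x) ** frechet_derivative (g c') (at (coord c' p)) (?J *v u)
          + transpose (?dJ u) ** g c' (?\<phi> ?x)) ** (jac c c' \<circ> param c) ?x)) (at ?x)"
      by (intro has_derivative_matrix_mult bounded_linear.has_derivative[OF bounded_linear_transpose] Jd
          has_derivative_compose[OF \<phi>d gd])
    then have "(g c has_derivative (\<lambda>u. transpose ((jac c c' \<circ> param c) ?x) ** g c' (?\<phi> ?x) ** ?dJ u
        + (transpose ((jac c c' \<circ> param c) ?x) ** frechet_derivative (g c') (at (coord c' p)) (?J *v u)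
          + transpose (?dJ u) ** g c' (?\<phi> ?x)) ** (jac c c' \<circ> param c) ?x)) (at ?x)"
      by (rule has_derivative_transform_within_open[OF _ U])
        (auto simp: pc pseudo_riemannian_change[OF g c])
    from frechet_derivative_eqI[OF this] show ?thesis
      unfolding Jx \<phi>x by (simp add: matrix_ring_simps algebra_simps)
  qed
  have met: "frechet_derivative (g c) (at ?x) u = ?G ** \<Gamma> u + transpose (\<Gamma> u) ** ?G" for u
  proof -
    have s': "transpose ?G' = ?G'" by (rule pseudo_riemannian_local(2)[OF g c(2) x'])
    have G\<Gamma>: "?G ** \<Gamma> u = transpose ?J ** ?G' ** (?dJ u + ?L u ** ?J)"
      unfolding pseudo_riemannian_change[OF g c p] J\<Gamma>[symmetric] by (simp add: matrix_mul_assoc)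
    have "transpose (\<Gamma> u) ** ?G = transpose (?G ** \<Gamma> u)"
      by (simp add: matrix_transpose_mul pseudo_riemannian_local(2)[OF g c(1) x])
    also have "\<dots> = transpose (?dJ u + ?L u ** ?J) ** ?G' ** ?J"
      unfolding G\<Gamma> matrix_transpose_mul s' transpose_transpose by (simp add: matrix_mul_assoc)
    finally have \<Gamma>G: "transpose (\<Gamma> u) ** ?G = transpose (?dJ u + ?L u ** ?J) ** ?G' ** ?J" .
    have "frechet_derivative (g c') (at (coord c' p)) (?J *v u) = ?G' ** ?L u + transpose (?L u) ** ?G'"
      using lc' by (simp add: levi_civita_at_def)
    then show ?thesis unfolding dG G\<Gamma> \<Gamma>G
      by (simp add: matrix_ring_simps transpose_algebra matrix_transpose_mul algebra_simps)
  qed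
  have "levi_civita (g c) ?x u = \<Gamma> u"
    by (rule levi_civita_at_unique[OF pseudo_riemannian_local(2)[OF g c(1) x] pseudo_riemannian_local(3)[OF g c(1) x] lc])
      (simp add: levi_civita_at_def tors met)
  then show ?thesis by (simp add: J\<Gamma>)
qed

lemma connection_levi_civita:
  assumes A: "smooth_atlas A" and g: "pseudo_riemannian A g"
  shows "connection A (tangent_bundle A) (\<lambda>c. levi_civita (g c))"
  unfolding connection_def
proof (intro conjI ballI allI)
  show "vector_bundle A (tangent_bundle A)" by (rule vector_bundle_tangent_bundle[OF A])
  show "linear (levi_civita (g c) x)" for c x by (rule linear_levi_civita)
  fix c assume "c \<in> triv (tangent_bundle A)"
  then have c: "c \<in> A" by (simp add: tangent_bundle_def)
  show "smooth_on (\<lambda>x. levi_civita (g c) x u) (img (chart_of (tangent_bundle A) c))" for u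
    using smooth_on_levi_civita[OF atlas_chart(2)[OF A c] pseudo_riemannian_local(1)[OF g c] pseudo_riemannian_local(3)[OF g c]]
    by (simp add: tangent_bundle_def)
  fix c' p u
  assume "c' \<in> triv (tangent_bundle A)" "p \<in> dom (chart_of (tangent_bundle A) c) \<inter> dom (chart_of (tangent_bundle A) c')"
  then show "let ch = chart_of (tangent_bundle A) c; ch' = chart_of (tangent_bundle A) c'; h = transition (tangent_bundle A) c c' in
          h p ** levi_civita (g c) (coord ch p) u = frechet_derivative (h \<circ> param ch) (at (coord ch p)) u
              + levi_civita (g c') (coord ch' p) (jac ch ch' p *v u) ** h p"
    using levi_civita_change[OF A g c, of c' p u] by (simp add: tangent_bundle_def Let_def)
qed

section \<open>Block matrices\<close>

text \<open>Endomorphisms of \<open>\<real> \<oplus> \<real>\<^sup>n \<oplus> \<real>\<close>. The rows \<open>b\<close>, \<open>h\<close> and the columns \<open>d\<close>, \<open>f\<close> are all elements of \<open>\<real>\<^sup>n\<close>,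
  which is why a transposed block occurs in the product formula \<open>blk_mult\<close>.\<close>

definition blk :: "real \<Rightarrow> real^'n \<Rightarrow> real \<Rightarrow> real^'n \<Rightarrow> real^'n^'n \<Rightarrow> real^'n \<Rightarrow> real \<Rightarrow> real^'n \<Rightarrow> real
    \<Rightarrow> real^(unit + 'n::finite + unit)^(unit + 'n + unit)" where
  "blk a b c d E f g h i = (\<chi> r s.
     case r of
       Inl _ \<Rightarrow> (case s of Inl _ \<Rightarrow> a | Inr (Inl l) \<Rightarrow> b $ l | Inr (Inr _) \<Rightarrow> c)
     | Inr (Inl k) \<Rightarrow> (case s of Inl _ \<Rightarrow> d $ k | Inr (Inl l) \<Rightarrow> E $ k $ l | Inr (Inr _) \<Rightarrow> f $ k)
     | Inr (Inr _) \<Rightarrow> (case s of Inl _ \<Rightarrow> g | Inr (Inl l) \<Rightarrow> h $ l | Inr (Inr _) \<Rightarrow> i))"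

lemma blk_nth [simp]:
  "blk a b c d E f g h i $ Inl x $ Inl y = a"
  "blk a b c d E f g h i $ Inl x $ Inr (Inl l) = b $ l"
  "blk a b c d E f g h i $ Inl x $ Inr (Inr y) = c"
  "blk a b c d E f g h i $ Inr (Inl k) $ Inl y = d $ k"
  "blk a b c d E f g h i $ Inr (Inl k) $ Inr (Inl l) = E $ k $ l"
  "blk a b c d E f g h i $ Inr (Inl k) $ Inr (Inr y) = f $ k"
  "blk a b c d E f g h i $ Inr (Inr x) $ Inl y = g"
  "blk a b c d E f g h i $ Inr (Inr x) $ Inr (Inl l) = h $ l"
  "blk a b c d E f g h i $ Inr (Inr x) $ Inr (Inr y) = i"
  by (simp_all add: blk_def)

lemma all_triple_index: "(\<forall>r::unit + 'a + unit. P r) \<longleftrightarrow> P (Inl ()) \<and> (\<forall>k. P (Inr (Inl k))) \<and> P (Inr (Inr ()))"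
proof (intro iffI allI)
  fix r :: "unit + 'a + unit"
  assume P: "P (Inl ()) \<and> (\<forall>k. P (Inr (Inl k))) \<and> P (Inr (Inr ()))"
  show "P r"
  proof (cases r)
    case (Inr s)
    then show ?thesis using P by (cases s) auto
  qed (use P in auto)
qed auto

lemma sum_triple_index:
  fixes F :: "unit + 'n::finite + unit \<Rightarrow> 'b::comm_monoid_add"
  shows "(\<Sum>r\<in>UNIV. F r) = F (Inl ()) + ((\<Sum>k\<in>UNIV. F (Inr (Inl k))) + F (Inr (Inr ())))"
  by (simp add: UNIV_Plus_UNIV[symmetric] sum.Plus UNIV_unit del: UNIV_Plus_UNIV)

lemma triple_matrix_eq_iff:
  fixes M N :: "real^(unit + 'n::finite + unit)^(unit + 'n + unit)"
  shows "M = N \<longleftrightarrow> M $ Inl () $ Inl () = N $ Inl () $ Inl () \<and>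
     (\<forall>l. M $ Inl () $ Inr (Inl l) = N $ Inl () $ Inr (Inl l)) \<and>
     M $ Inl () $ Inr (Inr ()) = N $ Inl () $ Inr (Inr ()) \<and>
     (\<forall>k. M $ Inr (Inl k) $ Inl () = N $ Inr (Inl k) $ Inl ()) \<and>
     (\<forall>k l. M $ Inr (Inl k) $ Inr (Inl l) = N $ Inr (Inl k) $ Inr (Inl l)) \<and>
     (\<forall>k. M $ Inr (Inl k) $ Inr (Inr ()) = N $ Inr (Inl k) $ Inr (Inr ())) \<and>
     M $ Inr (Inr ()) $ Inl () = N $ Inr (Inr ()) $ Inl () \<and>
     (\<forall>l. M $ Inr (Inr ()) $ Inr (Inl l) = N $ Inr (Inr ()) $ Inr (Inl l)) \<and>
     M $ Inr (Inr ()) $ Inr (Inr ()) = N $ Inr (Inr ()) $ Inr (Inr ())"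
  unfolding vec_eq_iff all_triple_index by auto

lemma blk_eq_iff:
  "blk a b c d E f g h i = blk a' b' c' d' E' f' g' h' i' \<longleftrightarrow>
     a = a' \<and> b = b' \<and> c = c' \<and> d = d' \<and> E = E' \<and> f = f' \<and> g = g' \<and> h = h' \<and> i = i'"
  unfolding triple_matrix_eq_iff by (auto simp: vec_eq_iff)

lemma blk_mult:
  "blk a b c d E f g h i ** blk a' b' c' d' E' f' g' h' i' = blk
     (a * a' + b \<bullet> d' + c * g') (a *\<^sub>R b' + transpose E' *v b + c *\<^sub>R h') (a * c' + b \<bullet> f' + c * i')
     (a' *\<^sub>R d + E *v d' + g' *\<^sub>R f) (outer d b' + E ** E' + outer f h') (c' *\<^sub>R d + E *v f' + i' *\<^sub>R f)
     (g * a' + h \<bullet> d' + i * g') (g *\<^sub>R b' + transpose E' *v h + i *\<^sub>R h') (g * c' + h \<bullet> f' + i * i')"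
  unfolding triple_matrix_eq_iff
  by (simp add: matrix_matrix_mult_def[of "blk a b c d E f g h i"] sum_triple_index)
     (simp add: inner_vec_def outer_def matrix_vector_mult_def matrix_matrix_mult_def
      vector_matrix_mult_def transpose_def ac_simps)

lemma blk_add: "blk a b c d E f g h i + blk a' b' c' d' E' f' g' h' i'
    = blk (a + a') (b + b') (c + c') (d + d') (E + E') (f + f') (g + g') (h + h') (i + i')"
  unfolding triple_matrix_eq_iff by simp

lemma blk_diff: "blk a b c d E f g h i - blk a' b' c' d' E' f' g' h' i'
    = blk (a - a') (b - b') (c - c') (d - d') (E - E') (f - f') (g - g') (h - h') (i - i')"
  unfolding triple_matrix_eq_iff by simp

lemma blk_scaleR: "r *\<^sub>R blk a b c d E f g h i
    = blk (r * a) (r *\<^sub>R b) (r * c) (r *\<^sub>R d) (r *\<^sub>R E) (r *\<^sub>R f) (r * g) (r *\<^sub>R h) (r * i)"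
  unfolding triple_matrix_eq_iff by simp

lemma blk_id: "mat 1 = blk 1 0 0 0 (mat 1) 0 0 0 1"
  unfolding triple_matrix_eq_iff by (simp add: mat_def)

lemma trace_blk: "trace (blk a b c d E f g h i) = a + trace E + i"
  by (simp add: trace_def sum_triple_index)

lemma has_derivative_blk:
  assumes "(a has_derivative a') (at x)" "(b has_derivative b') (at x)" "(c has_derivative c') (at x)"
    "(d has_derivative d') (at x)" "(E has_derivative E') (at x)" "(f has_derivative f') (at x)"
    "(g has_derivative g') (at x)" "(h has_derivative h') (at x)" "(i has_derivative i') (at x)"
  shows "((\<lambda>x. blk (a x) (b x) (c x) (d x) (E x) (f x) (g x) (h x) (i x)) has_derivative
     (\<lambda>x. blk (a' x) (b' x) (c' x) (d' x) (E' x) (f' x) (g' x) (h' x) (i' x))) (at x)"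
proof -
  let ?L = "\<lambda>(a, b, c, d, E, f, g, h, i). blk a b c d E f g h i"
  have "linear ?L"
    by (rule linearI) (auto simp: blk_add blk_scaleR split: prod.splits)
  then have "bounded_linear ?L" by (simp add: linear_conv_bounded_linear)
  from bounded_linear.has_derivative[OF this has_derivative_Pair[OF assms(1) has_derivative_Pair[OF assms(2)
      has_derivative_Pair[OF assms(3) has_derivative_Pair[OF assms(4) has_derivative_Pair[OF assms(5)
      has_derivative_Pair[OF assms(6) has_derivative_Pair[OF assms(7) has_derivative_Pair[OF assms(8,9)]]]]]]]]]
  show ?thesis by simp
qed

lemma smooth_on_blk:
  assumes "open S" "smooth_on a S" "smooth_on b S" "smooth_on c S" "smooth_on d S" "smooth_on E S" "smooth_on f S"
    "smooth_on g S" "smooth_on h S" "smooth_on i S"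
  shows "smooth_on (\<lambda>x. blk (a x) (b x) (c x) (d x) (E x) (f x) (g x) (h x) (i x)) S"
proof (rule smooth_on_matrixI[OF assms(1)])
  have "\<forall>r s. smooth_on (\<lambda>x. blk (a x) (b x) (c x) (d x) (E x) (f x) (g x) (h x) (i x) $ r $ s) S"
    unfolding all_triple_index
    by (auto intro!: smooth_on_vec_nth[OF assms(1)] assms)
  then show "smooth_on (\<lambda>x. blk (a x) (b x) (c x) (d x) (E x) (f x) (g x) (h x) (i x) $ r $ s) S" for r s
    by blast
qed

section \<open>Ricci and Schouten tensors\<close>

text \<open>The trace of the endomorphism that sends \<open>w\<close> to \<open>W w v z\<close>; for the Riemann curvature this is the
  Ricci tensor (\<open>inner_ricci\<close> below).\<close>

definition contraction :: "(real^'n \<Rightarrow> real^'n \<Rightarrow> real^'n^'n) \<Rightarrow> real^'n \<Rightarrow> real^'n::finite \<Rightarrow> real" where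
  "contraction W v z = (\<Sum>a\<in>UNIV. (W (axis a 1) v *v z) $ a)"

lemma contraction_eq_trace:
  assumes "\<And>w. M *v w = W w v *v z"
  shows "contraction W v z = trace M"
  unfolding contraction_def trace_def assms[symmetric] matrix_entry_axis[of M] ..

text \<open>A trace does not change under conjugation with \<open>J\<close>.\<close>

lemma contraction_intertwine:
  fixes I J :: "real^'n::finite^'n"
  assumes J: "I ** J = mat 1" and W: "\<And>u v. J ** W u v = W' (J *v u) (J *v v) ** J"
    and lin: "\<And>v. linear (\<lambda>u. W' u v)"
  shows "contraction W v z = contraction W' (J *v v) (J *v z)"
proof -
  have "linear (\<lambda>w. W' w (J *v v) *v (J *v z))"
    using linear_compose[OF lin bounded_bilinear.bounded_linear_left[OF bounded_bilinear_matrix_vector, THEN bounded_linear.linear]]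
    by (simp add: o_def)
  then have M: "matrix (\<lambda>w. W' w (J *v v) *v (J *v z)) *v w = W' w (J *v v) *v (J *v z)" for w
    using matrix_vector_mul(2) by metis
  define M where "M = matrix (\<lambda>w. W' w (J *v v) *v (J *v z))"
  have "(I ** M ** J) *v w = W w v *v z" for w
  proof -
    have "(I ** M ** J) *v w = (I ** (W' (J *v w) (J *v v) ** J)) *v z"
      by (simp add: M_def M flip: matrix_vector_mul_assoc)
    also have "\<dots> = W w v *v z" by (simp add: W[symmetric] matrix_mul_assoc J)
    finally show ?thesis .
  qed
  then have "contraction W v z = trace (I ** M ** J)" by (rule contraction_eq_trace)
  also have "\<dots> = trace (J ** (I ** M))" by (rule trace_mul_sym)
  also have "\<dots> = trace M" by (simp add: matrix_mul_assoc matrix_inv_unique(3)[OF J])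
  also have "\<dots> = contraction W' (J *v v) (J *v z)"
    by (rule contraction_eq_trace[symmetric]) (simp add: M_def M)
  finally show ?thesis .
qed

definition riemann :: "(real^'n \<Rightarrow> real^'n^'n) \<Rightarrow> real^'n \<Rightarrow> real^'n \<Rightarrow> real^'n \<Rightarrow> real^'n^'n::finite" where
  "riemann G x u v = curvature (levi_civita G) x (\<lambda>i. if i = 0 then u else v)"

context
  fixes U :: "(real^'n::finite) set" and G :: "real^'n \<Rightarrow> real^'n^'n"
  assumes U: "open U" and sm: "smooth_on G U" and inv: "\<And>y. y \<in> U \<Longrightarrow> invertible (G y)"
begin

lemma levi_civita_differentiable: "x \<in> U \<Longrightarrow> (\<lambda>y. levi_civita G y u) differentiable (at x)"
  by (rule smooth_on_differentiable[OF smooth_on_levi_civita[OF U sm inv]])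

lemma curvature_levi_civita:
  assumes x: "x \<in> U"
  shows "curvature (levi_civita G) x v = riemann G x (v 0) (v 1)"
  unfolding riemann_def curvature_explicit[OF levi_civita_differentiable[OF x]] by simp

lemma riemann_explicit:
  assumes x: "x \<in> U"
  shows "riemann G x u v = frechet_derivative (\<lambda>y. levi_civita G y v) (at x) u
      - frechet_derivative (\<lambda>y. levi_civita G y u) (at x) v
      + levi_civita G x u ** levi_civita G x v - levi_civita G x v ** levi_civita G x u"
  unfolding riemann_def curvature_explicit[OF levi_civita_differentiable[OF x]] by simp

lemma linear_riemann_left:
  assumes x: "x \<in> U" shows "linear (\<lambda>u. riemann G x u v)"
proof -
  have "linear (\<lambda>u. frechet_derivative (\<lambda>y. levi_civita G y v) (at x) u
      - frechet_derivative (\<lambda>y. levi_civita G y u) (at x) v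
      + levi_civita G x u ** levi_civita G x v - levi_civita G x v ** levi_civita G x u)"
    by (intro linear_compose_add linear_compose_sub linear_frechet_derivative levi_civita_differentiable x
        linear_frechet_derivative_family[OF U x linear_levi_civita]
        linear_compose[OF linear_levi_civita matrix_mult_linear_left, unfolded o_def]
        linear_compose[OF linear_levi_civita matrix_mult_linear_right, unfolded o_def])
  then show ?thesis
    unfolding riemann_def curvature_explicit[OF levi_civita_differentiable[OF x]] by simp
qed

lemma riemann_swap: "x \<in> U \<Longrightarrow> riemann G x u v = - riemann G x v u"
  unfolding riemann_def by (simp add: curvature_explicit[OF levi_civita_differentiable])

lemma linear_riemann_right:
  assumes x: "x \<in> U" shows "linear (\<lambda>v. riemann G x u v)"
  unfolding riemann_swap[OF x, of u] by (intro linear_compose_neg linear_riemann_left[OF x])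

lemma inner_ricci:
  assumes x: "x \<in> U"
  shows "v \<bullet> (ricci G x *v z) = contraction (riemann G x) v z"
proof -
  have "ricci G x $ b $ d = (\<Sum>a\<in>UNIV. riemann G x (axis a 1) (axis b 1) $ a $ d)" for b d
    by (simp add: ricci_def riemann_def)
  then have "v \<bullet> (ricci G x *v z) = (\<Sum>b\<in>UNIV. \<Sum>d\<in>UNIV. \<Sum>a\<in>UNIV. v $ b * (riemann G x (axis a 1) (axis b 1) $ a $ d * z $ d))"
    by (simp add: inner_vec_def matrix_vector_mult_def sum_distrib_left sum_distrib_right)
  also have "\<dots> = (\<Sum>a\<in>UNIV. \<Sum>d\<in>UNIV. \<Sum>b\<in>UNIV. v $ b * (riemann G x (axis a 1) (axis b 1) $ a $ d * z $ d))"
    by (subst sum.swap, subst (2) sum.swap, subst sum.swap) (rule refl)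
  also have "\<dots> = (\<Sum>a\<in>UNIV. \<Sum>d\<in>UNIV. riemann G x (axis a 1) v $ a $ d * z $ d)"
  proof (intro sum.cong refl)
    fix a d
    have "riemann G x (axis a 1) v $ a $ d = (\<Sum>b\<in>UNIV. v $ b * riemann G x (axis a 1) (axis b 1) $ a $ d)"
      using arg_cong[where f="\<lambda>X. X $ a $ d", OF linear_axis_expansion[OF linear_riemann_right[OF x], of "axis a 1" v]] by simp
    then show "(\<Sum>b\<in>UNIV. v $ b * (riemann G x (axis a 1) (axis b 1) $ a $ d * z $ d)) = riemann G x (axis a 1) v $ a $ d * z $ d"
      by (simp add: sum_distrib_right mult.assoc)
  qed
  finally show ?thesis by (simp add: contraction_def matrix_vector_mult_def)
qed

lemma smooth_on_riemann: "smooth_on (\<lambda>x. riemann G x u v) U"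
proof -
  have "smooth_on (\<lambda>x. frechet_derivative (\<lambda>y. levi_civita G y v) (at x) u
      - frechet_derivative (\<lambda>y. levi_civita G y u) (at x) v
      + levi_civita G x u ** levi_civita G x v - levi_civita G x v ** levi_civita G x u) U"
    by (intro smooth_on_diff smooth_on_add smooth_on_frechet smooth_on_matrix_mult U smooth_on_levi_civita[OF U sm inv])
  then show ?thesis
    by (rule smooth_on_cong[OF U, rotated])
      (simp add: riemann_def curvature_explicit[OF levi_civita_differentiable])
qed

lemma smooth_on_schouten: "smooth_on (\<lambda>x. schouten G x) U"
proof -
  have ric: "smooth_on (\<lambda>x. ricci G x) U"
  proof (rule smooth_on_matrixI[OF U])
    fix b d
    have "smooth_on (\<lambda>x. \<Sum>a\<in>UNIV. riemann G x (axis a 1) (axis b 1) $ a $ d) U"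
      by (intro smooth_on_sum smooth_on_matrix_nth smooth_on_riemann U)
    then show "smooth_on (\<lambda>x. ricci G x $ b $ d) U" by (simp add: ricci_def riemann_def)
  qed
  then show ?thesis
    unfolding schouten_def scal_def divide_inverse
    by (intro smooth_on_scaleR_fun smooth_on_diff smooth_on_const smooth_on_mult
        smooth_on_bounded_linear_comp[OF U bounded_linear_trace] smooth_on_matrix_mult smooth_on_matrix_inv U sm inv)
qed

end

lemma matrix_eq_inner:
  fixes M N :: "real^'n::finite^'m::finite"
  assumes "\<And>v z. v \<bullet> (M *v z) = v \<bullet> (N *v z)"
  shows "M = N"
  by (rule matrix_eqI, rule vector_inner_eqI) (rule assms)

lemma metric_inverse_change:
  fixes A :: "('m::topological_space, 'n::finite) chart set"
  assumes A: "smooth_atlas A" and g: "pseudo_riemannian A g" and c: "c \<in> A" "c' \<in> A" and p: "p \<in> dom c \<inter> dom c'"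
  shows "matrix_inv (g c (coord c p)) = jac c' c p ** matrix_inv (g c' (coord c' p)) ** transpose (jac c' c p)"
proof (rule matrix_inv_unique(1))
  let ?J = "jac c c' p" and ?I = "jac c' c p" and ?x = "coord c p" and ?x' = "coord c' p"
  note I = jac_inverse[OF A c p]
  have x: "?x' \<in> img c'" using p by auto
  have tI: "transpose ?J ** transpose ?I = mat 1"
    unfolding matrix_transpose_mul[symmetric] I(1) by (simp add: transpose_mat)
  have "g c ?x ** (?I ** matrix_inv (g c' ?x') ** transpose ?I)
      = transpose ?J ** (g c' ?x' ** (?J ** ?I) ** matrix_inv (g c' ?x')) ** transpose ?I"
    unfolding pseudo_riemannian_change[OF g c p] by (simp add: matrix_mul_assoc)
  also have "\<dots> = mat 1" by (simp add: I matrix_inv_inverse[OF pseudo_riemannian_local(3)[OF g c(2) x]] tI)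
  finally show "g c ?x ** (?I ** matrix_inv (g c' ?x') ** transpose ?I) = mat 1" .
qed

lemma schouten_change:
  fixes A :: "('m::topological_space, 'n::finite) chart set"
  assumes A: "smooth_atlas A" and g: "pseudo_riemannian A g" and c: "c \<in> A" "c' \<in> A" and p: "p \<in> dom c \<inter> dom c'"
  shows "schouten (g c) (coord c p) = transpose (jac c c' p) ** schouten (g c') (coord c' p) ** jac c c' p"
proof -
  let ?J = "jac c c' p" and ?I = "jac c' c p" and ?x = "coord c p" and ?x' = "coord c' p"
  note I = jac_inverse[OF A c p]
  have x: "?x \<in> img c" "?x' \<in> img c'" using p by auto
  note l = atlas_chart(2)[OF A c(1)] pseudo_riemannian_local(1,3)[OF g c(1)]
  note l' = atlas_chart(2)[OF A c(2)] pseudo_riemannian_local(1,3)[OF g c(2)]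
  have R: "?J ** riemann (g c) ?x u v = riemann (g c') ?x' (?J *v u) (?J *v v) ** ?J" for u v
    using connection_curvature[OF A connection_levi_civita[OF A g], of c c' p "\<lambda>i. if i = 0 then u else v"] c p
    by (simp add: tangent_bundle_def riemann_def if_distrib[of "\<lambda>w. ?J *v w"] cong: if_cong)
  have ric: "ricci (g c) ?x = transpose ?J ** ricci (g c') ?x' ** ?J"
  proof (rule matrix_eq_inner)
    fix v z
    have "v \<bullet> (ricci (g c) ?x *v z) = contraction (riemann (g c) ?x) v z"
      by (rule inner_ricci[OF l x(1)])
    also have "\<dots> = contraction (riemann (g c') ?x') (?J *v v) (?J *v z)"
      by (rule contraction_intertwine[where W="riemann (g c) ?x" and W'="riemann (g c') ?x'", OF I(1) R])
        (rule linear_riemann_left[OF l' x(2)])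
    also have "\<dots> = (?J *v v) \<bullet> (ricci (g c') ?x' *v (?J *v z))"
      by (rule inner_ricci[OF l' x(2), symmetric])
    also have "\<dots> = v \<bullet> ((transpose ?J ** ricci (g c') ?x' ** ?J) *v z)"
      by (simp add: matrix_inner matrix_vector_mul_assoc matrix_mul_assoc)
    finally show "v \<bullet> (ricci (g c) ?x *v z) = v \<bullet> ((transpose ?J ** ricci (g c') ?x' ** ?J) *v z)" .
  qed
  note ginv = metric_inverse_change[OF A g c p]
  have "scal (g c) ?x = trace (?I ** (matrix_inv (g c' ?x') ** ricci (g c') ?x' ** ?J))"
  proof -
    have tI: "transpose ?I ** transpose ?J = mat 1"
      unfolding matrix_transpose_mul[symmetric] I(2) by (simp add: transpose_mat)
    have "?I ** matrix_inv (g c' ?x') ** transpose ?I ** (transpose ?J ** ricci (g c') ?x' ** ?J)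
       = ?I ** matrix_inv (g c' ?x') ** (transpose ?I ** transpose ?J) ** ricci (g c') ?x' ** ?J"
      by (simp add: matrix_mul_assoc)
    then show ?thesis unfolding scal_def ginv ric tI by (simp add: matrix_mul_assoc)
  qed
  also have "\<dots> = trace ((matrix_inv (g c' ?x') ** ricci (g c') ?x' ** ?J) ** ?I)" by (rule trace_mul_sym)
  also have "\<dots> = scal (g c') ?x'"
    unfolding scal_def by (simp add: I flip: matrix_mul_assoc)
  finally have sc: "scal (g c) ?x = scal (g c') ?x'" .
  show ?thesis
    unfolding schouten_def sc ric pseudo_riemannian_change[OF g c p]
    by (simp add: matrix_ring_simps)
qed

section \<open>The tractor connection in a fixed scale\<close>

text \<open>The tractor connection of the metric \<open>G\<close> in a frame where densities are functions, by means of the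
  volume of \<open>G\<close>, and where the middle slot holds vectors instead of covectors. The linear map \<open>p\<close>
  stands for the Schouten tensor, but is left arbitrary.\<close>

definition scale_tractor :: "(real^'n \<Rightarrow> real^'n^'n) \<Rightarrow> (real^'n \<Rightarrow> real^'n \<Rightarrow> real^'n) \<Rightarrow> ('n::finite, unit + 'n + unit) conn_form" where
  "scale_tractor G p y u = blk 0 (- (G y *v u)) 0 (matrix_inv (G y) *v p y u) (levi_civita G y u) u 0 (- p y u) 0"

definition schouten_form :: "(real^'n \<Rightarrow> real^'n^'n) \<Rightarrow> real^'n \<Rightarrow> real^'n \<Rightarrow> real^'n::finite" where
  "schouten_form G y u = u v* schouten G y"

lemma schouten_form_transpose: "schouten_form G y u = transpose (schouten G y) *v u"
  by (simp add: schouten_form_def transpose_matrix_vector)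

text \<open>The Weyl curvature, if \<open>p\<close> is the Schouten tensor.\<close>

definition weyl :: "(real^'n \<Rightarrow> real^'n^'n) \<Rightarrow> (real^'n \<Rightarrow> real^'n \<Rightarrow> real^'n) \<Rightarrow> real^'n \<Rightarrow> real^'n \<Rightarrow> real^'n \<Rightarrow> real^'n^'n::finite" where
  "weyl G p x u v = riemann G x u v - outer (matrix_inv (G x) *v p x u) (G x *v v) + outer (matrix_inv (G x) *v p x v) (G x *v u)
     - outer u (p x v) + outer v (p x u)"

context
  fixes U :: "(real^'n::finite) set" and G :: "real^'n \<Rightarrow> real^'n^'n" and p :: "real^'n \<Rightarrow> real^'n \<Rightarrow> real^'n"
  assumes U: "open U" and sm: "smooth_on G U" and inv: "\<And>y. y \<in> U \<Longrightarrow> invertible (G y)"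
    and sym: "\<And>y. y \<in> U \<Longrightarrow> transpose (G y) = G y"
    and smp: "\<And>u. smooth_on (\<lambda>y. p y u) U" and linp: "\<And>y. y \<in> U \<Longrightarrow> linear (p y)"
begin

lemma smooth_on_scale_tractor: "smooth_on (\<lambda>y. scale_tractor G p y u) U"
  unfolding scale_tractor_def
  by (intro smooth_on_blk smooth_on_minus smooth_on_matrix_vector smooth_on_matrix_inv smooth_on_levi_civita
      smooth_on_const U sm inv smp)

lemma linear_scale_tractor: "y \<in> U \<Longrightarrow> linear (scale_tractor G p y)"
  by (rule linearI)
    (simp_all add: scale_tractor_def blk_add blk_scaleR blk_eq_iff matrix_vector_simps linear_add[OF linp] linear_cmul[OF linp]
      linear_add[OF linear_levi_civita] linear_cmul[OF linear_levi_civita])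

text \<open>The two blocks that are asserted to vanish are the torsion and the derivative of the metric in
  disguise. The blocks that are left open involve derivatives of \<open>p\<close>.\<close>

lemma curvature_scale_tractor:
  assumes x: "x \<in> U"
  shows "\<exists>a c d g h i. curvature (scale_tractor G p) x v = blk a 0 c d (weyl G p x (v 0) (v 1)) 0 g h i"
proof -
  have lc: "levi_civita_at G x (levi_civita G x)"
    by (rule levi_civita_at_levi_civita[OF U x sm sym inv[OF x]])
  define dG where "dG = frechet_derivative G (at x)"
  define q where "q u = frechet_derivative (\<lambda>y. matrix_inv (G y) *v p y u) (at x)" for u
  define dp where "dp u = frechet_derivative (\<lambda>y. p y u) (at x)" for u
  define d\<Gamma> where "d\<Gamma> u = frechet_derivative (\<lambda>y. levi_civita G y u) (at x)" for u
  have smq: "smooth_on (\<lambda>y. matrix_inv (G y) *v p y u) U" for u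
    by (intro smooth_on_matrix_vector smooth_on_matrix_inv U sm inv smp)
  have "((\<lambda>y. scale_tractor G p y u) has_derivative
      (\<lambda>w. blk 0 (- (dG w *v u)) 0 (q u w) (d\<Gamma> u w) 0 0 (- dp u w) 0)) (at x)" for u
    unfolding scale_tractor_def dG_def q_def dp_def d\<Gamma>_def
    by (intro has_derivative_blk has_derivative_minus has_derivative_const smooth_on_has_derivative[OF smq x]
        smooth_on_has_derivative[OF smp x] smooth_on_has_derivative[OF smooth_on_levi_civita[OF U sm inv] x]
        bounded_linear.has_derivative[OF bounded_bilinear.bounded_linear_left[OF bounded_bilinear_matrix_vector]]
        smooth_on_has_derivative[OF sm x])
  note d = frechet_derivative_eqI[OF this]
  have dt: "(\<lambda>y. scale_tractor G p y u) differentiable (at x)" for u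
    by (rule smooth_on_differentiable[OF smooth_on_scale_tractor x])
  have G: "dG u *v w = G x *v (levi_civita G x u *v w) + transpose (levi_civita G x u) *v (G x *v w)" for u w
    using lc by (simp add: levi_civita_at_def dG_def matrix_vector_simps matrix_vector_mul_assoc)
  have T: "levi_civita G x u *v w = levi_civita G x w *v u" for u w
    using lc by (simp add: levi_civita_at_def)
  have R: "riemann G x (v 0) (v 1) = d\<Gamma> (v 1) (v 0) - d\<Gamma> (v 0) (v 1)
      + levi_civita G x (v 0) ** levi_civita G x (v 1) - levi_civita G x (v 1) ** levi_civita G x (v 0)"
    unfolding d\<Gamma>_def by (rule riemann_explicit[OF U sm inv x])
  show ?thesis
    unfolding curvature_explicit[OF dt] d
    unfolding scale_tractor_def blk_mult blk_add blk_diff blk_eq_iff weyl_def R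
    using T[of "v 1" "v 0"] by (simp add: G matrix_vector_simps outer_algebra)
qed

end

section \<open>Conformal change of the metric\<close>

text \<open>The gauge equation between the tractor connections of \<open>G\<close> and \<open>s\<^sup>2 G\<close> at one point, as an identity of
  block matrices. Here \<open>\<Upsilon>\<close> is the differential of \<open>ln s\<close>, \<open>Y\<close> the dual vector, and \<open>d\<Upsilon>\<close>, \<open>dY\<close> are
  their derivatives in the direction \<open>u\<close>; \<open>t\<close> is the inverse of \<open>s\<close>.\<close>

lemma conformal_gauge_algebra:
  fixes G Gi \<Gamma> :: "real^'n::finite^'n" and \<Upsilon> Y u d\<Upsilon> p :: "real^'n" and s t :: real
  assumes Gi: "Gi ** G = mat 1" and sym: "transpose G = G" and Y: "Y = Gi *v \<Upsilon>" and st: "s * t = 1"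
    and dY: "dY = Gi *v d\<Upsilon> - \<Gamma> *v Y - Gi *v (transpose \<Gamma> *v \<Upsilon>)"
    and q: "q = p - d\<Upsilon> + transpose \<Gamma> *v \<Upsilon> + (\<Upsilon> \<bullet> u) *\<^sub>R \<Upsilon> - (\<Upsilon> \<bullet> Y / 2) *\<^sub>R (G *v u)"
    and \<Gamma>': "\<Gamma>' = \<Gamma> + (\<Upsilon> \<bullet> u) *\<^sub>R mat 1 + outer u \<Upsilon> - outer Y (G *v u)"
  shows "blk s 0 0 (t *\<^sub>R Y) (t *\<^sub>R mat 1) 0 (- (t * (\<Upsilon> \<bullet> Y) / 2)) (- (t *\<^sub>R \<Upsilon>)) t
        ** blk 0 (- (G *v u)) 0 (Gi *v p) \<Gamma> u 0 (- p) 0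
    = blk (s * (\<Upsilon> \<bullet> u)) 0 0 (t *\<^sub>R dY - (t * (\<Upsilon> \<bullet> u)) *\<^sub>R Y) (- (t * (\<Upsilon> \<bullet> u)) *\<^sub>R mat 1) 0
        (- (t * (d\<Upsilon> \<bullet> Y + \<Upsilon> \<bullet> dY) - t * (\<Upsilon> \<bullet> u) * (\<Upsilon> \<bullet> Y)) / 2)
        (- (t *\<^sub>R d\<Upsilon> - (t * (\<Upsilon> \<bullet> u)) *\<^sub>R \<Upsilon>)) (- (t * (\<Upsilon> \<bullet> u)))
      + blk 0 (- ((s * s) *\<^sub>R (G *v u))) 0 ((t * t) *\<^sub>R (Gi *v q)) \<Gamma>' u 0 (- q) 0
        ** blk s 0 0 (t *\<^sub>R Y) (t *\<^sub>R mat 1) 0 (- (t * (\<Upsilon> \<bullet> Y) / 2)) (- (t *\<^sub>R \<Upsilon>)) t"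
proof -
  have Gi': "G ** Gi = mat 1" by (rule matrix_inv_unique(3)[OF Gi])
  have GiG: "Gi *v (G *v z) = z" for z by (simp add: matrix_vector_mul_assoc Gi)
  have GY: "G *v Y = \<Upsilon>" by (simp add: Y matrix_vector_mul_assoc Gi')
  have f1: "(G *v z) \<bullet> Y = z \<bullet> \<Upsilon>" for z by (simp add: matrix_inner sym GY)
  have f2: "\<Upsilon> \<bullet> (Gi *v z) = Y \<bullet> z" for z
    using f1[of "Gi *v z"] by (simp add: matrix_vector_mul_assoc Gi' inner_commute)
  have \<Gamma>'v: "\<Gamma>' *v z = \<Gamma> *v z + (\<Upsilon> \<bullet> u) *\<^sub>R z + (\<Upsilon> \<bullet> z) *\<^sub>R u - ((G *v u) \<bullet> z) *\<^sub>R Y" for z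
    by (simp add: \<Gamma>' matrix_vector_simps outer_vector)
  have st': "s * (s * t) = s" "t * (t * s) = t" "s * s * t = s" "t * t * s = t" using st by (simp_all add: ac_simps)
  have trI: "transpose (t *\<^sub>R mat 1) *v z = t *\<^sub>R (z::real^'n)" for z
    by (simp add: transpose_algebra transpose_mat matrix_vector_simps)
  have Giq: "Gi *v q = Gi *v p - Gi *v d\<Upsilon> + Gi *v (transpose \<Gamma> *v \<Upsilon>) + (\<Upsilon> \<bullet> u) *\<^sub>R Y - (\<Upsilon> \<bullet> Y / 2) *\<^sub>R u"
    by (simp add: q matrix_vector_simps GiG Y)
  have qY: "q \<bullet> Y = p \<bullet> Y - d\<Upsilon> \<bullet> Y + \<Upsilon> \<bullet> (\<Gamma> *v Y) + (\<Upsilon> \<bullet> u) * (\<Upsilon> \<bullet> Y) / 2"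
    by (simp add: q inner_add_left inner_diff_left f1 matrix_inner[of "transpose \<Gamma>"] transpose_transpose
        inner_commute[of u] dot_lmul_matrix field_simps)
  have UdY: "\<Upsilon> \<bullet> dY = Y \<bullet> d\<Upsilon> - 2 * (\<Upsilon> \<bullet> (\<Gamma> *v Y))"
    using matrix_inner[of "transpose \<Gamma>" \<Upsilon> Y]
    by (simp add: dY inner_diff_right f2 transpose_transpose inner_commute[of Y] dot_lmul_matrix)
  show ?thesis
    unfolding blk_mult blk_add blk_eq_iff trI
  proof (intro conjI)
    show "s * 0 + 0 \<bullet> (Gi *v p) + 0 * 0 = s * (\<Upsilon> \<bullet> u) + (0 * s + - ((s * s) *\<^sub>R (G *v u)) \<bullet> t *\<^sub>R Y + 0 * - (t * (\<Upsilon> \<bullet> Y) / 2))"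
    proof -
      have "- ((s * s) *\<^sub>R (G *v u)) \<bullet> t *\<^sub>R Y = - ((s * s * t) * (\<Upsilon> \<bullet> u))"
        by (simp add: f1 inner_commute[of u])
      then show ?thesis unfolding st'(3) by auto
    qed
    show "s *\<^sub>R - (G *v u) + transpose \<Gamma> *v 0 + 0 *\<^sub>R - p
        = 0 + (0 *\<^sub>R 0 + t *\<^sub>R - ((s * s) *\<^sub>R (G *v u)) + 0 *\<^sub>R - (t *\<^sub>R \<Upsilon>))"
      using st' by (simp add: ac_simps)
    show "0 *\<^sub>R t *\<^sub>R Y + t *\<^sub>R mat 1 *v (Gi *v p) + 0 *\<^sub>R 0
        = t *\<^sub>R dY - (t * (\<Upsilon> \<bullet> u)) *\<^sub>R Y + (s *\<^sub>R (t * t) *\<^sub>R (Gi *v q) + \<Gamma>' *v t *\<^sub>R Y + - (t * (\<Upsilon> \<bullet> Y) / 2) *\<^sub>R u)"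
    proof -
      have e: "s *\<^sub>R (t * t) *\<^sub>R z = t *\<^sub>R z" for z :: "real^'n"
        using st'(3) st by (simp flip: mult.assoc)
      show ?thesis
        unfolding e Giq dY matrix_vector_simps \<Gamma>'v f1
        by (simp add: inner_commute[of u]) (simp add: vec_eq_iff field_simps)
    qed
    show "outer (t *\<^sub>R Y) (- (G *v u)) + t *\<^sub>R mat 1 ** \<Gamma> + outer 0 (- p)
        = - (t * (\<Upsilon> \<bullet> u)) *\<^sub>R mat 1 + (outer ((t * t) *\<^sub>R (Gi *v q)) 0 + \<Gamma>' ** t *\<^sub>R mat 1 + outer u (- (t *\<^sub>R \<Upsilon>)))"
      by (simp add: \<Gamma>' outer_algebra matrix_ring_simps algebra_simps)
    show "- (t * (\<Upsilon> \<bullet> Y) / 2) * 0 + - (t *\<^sub>R \<Upsilon>) \<bullet> (Gi *v p) + t * 0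
        = - (t * (d\<Upsilon> \<bullet> Y + \<Upsilon> \<bullet> dY) - t * (\<Upsilon> \<bullet> u) * (\<Upsilon> \<bullet> Y)) / 2
          + (0 * s + - q \<bullet> t *\<^sub>R Y + 0 * - (t * (\<Upsilon> \<bullet> Y) / 2))"
      by (simp add: f2 qY UdY inner_commute[of Y] field_simps)
    show "- (t * (\<Upsilon> \<bullet> Y) / 2) *\<^sub>R - (G *v u) + transpose \<Gamma> *v - (t *\<^sub>R \<Upsilon>) + t *\<^sub>R - p
        = - (t *\<^sub>R d\<Upsilon> - (t * (\<Upsilon> \<bullet> u)) *\<^sub>R \<Upsilon>) + (0 *\<^sub>R 0 + t *\<^sub>R - q + 0 *\<^sub>R - (t *\<^sub>R \<Upsilon>))"
      by (simp add: q matrix_vector_simps scaleR_add_right scaleR_diff_right)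
  qed (simp_all add: matrix_vector_simps inner_commute)
qed

definition grad :: "(real^'n::finite \<Rightarrow> real) \<Rightarrow> real^'n \<Rightarrow> real^'n" where
  "grad w y = (\<chi> a. frechet_derivative w (at y) (axis a 1))"

lemma grad_inner:
  assumes "w differentiable (at y)"
  shows "frechet_derivative w (at y) u = grad w y \<bullet> u"
  using linear_axis_expansion[OF linear_frechet_derivative[OF assms], of u]
  by (simp add: grad_def inner_vec_def mult.commute)

lemma smooth_on_grad: "open U \<Longrightarrow> smooth_on w U \<Longrightarrow> smooth_on (grad w) U"
  by (rule smooth_on_vecI) (simp_all add: grad_def smooth_on_frechet)

text \<open>The transformation law \<open>P - \<nabla>\<Upsilon> + \<Upsilon> \<otimes> \<Upsilon> - 1/2 \<bar>\<Upsilon>\<bar>\<^sup>2 G\<close> of the Schouten tensor, read as a definition for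
  arbitrary \<open>p\<close>.\<close>

definition rescaled_form :: "(real^'n \<Rightarrow> real^'n^'n) \<Rightarrow> (real^'n \<Rightarrow> real) \<Rightarrow> (real^'n \<Rightarrow> real^'n \<Rightarrow> real^'n)
    \<Rightarrow> real^'n \<Rightarrow> real^'n \<Rightarrow> real^'n::finite" where
  "rescaled_form G w p y u = p y u - frechet_derivative (grad w) (at y) u + transpose (levi_civita G y u) *v grad w y
     + (grad w y \<bullet> u) *\<^sub>R grad w y - (grad w y \<bullet> (matrix_inv (G y) *v grad w y) / 2) *\<^sub>R (G y *v u)"

text \<open>The change of splitting from \<open>G\<close> to \<open>exp (2 w) G\<close>. The exponential factors appear because densities
  and covectors are identified with functions and vectors by means of the respective metrics.\<close>

definition rescale_gauge :: "(real^'n \<Rightarrow> real^'n^'n) \<Rightarrow> (real^'n \<Rightarrow> real) \<Rightarrow> real^'n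
    \<Rightarrow> real^(unit + 'n::finite + unit)^(unit + 'n + unit)" where
  "rescale_gauge G w y = blk (exp (w y)) 0 0 (exp (- w y) *\<^sub>R (matrix_inv (G y) *v grad w y)) (exp (- w y) *\<^sub>R mat 1) 0
     (- (exp (- w y) * (grad w y \<bullet> (matrix_inv (G y) *v grad w y)) / 2)) (- (exp (- w y) *\<^sub>R grad w y)) (exp (- w y))"

lemma invertible_rescale_gauge: "invertible (rescale_gauge G w y)"
proof -
  let ?s = "exp (w y)" and ?t = "exp (- w y)" and ?\<Upsilon> = "grad w y" and ?Y = "matrix_inv (G y) *v grad w y"
  have st: "?s * ?t = 1" by (simp flip: exp_add)
  have "rescale_gauge G w y ** blk ?t 0 0 (- (?t *\<^sub>R ?Y)) (?s *\<^sub>R mat 1) 0 (- (?t * (?\<Upsilon> \<bullet> ?Y) / 2)) (?s *\<^sub>R ?\<Upsilon>) ?s = mat 1"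
    unfolding rescale_gauge_def blk_mult blk_id blk_eq_iff
    using st by (simp add: transpose_algebra transpose_mat matrix_vector_simps matrix_ring_simps outer_algebra ac_simps)
  then show ?thesis unfolding invertible_def using matrix_inv_unique(3) by blast
qed

context
  fixes U :: "(real^'n::finite) set" and G G' :: "real^'n \<Rightarrow> real^'n^'n" and p :: "real^'n \<Rightarrow> real^'n \<Rightarrow> real^'n"
    and w :: "real^'n \<Rightarrow> real"
  assumes U: "open U" and sm: "smooth_on G U" and inv: "\<And>y. y \<in> U \<Longrightarrow> invertible (G y)"
    and sym: "\<And>y. y \<in> U \<Longrightarrow> transpose (G y) = G y"
    and smp: "\<And>u. smooth_on (\<lambda>y. p y u) U" and linp: "\<And>y. y \<in> U \<Longrightarrow> linear (p y)"
    and smw: "smooth_on w U" and G': "\<And>y. y \<in> U \<Longrightarrow> G' y = exp (2 * w y) *\<^sub>R G y"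
begin

lemma smooth_on_rescaled: "smooth_on G' U"
  by (rule smooth_on_cong[OF U G'[symmetric]])
    (auto intro!: smooth_on_scaleR_fun smooth_on_exp smooth_on_mult smooth_on_const U smw sm)

lemma matrix_inv_rescaled: "y \<in> U \<Longrightarrow> matrix_inv (G' y) = exp (- 2 * w y) *\<^sub>R matrix_inv (G y)"
  by (rule matrix_inv_unique(1))
    (simp add: G' matrix_ring_simps matrix_inv_inverse[OF inv] flip: exp_add)

lemma invertible_rescaled: "y \<in> U \<Longrightarrow> invertible (G' y)"
  unfolding invertible_def
  by (rule exI[of _ "exp (- 2 * w y) *\<^sub>R matrix_inv (G y)"])
    (simp add: G' matrix_ring_simps matrix_inv_inverse[OF inv] flip: exp_add)

lemma symmetric_rescaled: "y \<in> U \<Longrightarrow> transpose (G' y) = G' y"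
  by (simp add: G' transpose_algebra sym)

text \<open>The right-hand side is torsion-free and metric for the rescaled metric; uniqueness does the rest.\<close>

lemma levi_civita_rescaled:
  assumes x: "x \<in> U"
  shows "levi_civita G' x u = levi_civita G x u + (grad w x \<bullet> u) *\<^sub>R mat 1 + outer u (grad w x)
     - outer (matrix_inv (G x) *v grad w x) (G x *v u)"
proof -
  let ?\<Upsilon> = "grad w x" and ?Y = "matrix_inv (G x) *v grad w x" and ?e = "exp (2 * w x)"
  have lc: "levi_civita_at G x (levi_civita G x)"
    by (rule levi_civita_at_levi_civita[OF U x sm sym inv[OF x]])
  have lc': "levi_civita_at G' x (levi_civita G' x)"
    by (rule levi_civita_at_levi_civita[OF U x smooth_on_rescaled symmetric_rescaled invertible_rescaled[OF x]])
  have GY: "G x *v ?Y = ?\<Upsilon>" by (simp add: matrix_vector_mul_assoc matrix_inv_inverse[OF inv[OF x]])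
  define \<Gamma> where "\<Gamma> u = levi_civita G x u + (?\<Upsilon> \<bullet> u) *\<^sub>R mat 1 + outer u ?\<Upsilon> - outer ?Y (G x *v u)" for u
  have tors: "\<Gamma> u *v v = \<Gamma> v *v u" for u v
  proof -
    have "(G x *v u) \<bullet> v = (G x *v v) \<bullet> u" by (metis matrix_inner sym[OF x] inner_commute)
    moreover have "levi_civita G x u *v v = levi_civita G x v *v u" using lc by (simp add: levi_civita_at_def)
    ultimately show ?thesis by (simp add: \<Gamma>_def matrix_vector_simps outer_vector)
  qed
  have met: "frechet_derivative G' (at x) u = G' x ** \<Gamma> u + transpose (\<Gamma> u) ** G' x" for u
  proof -
    have "((\<lambda>y. exp (2 * w y) *\<^sub>R G y) has_derivative (\<lambda>u. ?e *\<^sub>R frechet_derivative G (at x) u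
        + (?e * (2 * frechet_derivative w (at x) u)) *\<^sub>R G x)) (at x)"
      by (rule has_derivative_eq_rhs[OF has_derivative_scaleR[OF has_derivative_exp[OF has_derivative_mult_right[OF
          smooth_on_has_derivative[OF smw x]]] smooth_on_has_derivative[OF sm x]]]) auto
    then have "(G' has_derivative (\<lambda>u. ?e *\<^sub>R frechet_derivative G (at x) u
        + (?e * (2 * frechet_derivative w (at x) u)) *\<^sub>R G x)) (at x)"
      by (rule has_derivative_transform_within_open[OF _ U x]) (simp add: G')
    then have d: "frechet_derivative G' (at x) u = ?e *\<^sub>R frechet_derivative G (at x) u + (?e * (2 * (?\<Upsilon> \<bullet> u))) *\<^sub>R G x"
      unfolding grad_inner[OF smooth_on_differentiable[OF smw x]] by (simp add: frechet_derivative_eqI)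
    have dG: "frechet_derivative G (at x) u = G x ** levi_civita G x u + transpose (levi_civita G x u) ** G x"
      using lc by (simp add: levi_civita_at_def)
    have G1: "G x ** \<Gamma> u = G x ** levi_civita G x u + (?\<Upsilon> \<bullet> u) *\<^sub>R G x + outer (G x *v u) ?\<Upsilon> - outer ?\<Upsilon> (G x *v u)"
      by (simp add: \<Gamma>_def matrix_ring_simps matrix_outer GY)
    have G2: "transpose (\<Gamma> u) ** G x = transpose (levi_civita G x u) ** G x + (?\<Upsilon> \<bullet> u) *\<^sub>R G x
        + outer ?\<Upsilon> (G x *v u) - outer (G x *v u) ?\<Upsilon>"
      by (simp add: \<Gamma>_def matrix_ring_simps transpose_algebra transpose_mat transpose_outer outer_matrix sym[OF x] GY)
    show ?thesis unfolding d dG G'[OF x]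
      by (simp add: matrix_ring_simps G1 G2 scaleR_add_right scaleR_diff_right) (simp add: vec_eq_iff algebra_simps)
  qed
  have "levi_civita G' x u = \<Gamma> u"
    by (rule levi_civita_at_unique[OF symmetric_rescaled[OF x] invertible_rescaled[OF x] lc'])
      (simp add: levi_civita_at_def tors met)
  then show ?thesis by (simp add: \<Gamma>_def)
qed

lemma smooth_on_rescaled_form: "smooth_on (\<lambda>y. rescaled_form G w p y u) U"
  unfolding rescaled_form_def divide_inverse
  by (intro smooth_on_diff smooth_on_add smooth_on_frechet smooth_on_grad smooth_on_matrix_vector smooth_on_scaleR_fun
      smooth_on_bilinear[OF bounded_bilinear_inner] smooth_on_mult smooth_on_const smooth_on_matrix_inv
      smooth_on_bounded_linear_comp[OF U bounded_linear_transpose] smooth_on_levi_civita U sm inv smw smp)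

lemma linear_rescaled_form:
  assumes y: "y \<in> U" shows "linear (rescaled_form G w p y)"
proof -
  have l: "linear (frechet_derivative (grad w) (at y))"
    by (rule linear_frechet_derivative[OF smooth_on_differentiable[OF smooth_on_grad[OF U smw] y]])
  show ?thesis
    by (rule linearI)
      (simp_all add: rescaled_form_def linear_add[OF linp[OF y]] linear_cmul[OF linp[OF y]] linear_add[OF l] linear_cmul[OF l]
        linear_add[OF linear_levi_civita] linear_cmul[OF linear_levi_civita] transpose_algebra matrix_vector_simps
        inner_add_right algebra_simps)
qed

lemma smooth_on_rescale_gauge: "smooth_on (rescale_gauge G w) U"
  unfolding rescale_gauge_def[abs_def] divide_inverse
  by (intro smooth_on_blk smooth_on_exp smooth_on_minus smooth_on_scaleR_fun smooth_on_matrix_vector smooth_on_matrix_inv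
      smooth_on_mult smooth_on_const smooth_on_bilinear[OF bounded_bilinear_inner] smooth_on_grad U sm inv smw)

lemma rescale_gauge_scale_tractor:
  assumes x: "x \<in> U"
  shows "rescale_gauge G w x ** scale_tractor G p x u = frechet_derivative (rescale_gauge G w) (at x) u
    + scale_tractor G' (rescaled_form G w p) x u ** rescale_gauge G w x"
proof -
  let ?s = "exp (w x)" and ?t = "exp (- w x)" and ?\<Upsilon> = "grad w" and ?Y = "\<lambda>y. matrix_inv (G y) *v grad w y"
  define d\<Upsilon> where "d\<Upsilon> = frechet_derivative (grad w) (at x)"
  define dY where "dY = frechet_derivative ?Y (at x)"
  have smY: "smooth_on ?Y U" by (intro smooth_on_matrix_vector smooth_on_matrix_inv smooth_on_grad U sm inv smw)
  have w: "(w has_derivative (\<lambda>u. ?\<Upsilon> x \<bullet> u)) (at x)"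
    using smooth_on_has_derivative[OF smw x] by (simp add: grad_inner[OF smooth_on_differentiable[OF smw x], abs_def])
  have \<Upsilon>: "(?\<Upsilon> has_derivative d\<Upsilon>) (at x)"
    unfolding d\<Upsilon>_def by (rule smooth_on_has_derivative[OF smooth_on_grad[OF U smw] x])
  have Y: "(?Y has_derivative dY) (at x)" unfolding dY_def by (rule smooth_on_has_derivative[OF smY x])
  have lc: "levi_civita_at G x (levi_civita G x)"
    by (rule levi_civita_at_levi_civita[OF U x sm sym inv[OF x]])
  note Gi = matrix_inv_inverse[OF inv[OF x]]
  have "((\<lambda>y. G y *v ?Y y) has_derivative (\<lambda>u. G x *v dY u + frechet_derivative G (at x) u *v ?Y x)) (at x)"
    by (rule bounded_bilinear.FDERIV[OF bounded_bilinear_matrix_vector smooth_on_has_derivative[OF sm x] Y])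
  then have "(?\<Upsilon> has_derivative (\<lambda>u. G x *v dY u + frechet_derivative G (at x) u *v ?Y x)) (at x)"
    by (rule has_derivative_transform_within_open[OF _ U x])
      (simp add: matrix_vector_mul_assoc matrix_inv_inverse[OF inv])
  then have "d\<Upsilon> u = G x *v dY u + frechet_derivative G (at x) u *v ?Y x"
    unfolding d\<Upsilon>_def by (rule frechet_derivative_eqI[THEN fun_cong])
  moreover have GY: "G x *v ?Y x = ?\<Upsilon> x" and GiG: "matrix_inv (G x) *v (G x *v z) = z" for z
    by (simp_all add: matrix_vector_mul_assoc Gi)
  moreover have "frechet_derivative G (at x) u *v z
      = G x *v (levi_civita G x u *v z) + transpose (levi_civita G x u) *v (G x *v z)" for z
    using lc by (simp add: levi_civita_at_def matrix_vector_simps matrix_vector_mul_assoc)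
  ultimately have "d\<Upsilon> u = G x *v dY u + (G x *v (levi_civita G x u *v ?Y x) + transpose (levi_civita G x u) *v ?\<Upsilon> x)"
    by (simp only:)
  then have "matrix_inv (G x) *v d\<Upsilon> u = dY u + (levi_civita G x u *v ?Y x
      + matrix_inv (G x) *v (transpose (levi_civita G x u) *v ?\<Upsilon> x))"
    by (simp only: matrix_vector_simps GiG)
  then have dY: "dY u = matrix_inv (G x) *v d\<Upsilon> u - levi_civita G x u *v ?Y x
      - matrix_inv (G x) *v (transpose (levi_civita G x u) *v ?\<Upsilon> x)"
    by (simp only: add_diff_cancel_right' diff_diff_eq)
  have t: "((\<lambda>y. exp (- w y)) has_derivative (\<lambda>u. - (?t * (?\<Upsilon> x \<bullet> u)))) (at x)"
    by (rule has_derivative_eq_rhs[OF has_derivative_exp[OF has_derivative_minus[OF w]]]) auto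
  have "(rescale_gauge G w has_derivative (\<lambda>u.
      blk (?s * (?\<Upsilon> x \<bullet> u)) 0 0 (?t *\<^sub>R dY u - (?t * (?\<Upsilon> x \<bullet> u)) *\<^sub>R ?Y x) (- (?t * (?\<Upsilon> x \<bullet> u)) *\<^sub>R mat 1) 0
        (- (?t * (d\<Upsilon> u \<bullet> ?Y x + ?\<Upsilon> x \<bullet> dY u) - ?t * (?\<Upsilon> x \<bullet> u) * (?\<Upsilon> x \<bullet> ?Y x)) / 2)
        (- (?t *\<^sub>R d\<Upsilon> u - (?t * (?\<Upsilon> x \<bullet> u)) *\<^sub>R ?\<Upsilon> x)) (- (?t * (?\<Upsilon> x \<bullet> u))))) (at x)"
    unfolding rescale_gauge_def[abs_def]
  proof (rule has_derivative_blk)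
    show "((\<lambda>y. exp (w y)) has_derivative (\<lambda>u. ?s * (?\<Upsilon> x \<bullet> u))) (at x)"
      by (rule has_derivative_eq_rhs[OF has_derivative_exp[OF w]]) auto
    show "((\<lambda>y. exp (- w y) *\<^sub>R ?Y y) has_derivative (\<lambda>u. ?t *\<^sub>R dY u - (?t * (?\<Upsilon> x \<bullet> u)) *\<^sub>R ?Y x)) (at x)"
      by (rule has_derivative_eq_rhs[OF has_derivative_scaleR[OF t Y]]) auto
    show "((\<lambda>y. exp (- w y) *\<^sub>R (mat 1 :: real^'n^'n)) has_derivative (\<lambda>u. - (?t * (?\<Upsilon> x \<bullet> u)) *\<^sub>R mat 1)) (at x)"
      by (rule has_derivative_scaleR_left[OF t])
    have "((\<lambda>y. - (exp (- w y) * (?\<Upsilon> y \<bullet> ?Y y) * (1/2))) has_derivative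
      (\<lambda>u. - ((?t * (?\<Upsilon> x \<bullet> dY u + d\<Upsilon> u \<bullet> ?Y x) + - (?t * (?\<Upsilon> x \<bullet> u)) * (?\<Upsilon> x \<bullet> ?Y x)) * (1/2)))) (at x)"
      by (intro has_derivative_minus has_derivative_mult_left has_derivative_mult has_derivative_inner t \<Upsilon> Y)
    then show "((\<lambda>y. - (exp (- w y) * (?\<Upsilon> y \<bullet> ?Y y) / 2)) has_derivative
      (\<lambda>u. - (?t * (d\<Upsilon> u \<bullet> ?Y x + ?\<Upsilon> x \<bullet> dY u) - ?t * (?\<Upsilon> x \<bullet> u) * (?\<Upsilon> x \<bullet> ?Y x)) / 2)) (at x)"
      by (simp add: algebra_simps add_divide_distrib diff_divide_distrib)
    show "((\<lambda>y. - (exp (- w y) *\<^sub>R ?\<Upsilon> y)) has_derivative (\<lambda>u. - (?t *\<^sub>R d\<Upsilon> u - (?t * (?\<Upsilon> x \<bullet> u)) *\<^sub>R ?\<Upsilon> x))) (at x)"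
      by (rule has_derivative_eq_rhs[OF has_derivative_minus[OF has_derivative_scaleR[OF t \<Upsilon>]]]) auto
  qed (auto intro: t)
  note dh = frechet_derivative_eqI[OF this]
  have e2: "exp (2 * w x) = ?s * ?s" "exp (- 2 * w x) = ?t * ?t"
    by (simp_all flip: exp_add)
  show ?thesis
    unfolding dh scale_tractor_def matrix_inv_rescaled[OF x] rescale_gauge_def
    unfolding G'[OF x] e2 matrix_vector_simps
    by (rule conformal_gauge_algebra[OF Gi(1) sym[OF x] refl _ dY])
      (simp_all add: rescaled_form_def d\<Upsilon>_def levi_civita_rescaled[OF x] flip: exp_add)
qed

lemma curvature_rescaled:
  assumes x: "x \<in> U"
  shows "rescale_gauge G w x ** curvature (scale_tractor G p) x v
     = curvature (scale_tractor G' (rescaled_form G w p)) x v ** rescale_gauge G w x"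
proof -
  have "rescale_gauge G w x ** curvature (scale_tractor G p) x v = curvature (scale_tractor G' (rescaled_form G w p)) x
     (\<lambda>i. frechet_derivative (\<lambda>x. x) (at x) (v i)) ** rescale_gauge G w x"
  proof (rule curvature_gauge[OF U x U])
    show "(\<lambda>x. x) ` U \<subseteq> U" by auto
    show "smooth_on (\<lambda>x. x) U" by (rule smooth_on_ident[OF U])
    show "smooth_on (rescale_gauge G w) U" by (rule smooth_on_rescale_gauge)
    show "smooth_on (\<lambda>y. scale_tractor G p y u) U" for u by (rule smooth_on_scale_tractor[OF U sm inv sym smp linp])
    show "smooth_on (\<lambda>y. scale_tractor G' (rescaled_form G w p) y u) U" for u
      by (rule smooth_on_scale_tractor[OF U smooth_on_rescaled invertible_rescaled symmetric_rescaled
            smooth_on_rescaled_form linear_rescaled_form])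
    show "linear (scale_tractor G' (rescaled_form G w p) y)" if "y \<in> U" for y
      by (rule linear_scale_tractor[OF U smooth_on_rescaled invertible_rescaled symmetric_rescaled
            smooth_on_rescaled_form linear_rescaled_form that])
    show "rescale_gauge G w y ** scale_tractor G p y u = frechet_derivative (rescale_gauge G w) (at y) u +
       scale_tractor G' (rescaled_form G w p) y (frechet_derivative (\<lambda>x. x) (at y) u) ** rescale_gauge G w y" if "y \<in> U" for y u
      using rescale_gauge_scale_tractor[OF that, of u] by simp
  qed
  then show ?thesis by simp
qed

text \<open>The gauge matrix is block triangular with scalar blocks on the diagonal, and the curvatures vanish
  above the diagonal. So conjugation leaves the middle block of the curvature unchanged.\<close>

lemma weyl_rescaled:
  assumes x: "x \<in> U"
  shows "weyl G p x u v = weyl G' (rescaled_form G w p) x u v"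
proof -
  let ?v = "\<lambda>i::nat. if i = 0 then u else v"
  have "\<exists>a c d g h i. curvature (scale_tractor G p) x ?v = blk a 0 c d (weyl G p x (?v 0) (?v 1)) 0 g h i"
    by (rule curvature_scale_tractor[OF U sm inv sym smp linp x])
  then obtain a c d g h i where 1: "curvature (scale_tractor G p) x ?v = blk a 0 c d (weyl G p x u v) 0 g h i"
    by auto
  have "\<exists>a c d g h i. curvature (scale_tractor G' (rescaled_form G w p)) x ?v
      = blk a 0 c d (weyl G' (rescaled_form G w p) x (?v 0) (?v 1)) 0 g h i"
    by (rule curvature_scale_tractor[OF U smooth_on_rescaled invertible_rescaled symmetric_rescaled
          smooth_on_rescaled_form linear_rescaled_form x])
  then obtain a' c' d' g' h' i' where 2: "curvature (scale_tractor G' (rescaled_form G w p)) x ?v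
      = blk a' 0 c' d' (weyl G' (rescaled_form G w p) x u v) 0 g' h' i'"
    by auto
  let ?d = "exp (- w x) *\<^sub>R (matrix_inv (G x) *v grad w x)" and ?h = "- (exp (- w x) *\<^sub>R grad w x)"
  have "outer ?d 0 + (exp (- w x) *\<^sub>R mat 1) ** weyl G p x u v + outer 0 h
      = outer d' 0 + weyl G' (rescaled_form G w p) x u v ** (exp (- w x) *\<^sub>R mat 1) + outer 0 ?h"
    using curvature_rescaled[OF x, of ?v]
    unfolding 1 2 rescale_gauge_def blk_mult blk_eq_iff by (elim conjE)
  then show ?thesis by (simp add: outer_algebra matrix_ring_simps)
qed

end

section \<open>The Schouten tensor as a normalisation\<close>

lemma contraction_weyl:
  fixes G :: "real^'n::finite \<Rightarrow> real^'n^'n"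
  assumes U: "open U" "x \<in> U" and sm: "smooth_on G U" and inv: "\<And>y. y \<in> U \<Longrightarrow> invertible (G y)"
    and sym: "transpose (G x) = G x" and P: "\<And>u. p x u = transpose P *v u"
  shows "contraction (weyl G p x) v z
    = v \<bullet> ((ricci G x - (real CARD('n) - 2) *\<^sub>R P - trace (matrix_inv (G x) ** P) *\<^sub>R G x) *v z)"
proof -
  let ?Gi = "matrix_inv (G x)"
  have t1: "(\<Sum>a\<in>UNIV. (outer (?Gi *v p x (axis a 1)) (G x *v v) *v z) $ a) = trace (?Gi ** P) * (v \<bullet> (G x *v z))"
  proof -
    have GiT: "transpose ?Gi = ?Gi"
      using matrix_inv_inverse[OF inv[OF U(2)]] sym matrix_inv_unique
      by (metis matrix_transpose_mul transpose_mat)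
    have "(\<Sum>a\<in>UNIV. (?Gi *v p x (axis a 1)) $ a) = trace (?Gi ** transpose P)"
      by (simp add: P trace_def matrix_entry_axis[of "?Gi ** transpose P"] matrix_vector_mul_assoc del: transpose_matrix_vector)
    also have "\<dots> = trace (transpose (P ** transpose ?Gi))"
      by (simp add: matrix_transpose_mul transpose_transpose)
    also have "\<dots> = trace (P ** ?Gi)" unfolding GiT by (simp add: trace_def transpose_def)
    also have "\<dots> = trace (?Gi ** P)" by (rule trace_mul_sym)
    finally show ?thesis
      by (simp add: outer_vector matrix_inner sym mult.commute flip: sum_distrib_left)
  qed
  have ax: "(\<Sum>a\<in>UNIV. (b \<bullet> axis a 1) * c $ a) = b \<bullet> c" for b c :: "real^'n"
    unfolding cart_eq_inner_axis[symmetric] by (simp add: inner_vec_def)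
  have t2: "(\<Sum>a\<in>UNIV. (outer (?Gi *v p x v) (G x *v axis a 1) *v z) $ a) = v \<bullet> (P *v z)"
  proof -
    have "(\<Sum>a\<in>UNIV. (outer (?Gi *v p x v) (G x *v axis a 1) *v z) $ a) = (G x *v z) \<bullet> (?Gi *v p x v)"
      using ax[of "G x *v z" "?Gi *v p x v"]
      by (simp add: outer_vector matrix_inner sym inner_commute[of "axis _ _"])
    also have "\<dots> = z \<bullet> p x v"
      by (simp add: matrix_inner[of "G x"] sym matrix_vector_mul_assoc matrix_mul_assoc matrix_inv_inverse[OF inv[OF U(2)]])
    finally show ?thesis by (simp add: P inner_commute[of z] matrix_inner transpose_transpose dot_lmul_matrix)
  qed
  have t3: "(\<Sum>a\<in>UNIV. (outer (axis a 1) (p x v) *v z) $ (a::'n)) = real CARD('n) * (v \<bullet> (P *v z))"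
    by (simp add: outer_vector P matrix_inner transpose_transpose dot_lmul_matrix axis_def)
  have t4: "(\<Sum>a\<in>UNIV. (outer v (p x (axis a 1)) *v z) $ a) = v \<bullet> (P *v z)"
    using ax[of "P *v z" v]
    by (simp add: outer_vector P dot_lmul_matrix inner_commute[of "P *v z"])
  have "contraction (weyl G p x) v z = contraction (riemann G x) v z
     - (\<Sum>a\<in>UNIV. (outer (?Gi *v p x (axis a 1)) (G x *v v) *v z) $ a)
     + (\<Sum>a\<in>UNIV. (outer (?Gi *v p x v) (G x *v axis a 1) *v z) $ a)
     - (\<Sum>a\<in>UNIV. (outer (axis a 1) (p x v) *v z) $ (a::'n))
     + (\<Sum>a\<in>UNIV. (outer v (p x (axis a 1)) *v z) $ a)"
    by (simp add: contraction_def weyl_def matrix_vector_simps sum.distrib sum_subtractf)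
  moreover have "v \<bullet> (ricci G x *v z) = contraction (riemann G x) v z"
    by (rule inner_ricci[OF U(1) sm inv U(2)])
  ultimately show ?thesis
    unfolding t1 t2 t3 t4
    by (simp add: matrix_vector_simps inner_diff_right algebra_simps)
qed

text \<open>The trace of the equation determines the trace of \<open>P\<close> from the scalar curvature, as \<open>2 n - 2 \<noteq> 0\<close>;
  then \<open>P\<close> itself is determined, as \<open>n - 2 \<noteq> 0\<close>.\<close>

lemma schouten_unique:
  fixes G :: "real^'n::finite \<Rightarrow> real^'n^'n"
  assumes n: "CARD('n) \<ge> 3" and inv: "invertible (G x)"
  shows "ricci G x = (real CARD('n) - 2) *\<^sub>R P + trace (matrix_inv (G x) ** P) *\<^sub>R G x \<longleftrightarrow> P = schouten G x"
proof -
  let ?n = "real CARD('n)" and ?Gi = "matrix_inv (G x)"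
  have n3: "?n \<ge> 3" using n by simp
  have tr1: "trace (?Gi ** G x) = ?n" by (simp add: matrix_inv_inverse[OF inv] trace_I)
  have tr: "trace (?Gi ** (a *\<^sub>R M + b *\<^sub>R N)) = a * trace (?Gi ** M) + b * trace (?Gi ** N)" for a b M N
    by (simp add: matrix_ring_simps linear_add[OF linear_trace] linear_cmul[OF linear_trace])
  show ?thesis
  proof
    assume r: "ricci G x = (?n - 2) *\<^sub>R P + trace (?Gi ** P) *\<^sub>R G x"
    have "scal G x = (2 * (?n - 1)) * trace (?Gi ** P)"
      unfolding scal_def r tr tr1 by (simp add: algebra_simps)
    then have "scal G x / (2 * (?n - 1)) = trace (?Gi ** P)" using n3 by simp
    then show "P = schouten G x" unfolding schouten_def r using n3 by simp
  next
    assume P: "P = schouten G x"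
    define j where "j = scal G x / (2 * (?n - 1))"
    have Pj: "P = (1 / (?n - 2)) *\<^sub>R ricci G x + (- (j / (?n - 2))) *\<^sub>R G x"
      unfolding P schouten_def j_def by (simp add: scaleR_diff_right)
    have "trace (?Gi ** P) = (scal G x - j * ?n) / (?n - 2)"
      unfolding Pj tr tr1 scal_def by (simp add: diff_divide_distrib)
    also have "scal G x - j * ?n = j * (?n - 2)" using n3 by (simp add: j_def field_simps)
    finally have "trace (?Gi ** P) = j" using n3 by simp
    then show "ricci G x = (?n - 2) *\<^sub>R P + trace (?Gi ** P) *\<^sub>R G x"
      unfolding P schouten_def j_def[symmetric] using n3 by simp
  qed
qed

text \<open>This characterises the Schouten tensor by the middle block of the tractor curvature, and so lets the
  invariance of that block determine how the Schouten tensor transforms.\<close>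

lemma contraction_weyl_zero_iff:
  fixes G :: "real^'n::finite \<Rightarrow> real^'n^'n"
  assumes n: "CARD('n) \<ge> 3" and U: "open U" "x \<in> U" and sm: "smooth_on G U" and inv: "\<And>y. y \<in> U \<Longrightarrow> invertible (G y)"
    and sym: "transpose (G x) = G x" and lin: "linear (p x)"
  shows "(\<forall>v z. contraction (weyl G p x) v z = 0) \<longleftrightarrow> p x = schouten_form G x"
proof -
  define P where "P = transpose (matrix (p x))"
  have P: "p x u = transpose P *v u" for u
    using matrix_vector_mul(2)[OF lin] by (simp add: P_def transpose_transpose fun_eq_iff)
  let ?M = "ricci G x - (real CARD('n) - 2) *\<^sub>R P - trace (matrix_inv (G x) ** P) *\<^sub>R G x"
  have "(\<forall>v z. contraction (weyl G p x) v z = 0) \<longleftrightarrow> (\<forall>v z. v \<bullet> (?M *v z) = v \<bullet> (0 *v z))"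
    by (simp add: contraction_weyl[where p=p and P=P, OF U sm inv sym P])
  also have "\<dots> \<longleftrightarrow> ?M = 0" using matrix_eq_inner[of ?M 0] by auto
  also have "\<dots> \<longleftrightarrow> ricci G x = (real CARD('n) - 2) *\<^sub>R P + trace (matrix_inv (G x) ** P) *\<^sub>R G x"
    by (auto simp: algebra_simps)
  also have "\<dots> \<longleftrightarrow> P = schouten G x" by (rule schouten_unique[where G=G and x=x, OF n inv[OF U(2)]])
  also have "\<dots> \<longleftrightarrow> p x = schouten_form G x"
  proof
    assume "P = schouten G x"
    then show "p x = schouten_form G x" by (auto simp: P schouten_form_transpose)
  next
    assume e: "p x = schouten_form G x"
    have "transpose P = transpose (schouten G x)"
      by (rule matrix_eqI) (simp only: P[symmetric] e schouten_form_transpose)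
    then show "P = schouten G x" by (metis transpose_transpose)
  qed
  finally show ?thesis .
qed

lemma linear_schouten_form: "linear (schouten_form G y)"
  unfolding schouten_form_transpose[abs_def] by (rule linear_matrix_vector)

lemma smooth_on_schouten_form:
  assumes "open U" "smooth_on G U" "\<And>y. y \<in> U \<Longrightarrow> invertible (G y)"
  shows "smooth_on (\<lambda>y. schouten_form G y u) U"
  unfolding schouten_form_transpose
  by (intro smooth_on_matrix_vector smooth_on_bounded_linear_comp[OF assms(1) bounded_linear_transpose]
      smooth_on_schouten smooth_on_const assms)

lemma curvature_cong:
  assumes "open U" "x \<in> U" "\<And>y. y \<in> U \<Longrightarrow> A y = B y"
  shows "curvature A x = curvature B x"
proof
  fix v
  have "ext_deriv 1 (\<lambda>y w. A y (w 0)) x v = ext_deriv 1 (\<lambda>y w. B y (w 0)) x v"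
    by (rule ext_deriv_cong[OF assms(1,2)]) (simp add: assms(3))
  then show "curvature A x v = curvature B x v" by (simp add: curvature_def assms(3)[OF assms(2)])
qed

lemma trace_form_scale_tractor_conformal:
  fixes G G' :: "real^'n::finite \<Rightarrow> real^'n^'n"
  assumes n: "CARD('n) \<ge> 3" and U: "open U" "x \<in> U" and sm: "smooth_on G U" and inv: "\<And>y. y \<in> U \<Longrightarrow> invertible (G y)"
    and sym: "\<And>y. y \<in> U \<Longrightarrow> transpose (G y) = G y"
    and smw: "smooth_on w U" and G': "\<And>y. y \<in> U \<Longrightarrow> G' y = exp (2 * w y) *\<^sub>R G y"
  shows "trace_form m (curvature (scale_tractor G (schouten_form G)) x) v = trace_form m (curvature (scale_tractor G' (schouten_form G')) x) v"
proof -
  let ?p = "schouten_form G" and ?q = "rescaled_form G w (schouten_form G)"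
  note smp = smooth_on_schouten_form[OF U(1) sm inv]
  note ctx = U(1) sm inv sym smp linear_schouten_form smw G'
  have q: "?q y = schouten_form G' y" if y: "y \<in> U" for y
  proof -
    have "(\<forall>v z. contraction (weyl G ?p y) v z = 0) \<longleftrightarrow> ?p y = schouten_form G y"
      by (rule contraction_weyl_zero_iff[where p="?p", OF n U(1) y sm inv sym[OF y] linear_schouten_form])
    moreover have "weyl G ?p y = weyl G' ?q y"
      by (intro ext) (rule weyl_rescaled[OF ctx y])
    moreover have "(\<forall>v z. contraction (weyl G' ?q y) v z = 0) \<longleftrightarrow> ?q y = schouten_form G' y"
      by (rule contraction_weyl_zero_iff[where p="?q" and G=G', OF n U(1) y smooth_on_rescaled[OF ctx] invertible_rescaled[OF ctx]
          symmetric_rescaled[OF ctx y] linear_rescaled_form[OF ctx y]])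
    ultimately show ?thesis by simp
  qed
  have "trace_form m (curvature (scale_tractor G ?p) x) v = trace_form m (curvature (scale_tractor G' ?q) x) (\<lambda>i. v i)"
    by (rule trace_form_intertwine[where T="\<lambda>u. u", OF invertible_rescale_gauge])
      (rule curvature_rescaled[OF ctx U(2)])
  also have "curvature (scale_tractor G' ?q) x = curvature (scale_tractor G' (schouten_form G')) x"
    by (rule curvature_cong[OF U]) (simp add: scale_tractor_def q fun_eq_iff)
  finally show ?thesis .
qed

section \<open>Removing the density weights\<close>

text \<open>The identity permutation contributes the trace. Any other permutation moves at least two indices, so
  each of its terms keeps an off-diagonal entry of the unit matrix after one factor is differentiated.\<close>

lemma has_derivative_det_id: "(det has_derivative trace) (at (mat 1 :: real^'n::finite^'n))"
proof -
  have "((\<lambda>A. \<Sum>p\<in>{p. p permutes (UNIV::'n set)}. of_int (sign p) * (\<Prod>i\<in>UNIV. A $ i $ p i)) has_derivative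
     (\<lambda>X. \<Sum>p\<in>{p. p permutes (UNIV::'n set)}. of_int (sign p) *
        (\<Sum>i\<in>UNIV. X $ i $ p i * (\<Prod>j\<in>UNIV - {i}. (mat 1 :: real^'n^'n) $ j $ p j)))) (at (mat 1))"
    by (intro has_derivative_sum has_derivative_mult_right has_derivative_prod
        bounded_linear.has_derivative[OF bounded_linear_vec_nth] has_derivative_ident)
  moreover have "(\<Sum>p\<in>{p. p permutes (UNIV::'n set)}. of_int (sign p) *
        (\<Sum>i\<in>UNIV. X $ i $ p i * (\<Prod>j\<in>UNIV - {i}. (mat 1 :: real^'n^'n) $ j $ p j))) = trace X" for X :: "real^'n^'n"
  proof -
    have z: "(\<Prod>j\<in>UNIV - {i}. (mat 1 :: real^'n^'n) $ j $ p j) = 0" if p: "p permutes UNIV" "p \<noteq> id" for p and i :: 'n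
    proof -
      have "\<exists>j. j \<noteq> i \<and> p j \<noteq> j"
      proof (rule ccontr)
        assume "\<nexists>j. j \<noteq> i \<and> p j \<noteq> j"
        then have fixed: "p j = j" if "j \<noteq> i" for j using that by blast
        then have "p i = i" using permutes_inj[OF p(1)] by (metis injD)
        then show False using fixed p(2) by (metis eq_id_iff)
      qed
      then obtain j where "j \<noteq> i" "p j \<noteq> j" by blast
      then show ?thesis by (intro prod_zero) (auto simp: mat_def intro!: bexI[of _ j])
    qed
    have "(\<Sum>p\<in>{p. p permutes (UNIV::'n set)}. of_int (sign p) *
        (\<Sum>i\<in>UNIV. X $ i $ p i * (\<Prod>j\<in>UNIV - {i}. (mat 1 :: real^'n^'n) $ j $ p j)))
      = (\<Sum>p\<in>{id}. of_int (sign p) *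
        (\<Sum>i\<in>UNIV. X $ i $ p i * (\<Prod>j\<in>UNIV - {i}. (mat 1 :: real^'n^'n) $ j $ p j)))"
      by (rule sum.mono_neutral_right) (auto simp: z permutes_id)
    also have "\<dots> = trace X" by (simp add: trace_def mat_def)
    finally show ?thesis .
  qed
  ultimately show ?thesis by (simp add: det_def[abs_def])
qed

text \<open>Jacobi's formula, reduced to the derivative at the unit matrix: \<open>det (M y)\<close> is \<open>det (M x)\<close> times the
  determinant of \<open>matrix_inv (M x) ** M y\<close>.\<close>

lemma has_derivative_det:
  fixes M :: "real^'k::finite \<Rightarrow> real^'n::finite^'n"
  assumes M: "(M has_derivative M') (at x)" and inv: "invertible (M x)"
  shows "((\<lambda>y. det (M y)) has_derivative (\<lambda>u. det (M x) * trace (matrix_inv (M x) ** M' u))) (at x)"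
proof -
  let ?I = "matrix_inv (M x)"
  note I = matrix_inv_inverse[OF inv]
  have N: "((\<lambda>y. ?I ** M y) has_derivative (\<lambda>u. ?I ** M' u)) (at x)"
    by (rule bounded_linear.has_derivative[OF bounded_bilinear.bounded_linear_right[OF bounded_bilinear_matrix_mult] M])
  have d: "(det has_derivative trace) (at (?I ** M x))" unfolding I by (rule has_derivative_det_id)
  have "((\<lambda>y. det (M x) * det (?I ** M y)) has_derivative (\<lambda>u. det (M x) * trace (?I ** M' u))) (at x)"
    by (rule has_derivative_mult_right[OF has_derivative_compose[OF N d]])
  moreover have "det (M x) * det (?I ** M y) = det (M y)" for y
  proof -
    have "det (M x) * det (?I ** M y) = det (M x ** (?I ** M y))" by (rule det_mul[symmetric])
    then show ?thesis by (simp add: matrix_mul_assoc I)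
  qed
  ultimately show ?thesis by simp
qed

lemma triple_matrix_eq_blk:
  assumes "\<And>\<sigma> \<mu> \<rho>. F \<sigma> \<mu> \<rho> = triple (a * \<sigma> + b \<bullet> \<mu> + c * \<rho>) (\<sigma> *\<^sub>R d + E *v \<mu> + \<rho> *\<^sub>R f) (g * \<sigma> + h \<bullet> \<mu> + i * \<rho>)"
  shows "triple_matrix F = blk a b c d E f g h i"
proof -
  have ax: "(\<chi> k. (axis (Inr (Inl l)) 1 :: real^(unit + 'a + unit)) $ Inr (Inl k)) = axis l 1"
    "(\<chi> k. (axis (Inl ()) 1 :: real^(unit + 'a + unit)) $ Inr (Inl k)) = 0"
    "(\<chi> k. (axis (Inr (Inr ())) 1 :: real^(unit + 'a + unit)) $ Inr (Inl k)) = 0" for l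
    by (auto simp: axis_def vec_eq_iff)
  show ?thesis
    unfolding triple_matrix_eq_iff
    by (simp add: triple_matrix_def matrix_def assms ax)
       (simp add: triple_def axis_def inner_vec_def matrix_vector_mult_def if_distrib cong: if_cong)
qed

definition density_scale :: "(real^'n \<Rightarrow> real^'n^'n) \<Rightarrow> real^'n::finite \<Rightarrow> real" where
  "density_scale G y = exp (ln \<bar>det (G y)\<bar> / (2 * real CARD('n)))"

text \<open>Passes from the coordinate frames of the density bundles to the frames given by the volume of \<open>G\<close>,
  and raises the index of the middle slot.\<close>

definition density_gauge :: "(real^'n \<Rightarrow> real^'n^'n) \<Rightarrow> real^'n::finite \<Rightarrow> real^(unit + 'n + unit)^(unit + 'n + unit)" where
  "density_gauge G y = blk (density_scale G y) 0 0 0 (density_scale G y *\<^sub>R matrix_inv (G y)) 0 0 0 (1 / density_scale G y)"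

lemma density_scale_pos: "density_scale G y > 0" by (simp add: density_scale_def)

lemma invertible_density_gauge:
  assumes "invertible (G y)"
  shows "invertible (density_gauge G y)"
proof -
  have "density_gauge G y ** blk (1 / density_scale G y) 0 0 0 ((1 / density_scale G y) *\<^sub>R G y) 0 0 0 (density_scale G y) = mat 1"
    unfolding density_gauge_def blk_mult blk_id blk_eq_iff
    using density_scale_pos[of G y] by (simp add: matrix_ring_simps matrix_inv_inverse[OF assms] outer_algebra)
  then show ?thesis unfolding invertible_def using matrix_inv_unique(3) by blast
qed

context
  fixes U :: "(real^'n::finite) set" and G :: "real^'n \<Rightarrow> real^'n^'n" and g :: "('m, 'n) metric" and c :: "('m, 'n) chart"
  assumes U: "open U" and sm: "smooth_on G U" and inv: "\<And>y. y \<in> U \<Longrightarrow> invertible (G y)"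
    and sym: "\<And>y. y \<in> U \<Longrightarrow> transpose (G y) = G y" and G: "G = g c"
begin

lemma smooth_on_density_scale: "smooth_on (density_scale G) U"
proof -
  have "smooth_on (\<lambda>y. ln \<bar>det (G y)\<bar>) U"
    using inv by (intro smooth_on_ln_abs smooth_on_det U sm) (simp add: invertible_det_nz)
  then show ?thesis
    unfolding density_scale_def[abs_def] divide_inverse by (intro smooth_on_exp smooth_on_mult smooth_on_const U)
qed

lemma smooth_on_density_gauge: "smooth_on (density_gauge G) U"
  unfolding density_gauge_def[abs_def]
  by (intro smooth_on_blk smooth_on_const smooth_on_scaleR_fun smooth_on_matrix_inv smooth_on_divide smooth_on_density_scale U sm inv)
    (assumption, rule less_imp_neq[OF density_scale_pos, symmetric])

text \<open>The trace of the Christoffel matrices is the derivative of \<open>ln (\<bar>det G\<bar>) / 2\<close>, so the density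
  connections are cancelled by the derivative of \<open>density_scale\<close>, and the conformal metric becomes
  \<open>G\<close>.\<close>

lemma density_gauge_tractor:
  assumes x: "x \<in> U"
  shows "density_gauge G x ** tractor_connection (c, g) x u
     = frechet_derivative (density_gauge G) (at x) u + scale_tractor G (schouten_form G) x u ** density_gauge G x"
proof -
  let ?s = "density_scale G x" and ?Gi = "matrix_inv (G x)" and ?L = "levi_civita G x u"
  define \<delta> where "\<delta> = density_conn 1 G x u"
  define dG where "dG = frechet_derivative G (at x)"
  have s: "?s \<noteq> 0" using density_scale_pos[of G x] by simp
  have det: "det (G x) \<noteq> 0" using inv[OF x] by (simp add: invertible_det_nz)
  note Gi = matrix_inv_inverse[OF inv[OF x]]
  have lc: "levi_civita_at G x (levi_civita G x)"
    by (rule levi_civita_at_levi_civita[OF U x sm sym inv[OF x]])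
  have dGu: "dG u = G x ** ?L + transpose ?L ** G x" using lc by (simp add: levi_civita_at_def dG_def)
  have dGd: "(G has_derivative dG) (at x)" unfolding dG_def by (rule smooth_on_has_derivative[OF sm x])
  have tr: "trace (?Gi ** dG u) = 2 * trace ?L"
  proof -
    have "trace (?Gi ** (transpose ?L ** G x)) = trace ((transpose ?L ** G x) ** ?Gi)" by (rule trace_mul_sym)
    also have "\<dots> = trace ?L" by (simp add: Gi flip: matrix_mul_assoc) (simp add: trace_def transpose_def)
    finally show ?thesis
      unfolding dGu by (simp add: matrix_ring_simps Gi linear_add[OF linear_trace])
  qed
  have ds: "(density_scale G has_derivative (\<lambda>u. ?s * (trace (?Gi ** dG u) / (2 * real CARD('n))))) (at x)"
  proof -
    have l: "((\<lambda>y. ln \<bar>det (G y)\<bar>) has_derivative (\<lambda>u. det (G x) * trace (?Gi ** dG u) * inverse (det (G x)))) (at x)"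
      by (rule has_derivative_compose[OF has_derivative_det[OF dGd inv[OF x]] has_derivative_ln_abs[OF det]])
    have "((\<lambda>y. exp (ln \<bar>det (G y)\<bar> * (1 / (2 * real CARD('n))))) has_derivative
      (\<lambda>u. ?s * (trace (?Gi ** dG u) / (2 * real CARD('n))))) (at x)"
      by (rule has_derivative_eq_rhs[OF has_derivative_exp[OF has_derivative_mult_left[OF l]]])
        (use det in \<open>auto simp: density_scale_def field_simps\<close>)
    then show ?thesis by (simp add: density_scale_def[abs_def])
  qed
  have dsu: "?s * (trace (?Gi ** dG u) / (2 * real CARD('n))) = ?s * \<delta>"
    by (simp add: tr \<delta>_def density_conn_def)
  define dGi where "dGi = frechet_derivative (\<lambda>y. matrix_inv (G y)) (at x)"
  have dGid: "((\<lambda>y. matrix_inv (G y)) has_derivative dGi) (at x)"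
    unfolding dGi_def by (rule smooth_on_has_derivative[OF smooth_on_matrix_inv[OF U sm inv] x])
  have "((\<lambda>y. matrix_inv (G y) ** G y) has_derivative (\<lambda>u. ?Gi ** dG u + dGi u ** G x)) (at x)"
    by (rule has_derivative_matrix_mult[OF dGid dGd])
  then have "((\<lambda>y. mat 1 :: real^'n^'n) has_derivative (\<lambda>u. ?Gi ** dG u + dGi u ** G x)) (at x)"
    by (rule has_derivative_transform_within_open[OF _ U x]) (simp add: matrix_inv_inverse[OF inv])
  then have "?Gi ** dG u + dGi u ** G x = 0"
    using frechet_derivative_eqI[THEN fun_cong, of "\<lambda>y. mat 1 :: real^'n^'n" _ x u] by simp
  then have "0 = (?Gi ** dG u + dGi u ** G x) ** ?Gi" by simp
  also have "\<dots> = (?Gi ** G x) ** ?L ** ?Gi + ?Gi ** transpose ?L ** (G x ** ?Gi) + dGi u ** (G x ** ?Gi)"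
    unfolding dGu by (simp only: matrix_ring_simps)
  also have "\<dots> = ?L ** ?Gi + ?Gi ** transpose ?L + dGi u"
    by (simp only: Gi matrix_mul_lid matrix_mul_rid)
  finally have e: "0 = ?L ** ?Gi + ?Gi ** transpose ?L + dGi u" .
  have dGiu: "dGi u = - (?L ** ?Gi + ?Gi ** transpose ?L)"
    unfolding eq_neg_iff_add_eq_0 add.commute[of "dGi u"] by (rule e[symmetric])
  have "(density_gauge G has_derivative (\<lambda>u.
      blk (?s * (trace (?Gi ** dG u) / (2 * real CARD('n)))) 0 0 0
        (?s *\<^sub>R dGi u + (?s * (trace (?Gi ** dG u) / (2 * real CARD('n)))) *\<^sub>R ?Gi) 0 0 0
        (- (inverse ?s * (?s * (trace (?Gi ** dG u) / (2 * real CARD('n)))) * inverse ?s)))) (at x)"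
    unfolding density_gauge_def[abs_def] inverse_eq_divide[symmetric]
    by (rule has_derivative_blk[OF ds has_derivative_const has_derivative_const has_derivative_const
          has_derivative_scaleR[OF ds dGid] has_derivative_const has_derivative_const has_derivative_const
          Deriv.has_derivative_inverse[OF s ds]])
  note dh = frechet_derivative_eqI[OF this]
  have powr: "\<bar>det (G x)\<bar> powr (- 1 / real CARD('n)) = inverse ?s * inverse ?s"
    using det by (simp add: powr_def density_scale_def flip: exp_minus exp_add)
  have H: "conf_metric G x = (inverse ?s * inverse ?s) *\<^sub>R G x"
    unfolding conf_metric_def powr by (rule refl)
  have ss: "?s * ?s * (inverse ?s * inverse ?s) = 1" "inverse ?s * inverse ?s * (?s * ?s) = 1"
    "?s * (inverse ?s * inverse ?s) = inverse ?s" "inverse ?s * inverse ?s * ?s = inverse ?s"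
    "inverse ?s * (?s * ?s) = ?s" "inverse ?s * (?s * \<delta>) * inverse ?s = \<delta> * inverse ?s"
    using s by (simp_all add: field_simps)
  have Hi: "matrix_inv (conf_metric G x) = (?s * ?s) *\<^sub>R ?Gi"
    unfolding H by (rule matrix_inv_unique(1)) (simp add: matrix_ring_simps Gi ss)
  have GiT: "transpose ?Gi = ?Gi"
    using Gi sym[OF x] matrix_inv_unique by (metis matrix_transpose_mul transpose_mat)
  have tc: "tractor_connection (c, g) x u = blk \<delta> (- u) 0 (schouten_form G x u) (\<delta> *\<^sub>R mat 1 - transpose ?L)
      ((inverse ?s * inverse ?s) *\<^sub>R (G x *v u)) 0 (- ((?s * ?s) *\<^sub>R (?Gi *v schouten_form G x u))) (- \<delta>)"
    unfolding tractor_connection_def prod.case G[symmetric] Let_def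
  proof (rule triple_matrix_eq_blk)
    fix \<sigma> \<rho> :: real and \<mu> :: "real^'n"
    have "u v* conf_metric G x = (inverse ?s * inverse ?s) *\<^sub>R (G x *v u)"
      using transpose_matrix_vector[of "conf_metric G x" u] by (simp add: H transpose_algebra sym[OF x] matrix_vector_simps)
    moreover have "density_conn (- 1) G x u = - \<delta>" by (simp add: \<delta>_def density_conn_def)
    moreover have "(u v* schouten G x) \<bullet> (matrix_inv (conf_metric G x) *v \<mu>) = (?s * ?s) * ((?Gi *v schouten_form G x u) \<bullet> \<mu>)"
      by (simp add: Hi matrix_vector_simps schouten_form_def matrix_inner GiT inner_commute)
    ultimately show "triple (density_conn 1 G x u * \<sigma> - u \<bullet> \<mu>)
         (density_conn 1 G x u *\<^sub>R \<mu> - transpose (levi_civita G x u) *v \<mu> + \<rho> *\<^sub>R (u v* conf_metric G x) + \<sigma> *\<^sub>R (u v* schouten G x))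
         (density_conn (- 1) G x u * \<rho> - (u v* schouten G x) \<bullet> (matrix_inv (conf_metric G x) *v \<mu>))
      = triple (\<delta> * \<sigma> + - u \<bullet> \<mu> + 0 * \<rho>)
         (\<sigma> *\<^sub>R schouten_form G x u + (\<delta> *\<^sub>R mat 1 - transpose ?L) *v \<mu> + \<rho> *\<^sub>R ((inverse ?s * inverse ?s) *\<^sub>R (G x *v u)))
         (0 * \<sigma> + - ((?s * ?s) *\<^sub>R (?Gi *v schouten_form G x u)) \<bullet> \<mu> + - \<delta> * \<rho>)"
      by (simp add: \<delta>_def[symmetric] schouten_form_def matrix_vector_simps algebra_simps del: transpose_matrix_vector)
  qed
  have GiG: "?Gi *v (G x *v z) = z" for z by (simp add: matrix_vector_mul_assoc Gi)
  show ?thesis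
    unfolding dh dsu tc
    unfolding density_gauge_def scale_tractor_def blk_mult blk_add blk_eq_iff inverse_eq_divide[symmetric]
    using s
    by (simp add: matrix_vector_simps transpose_algebra GiT GiG dGiu matrix_ring_simps outer_algebra scaleR_add_right
        scaleR_diff_right)
qed

lemma trace_form_tractor_connection:
  assumes x: "x \<in> U"
  shows "trace_form m (curvature (tractor_connection (c, g)) x) v = trace_form m (curvature (scale_tractor G (schouten_form G)) x) v"
proof -
  note smp = smooth_on_schouten_form[OF U sm inv]
  have smt: "smooth_on (\<lambda>y. scale_tractor G (schouten_form G) y u) U" for u
    by (rule smooth_on_scale_tractor[OF U sm inv sym smp linear_schouten_form])
  have smc: "smooth_on (\<lambda>y. tractor_connection (c, g) y u) U" for u
  proof -
    \<comment> \<open>the gauge equation, solved for the tractor connection, shows that it is smooth\<close>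
    have "smooth_on (\<lambda>y. matrix_inv (density_gauge G y) ** (frechet_derivative (density_gauge G) (at y) u
        + scale_tractor G (schouten_form G) y u ** density_gauge G y)) U"
      by (intro smooth_on_matrix_mult smooth_on_matrix_inv smooth_on_add smooth_on_frechet smooth_on_density_gauge smt U
          invertible_density_gauge inv)
    then show ?thesis
    proof (rule smooth_on_cong[OF U, rotated])
      fix y assume y: "y \<in> U"
      show "matrix_inv (density_gauge G y) ** (frechet_derivative (density_gauge G) (at y) u
        + scale_tractor G (schouten_form G) y u ** density_gauge G y) = tractor_connection (c, g) y u"
        unfolding density_gauge_tractor[OF y, symmetric]
        by (simp add: matrix_mul_assoc matrix_inv_inverse[OF invertible_density_gauge[where G=G and y=y, OF inv[OF y]]])
    qed
  qed
  have g: "density_gauge G x ** curvature (tractor_connection (c, g)) x v = curvature (scale_tractor G (schouten_form G)) x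
     (\<lambda>i. frechet_derivative (\<lambda>x. x) (at x) (v i)) ** density_gauge G x" for v
  proof (rule curvature_gauge[OF U x U])
    show "(\<lambda>x. x) ` U \<subseteq> U" by auto
    show "smooth_on (\<lambda>x. x) U" by (rule smooth_on_ident[OF U])
    show "smooth_on (density_gauge G) U" by (rule smooth_on_density_gauge)
    show "smooth_on (\<lambda>y. tractor_connection (c, g) y u) U" for u by (rule smc)
    show "smooth_on (\<lambda>y. scale_tractor G (schouten_form G) y u) U" for u by (rule smt)
    show "linear (scale_tractor G (schouten_form G) y)" if "y \<in> U" for y
      by (rule linear_scale_tractor[OF U sm inv sym smp linear_schouten_form that])
    show "density_gauge G y ** tractor_connection (c, g) y u = frechet_derivative (density_gauge G) (at y) u +
       scale_tractor G (schouten_form G) y (frechet_derivative (\<lambda>x. x) (at y) u) ** density_gauge G y" if "y \<in> U" for y u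
      using density_gauge_tractor[OF that, of u] by simp
  qed
  have "trace_form m (curvature (tractor_connection (c, g)) x) v = trace_form m (curvature (scale_tractor G (schouten_form G)) x) (\<lambda>i. v i)"
    by (rule trace_form_intertwine[where T="\<lambda>u. u", OF invertible_density_gauge[where G=G and y=x, OF inv[OF x]]]) (use g in simp)
  then show ?thesis by simp
qed

end

section \<open>Comparison with the Levi-Civita connection\<close>

definition scale_tractor_bundle :: "('m, 'n::finite) chart set \<Rightarrow> ('m, 'n, ('m, 'n) chart, unit + 'n + unit) bundle_data" where
  "scale_tractor_bundle A = \<lparr>triv = A, chart_of = (\<lambda>c. c), transition = (\<lambda>c c' p. blk 1 0 0 0 (jac c c' p) 0 0 0 1)\<rparr>"

text \<open>The direct sum of the Levi-Civita connection with two trivial connections.\<close>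

definition split_connection :: "(real^'n \<Rightarrow> real^'n^'n) \<Rightarrow> ('n::finite, unit + 'n + unit) conn_form" where
  "split_connection G y u = blk 0 0 0 0 (levi_civita G y u) 0 0 0 0"

lemma vector_bundle_scale_tractor_bundle:
  assumes A: "smooth_atlas A"
  shows "vector_bundle A (scale_tractor_bundle A)"
proof -
  have T: "vector_bundle A (tangent_bundle A)" by (rule vector_bundle_tangent_bundle[OF A])
  have "smooth_on ((\<lambda>p. blk 1 0 0 0 (jac c c' p) 0 0 0 1) \<circ> param c) (coord c ` (dom c \<inter> dom c'))"
    if "c \<in> A" "c' \<in> A" for c c'
  proof -
    have "smooth_on (jac c c' \<circ> param c) (coord c ` (dom c \<inter> dom c'))"
      using T that by (simp add: vector_bundle_def tangent_bundle_def)
    then show ?thesis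
      unfolding o_def by (intro smooth_on_blk smooth_on_const open_overlap[OF A that])
  qed
  then show ?thesis
    using T by (simp add: vector_bundle_def scale_tractor_bundle_def tangent_bundle_def blk_mult blk_id outer_algebra)
qed

lemma connection_scale_tractor_bundleI:
  assumes A: "smooth_atlas A"
    and sm: "\<And>c u. c \<in> A \<Longrightarrow> smooth_on (\<lambda>x. D c x u) (img c)"
    and lin: "\<And>c x. c \<in> A \<Longrightarrow> x \<in> img c \<Longrightarrow> linear (D c x)"
    and gauge: "\<And>c c' p u. c \<in> A \<Longrightarrow> c' \<in> A \<Longrightarrow> p \<in> dom c \<inter> dom c' \<Longrightarrow>
      blk 1 0 0 0 (jac c c' p) 0 0 0 1 ** D c (coord c p) u
       = blk 0 0 0 0 (frechet_derivative (jac c c' \<circ> param c) (at (coord c p)) u) 0 0 0 0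
         + D c' (coord c' p) (jac c c' p *v u) ** blk 1 0 0 0 (jac c c' p) 0 0 0 1"
  shows "connection A (scale_tractor_bundle A) D"
proof -
  have "frechet_derivative ((\<lambda>p. blk 1 0 0 0 (jac c c' p) 0 0 0 1) \<circ> param c) (at (coord c p)) u
     = blk 0 0 0 0 (frechet_derivative (jac c c' \<circ> param c) (at (coord c p)) u) 0 0 0 0"
    if c: "c \<in> A" "c' \<in> A" and p: "p \<in> dom c \<inter> dom c'" for c c' p u
  proof -
    have "smooth_on (jac c c' \<circ> param c) (coord c ` (dom c \<inter> dom c'))"
      using vector_bundle_tangent_bundle[OF A] c by (simp add: vector_bundle_def tangent_bundle_def)
    from smooth_on_has_derivative[OF this, of "coord c p"] p
    have "(jac c c' \<circ> param c has_derivative frechet_derivative (jac c c' \<circ> param c) (at (coord c p))) (at (coord c p))"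
      by blast
    then have "((\<lambda>y. blk 1 0 0 0 ((jac c c' \<circ> param c) y) 0 0 0 1) has_derivative
      (\<lambda>u. blk 0 0 0 0 (frechet_derivative (jac c c' \<circ> param c) (at (coord c p)) u) 0 0 0 0)) (at (coord c p))"
      by (intro has_derivative_blk has_derivative_const)
    from frechet_derivative_eqI[OF this] show ?thesis by (simp add: o_def)
  qed
  then show ?thesis
    using vector_bundle_scale_tractor_bundle[OF A] sm lin gauge
    by (simp add: connection_def scale_tractor_bundle_def Let_def)
qed

lemma connection_split_connection:
  assumes A: "smooth_atlas A" and g: "pseudo_riemannian A g"
  shows "connection A (scale_tractor_bundle A) (\<lambda>c. split_connection (g c))"
proof (rule connection_scale_tractor_bundleI[OF A])
  note LC = connection_levi_civita[OF A g]
  show "smooth_on (\<lambda>x. split_connection (g c) x u) (img c)" if c: "c \<in> A" for c u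
    unfolding split_connection_def
    by (intro smooth_on_blk smooth_on_const atlas_chart(2)[OF A c]
        smooth_on_levi_civita[OF atlas_chart(2)[OF A c] pseudo_riemannian_local(1)[OF g c] pseudo_riemannian_local(3)[OF g c]])
  show "linear (split_connection (g c) x)" for c x
    by (rule linearI) (simp_all add: split_connection_def blk_add blk_scaleR linear_add[OF linear_levi_civita] linear_cmul[OF linear_levi_civita])
  show "blk 1 0 0 0 (jac c c' p) 0 0 0 1 ** split_connection (g c) (coord c p) u
       = blk 0 0 0 0 (frechet_derivative (jac c c' \<circ> param c) (at (coord c p)) u) 0 0 0 0
         + split_connection (g c') (coord c' p) (jac c c' p *v u) ** blk 1 0 0 0 (jac c c' p) 0 0 0 1"
    if "c \<in> A" "c' \<in> A" "p \<in> dom c \<inter> dom c'" for c c' p u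
    unfolding split_connection_def blk_mult blk_add levi_civita_change[OF A g that]
    by (simp add: outer_algebra)
qed

text \<open>In a fixed scale the blocks of the tractor connection are tensors, except for the Christoffel
  matrices, whose inhomogeneous transformation law is the derivative of the transition function.\<close>

lemma connection_scale_tractor:
  assumes A: "smooth_atlas A" and g: "pseudo_riemannian A g"
  shows "connection A (scale_tractor_bundle A) (\<lambda>c. scale_tractor (g c) (schouten_form (g c)))"
proof (rule connection_scale_tractor_bundleI[OF A])
  fix c assume c: "c \<in> A"
  note l = atlas_chart(2)[OF A c] pseudo_riemannian_local(1)[OF g c] pseudo_riemannian_local(3)[OF g c] pseudo_riemannian_local(2)[OF g c]
  note smp = smooth_on_schouten_form[OF l(1-3)]
  show "smooth_on (\<lambda>x. scale_tractor (g c) (schouten_form (g c)) x u) (img c)" for u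
    by (rule smooth_on_scale_tractor[OF l smp linear_schouten_form])
  show "linear (scale_tractor (g c) (schouten_form (g c)) x)" if "x \<in> img c" for x
    by (rule linear_scale_tractor[OF l smp linear_schouten_form that])
  fix c' p u assume c': "c' \<in> A" and p: "p \<in> dom c \<inter> dom c'"
  let ?J = "jac c c' p" and ?I = "jac c' c p"
  note I = jac_inverse[OF A c c' p]
  have tI: "transpose ?I ** transpose ?J = mat 1"
    unfolding matrix_transpose_mul[symmetric] I(2) by (simp add: transpose_mat)
  have g1: "g c (coord c p) *v u = transpose ?J *v (g c' (coord c' p) *v (?J *v u))"
    unfolding pseudo_riemannian_change[OF g c c' p] by (simp add: matrix_vector_mul_assoc matrix_mul_assoc)
  have p1: "schouten_form (g c) (coord c p) u = transpose ?J *v schouten_form (g c') (coord c' p) (?J *v u)"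
    unfolding schouten_form_transpose schouten_change[OF A g c c' p] matrix_transpose_mul transpose_transpose
      matrix_vector_mul_assoc by (simp add: matrix_mul_assoc)
  have g2: "?J *v (matrix_inv (g c (coord c p)) *v schouten_form (g c) (coord c p) u)
      = matrix_inv (g c' (coord c' p)) *v schouten_form (g c') (coord c' p) (?J *v u)"
  proof -
    have "?J ** (?I ** matrix_inv (g c' (coord c' p)) ** transpose ?I) ** transpose ?J
        = (?J ** ?I) ** matrix_inv (g c' (coord c' p)) ** (transpose ?I ** transpose ?J)"
      by (simp add: matrix_mul_assoc)
    then have "?J ** (?I ** matrix_inv (g c' (coord c' p)) ** transpose ?I) ** transpose ?J
        = matrix_inv (g c' (coord c' p))" unfolding I tI by simp
    then show ?thesis
      unfolding p1 metric_inverse_change[OF A g c c' p] matrix_vector_mul_assoc by (simp add: matrix_mul_assoc)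
  qed
  show "blk 1 0 0 0 ?J 0 0 0 1 ** scale_tractor (g c) (schouten_form (g c)) (coord c p) u
       = blk 0 0 0 0 (frechet_derivative (jac c c' \<circ> param c) (at (coord c p)) u) 0 0 0 0
         + scale_tractor (g c') (schouten_form (g c')) (coord c' p) (?J *v u) ** blk 1 0 0 0 ?J 0 0 0 1"
    unfolding scale_tractor_def blk_mult blk_add blk_eq_iff g2
    unfolding levi_civita_change[OF A g c c' p] g1 p1
    by (simp add: outer_algebra matrix_vector_simps)
qed

lemma mwpower_blk:
  fixes F :: "(nat \<Rightarrow> 'v) \<Rightarrow> real^'r::finite^'r"
  shows "mwpower (Suc m) (\<lambda>v. blk 0 0 0 0 (F v) 0 0 0 0) v = blk 0 0 0 0 (mwpower (Suc m) F v) 0 0 0 0"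
proof -
  have lin: "linear (\<lambda>E. blk 0 0 0 0 (E :: real^'r^'r) 0 0 0 0)"
    by (rule linearI) (simp_all add: blk_add blk_scaleR)
  have mw: "mwedge p q (\<lambda>v. blk 0 0 0 0 (\<alpha> v) 0 0 0 0) B v = blk 0 0 0 0 (mwedge p q \<alpha> \<beta> v) 0 0 0 0"
    if "\<And>v w. blk 0 0 0 0 (\<alpha> v) 0 0 0 0 ** B w = blk 0 0 0 0 (\<alpha> v ** \<beta> w) 0 0 0 0"
    for p q B v and \<alpha> \<beta> :: "(nat \<Rightarrow> 'v) \<Rightarrow> real^'r^'r"
    unfolding mwedge_def that
    by (simp add: linear_sum[OF lin] linear_cmul[OF lin])
  show ?thesis
  proof (induction m arbitrary: v)
    case 0
    show ?case unfolding mwpower.simps by (rule mw) simp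
  next
    case (Suc m)
    show ?case
      unfolding mwpower.simps(2)[of "Suc m"]
      by (rule mw) (simp add: Suc blk_mult outer_algebra del: mwpower.simps)
  qed
qed

text \<open>The degree is positive because the empty power is the unit matrix, with a trace that depends on the
  rank.\<close>

lemma trace_form_split_connection:
  assumes U: "open U" "x \<in> U" and sm: "smooth_on G U" and inv: "\<And>y. y \<in> U \<Longrightarrow> invertible (G y)"
  shows "trace_form (Suc m) (curvature (split_connection G) x) v = trace_form (Suc m) (curvature (levi_civita G) x) v"
proof -
  have d: "((\<lambda>y. split_connection G y u) has_derivative
     (\<lambda>w. blk 0 0 0 0 (frechet_derivative (\<lambda>y. levi_civita G y u) (at x) w) 0 0 0 0)) (at x)" for u
    unfolding split_connection_def
    by (intro has_derivative_blk has_derivative_const smooth_on_has_derivative[OF smooth_on_levi_civita[OF U(1) sm inv] U(2)])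
  have "curvature (split_connection G) x = (\<lambda>v. blk 0 0 0 0 (curvature (levi_civita G) x v) 0 0 0 0)"
  proof
    fix v
    have "curvature (levi_civita G) x v = riemann G x (v 0) (v 1)"
      by (rule curvature_levi_civita[OF U(1) sm inv U(2)])
    also have "\<dots> = frechet_derivative (\<lambda>y. levi_civita G y (v 1)) (at x) (v 0)
        - frechet_derivative (\<lambda>y. levi_civita G y (v 0)) (at x) (v 1)
        + levi_civita G x (v 0) ** levi_civita G x (v 1) - levi_civita G x (v 1) ** levi_civita G x (v 0)"
      by (rule riemann_explicit[OF U(1) sm inv U(2)])
    finally have R: "curvature (levi_civita G) x v = \<dots>" .
    have dd: "(\<lambda>y. split_connection G y u) differentiable (at x)" for u using d by (auto simp: differentiable_def)
    show "curvature (split_connection G) x v = blk 0 0 0 0 (curvature (levi_civita G) x v) 0 0 0 0"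
      unfolding curvature_explicit[OF dd] frechet_derivative_eqI[OF d] R
      by (simp add: split_connection_def blk_mult blk_add blk_diff outer_algebra)
  qed
  then show ?thesis unfolding trace_form_def by (simp only: mwpower_blk trace_blk add_0_left add_0_right)
qed

lemma conformal_structure_conformal_change:
  assumes A: "smooth_atlas A" and C: "conformal_structure A C"
  obtains g where "pseudo_riemannian A g" "g \<in> C"
    "\<And>g'. g' \<in> C \<Longrightarrow> pseudo_riemannian A g' \<and> (\<exists>\<omega>. conformal_change A \<omega> g g')"
proof -
  obtain g where g: "pseudo_riemannian A g" "C = conformal_rel A `` {g}"
    using C by (auto simp: conformal_structure_def quotient_def)
  have "conformal_change A (\<lambda>_. 0) g g"
    unfolding conformal_change_def smooth_fun_def o_def
    using atlas_chart(2)[OF A] by (simp add: smooth_on_const)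
  then have "g \<in> C" using g by (auto simp: conformal_rel_def)
  then show thesis
  proof (rule that[OF g(1)])
    fix g' assume "g' \<in> C"
    then have "(g, g') \<in> conformal_rel A" unfolding g(2) by simp
    then show "pseudo_riemannian A g' \<and> (\<exists>\<omega>. conformal_change A \<omega> g g')"
      unfolding conformal_rel_def by blast
  qed
qed

text \<open>In each chart the conformal Pontrjagin form is computed with some metric of the class, possibly a
  different one for each chart. Its gauge invariance, first under \<open>density_gauge\<close> and then under
  \<open>rescale_gauge\<close>, allows \<open>g\<close> to be used everywhere.\<close>

lemma conformal_pontrjagin_form_eq:
  fixes A :: "('m::{t2_space, second_countable_topology}, 'n::finite) chart set"
  assumes A: "smooth_atlas A" and n: "CARD('n) \<ge> 3"
    and gC: "g \<in> C" and C: "\<And>g'. g' \<in> C \<Longrightarrow> pseudo_riemannian A g' \<and> (\<exists>\<omega>. conformal_change A \<omega> g g')"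
    and c: "c \<in> A" and x: "x \<in> img c"
  shows "conformal_pontrjagin_form A C k c x v
    = pontrjagin_form (scale_tractor_bundle A) (\<lambda>c. scale_tractor (g c) (schouten_form (g c))) k c x v"
proof -
  note U = atlas_chart(2)[OF A c]
  have g: "pseudo_riemannian A g" using C[OF gC] by simp
  have "chart_of (tractor_bundle A C) ` triv (tractor_bundle A C) = A"
    using gC by (auto simp: tractor_bundle_def fst_image_times)
  from triv_over[OF this c] obtain h where h: "triv_over (tractor_bundle A C) c = (c, h)" "h \<in> C"
    by (cases "triv_over (tractor_bundle A C) c") (auto simp: tractor_bundle_def)
  have ph: "pseudo_riemannian A h" using C[OF h(2)] by simp
  obtain \<omega> where \<omega>: "conformal_change A \<omega> g h" using C[OF h(2)] by blast
  define w where "w = \<omega> \<circ> param c"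
  have w: "smooth_on w (img c)" "\<And>y. y \<in> img c \<Longrightarrow> h c y = exp (2 * w y) *\<^sub>R g c y"
    using \<omega> c by (auto simp: conformal_change_def smooth_fun_def w_def)
  have t: "triv_over (scale_tractor_bundle A) c = c"
    using triv_over[of "scale_tractor_bundle A" A c] c by (simp add: scale_tractor_bundle_def)
  have "trace_form (2 * k) (curvature (tractor_connection (c, h)) x) v
      = trace_form (2 * k) (curvature (scale_tractor (h c) (schouten_form (h c))) x) v"
    by (rule trace_form_tractor_connection[where g=h and c=c and G="h c", OF U pseudo_riemannian_local(1)[OF ph c] pseudo_riemannian_local(3)[OF ph c]
          pseudo_riemannian_local(2)[OF ph c] refl x])
  also have "\<dots> = trace_form (2 * k) (curvature (scale_tractor (g c) (schouten_form (g c))) x) v"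
    by (rule trace_form_scale_tractor_conformal[OF n U x pseudo_riemannian_local(1)[OF g c] pseudo_riemannian_local(3)[OF g c]
          pseudo_riemannian_local(2)[OF g c] w, symmetric])
  finally show ?thesis
    unfolding conformal_pontrjagin_form_def pontrjagin_form_eq h(1) t by simp
qed

theorem theorem2p2:
  fixes A :: "('m::{t2_space, second_countable_topology}, 'n::finite) chart set"
    and C :: "('m, 'n) metric set"
    and k :: nat
  assumes "smooth_atlas A"
    and "CARD('n) \<ge> 3"
    and "conformal_structure A C"
    and "k \<ge> 1"
  shows "de_rham_class A (4 * k) (conformal_pontrjagin_form A C k) \<in> de_rham_cohomology A (4 * k)
    \<and> de_rham_class A (4 * k) (conformal_pontrjagin_form A C k)
        = pontrjagin_class A (tangent_bundle A) k"
proof -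
  note A = assms(1)
  obtain g where gC: "g \<in> C"
    and C: "\<And>g'. g' \<in> C \<Longrightarrow> pseudo_riemannian A g' \<and> (\<exists>\<omega>. conformal_change A \<omega> g g')"
    using conformal_structure_conformal_change[OF A assms(3)] by blast
  then have g: "pseudo_riemannian A g" by blast
  obtain r where r: "4 * k = Suc r" using assms(4) by (cases "4 * k") auto
  obtain m where m: "2 * k = Suc m" using assms(4) by (cases "2 * k") auto
  let ?\<tau> = "conformal_pontrjagin_form A C k"
  let ?T = "pontrjagin_form (scale_tractor_bundle A) (\<lambda>c. scale_tractor (g c) (schouten_form (g c))) k"
  let ?S = "pontrjagin_form (scale_tractor_bundle A) (\<lambda>c. split_connection (g c)) k"
  let ?L = "pontrjagin_form (tangent_bundle A) (\<lambda>c. levi_civita (g c)) k"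
  have \<tau>T: "?\<tau> c x v = ?T c x v" if "c \<in> A" "x \<in> img c" for c x v
    by (rule conformal_pontrjagin_form_eq[OF A assms(2) gC C that])
  have LS: "?L c x v = ?S c x v" if c: "c \<in> A" "x \<in> img c" for c x v
  proof -
    have "triv_over (scale_tractor_bundle A) c = c" "triv_over (tangent_bundle A) c = c"
      using triv_over[of "scale_tractor_bundle A" A c] triv_over[of "tangent_bundle A" A c] c
      by (simp_all add: scale_tractor_bundle_def tangent_bundle_def)
    moreover have "trace_form (Suc m) (curvature (split_connection (g c)) x) v = trace_form (Suc m) (curvature (levi_civita (g c)) x) v"
      by (rule trace_form_split_connection[OF atlas_chart(2)[OF A c(1)] c(2) pseudo_riemannian_local(1)[OF g c(1)]
            pseudo_riemannian_local(3)[OF g c(1)]])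
    ultimately show ?thesis unfolding pontrjagin_form_eq m by simp
  qed
  have "?\<tau> \<in> closed_forms A (4 * k)"
    by (rule closed_forms_cong[OF A pontrjagin_form_closed[OF A connection_scale_tractor[OF A g]] \<tau>T])
  then have cl: "de_rham_class A (4 * k) ?\<tau> \<in> de_rham_cohomology A (4 * k)"
    by (simp add: de_rham_class_def de_rham_cohomology_def quotientI)
  have "(?S, ?T) \<in> cohomologous A (Suc r)"
    unfolding r[symmetric] by (rule chern_weil[OF A connection_split_connection[OF A g] connection_scale_tractor[OF A g] assms(4)])
  then have "(?S, ?\<tau>) \<in> cohomologous A (Suc r)"
    by (rule cohomologous_cong[OF A]) (rule \<tau>T)
  moreover have "(?S, ?L) \<in> cohomologous A (Suc r)"
  proof (rule cohomologous_cong[OF A])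
    show "(?S, ?S) \<in> cohomologous A (Suc r)"
      unfolding r[symmetric] by (rule chern_weil[OF A connection_split_connection[OF A g] connection_split_connection[OF A g] assms(4)])
  qed (rule LS)
  ultimately have \<tau>L: "de_rham_class A (4 * k) ?\<tau> = de_rham_class A (4 * k) ?L"
    unfolding r using de_rham_class_eqI[OF A] by metis
  have "pontrjagin_class A (tangent_bundle A) k = de_rham_class A (4 * k) ?L"
    unfolding pontrjagin_class_def
  proof (rule the_equality)
    show "\<exists>D. connection A (tangent_bundle A) D \<and> de_rham_class A (4 * k) ?L = de_rham_class A (4 * k) (pontrjagin_form (tangent_bundle A) D k)"
      using connection_levi_civita[OF A g] by blast
  next
    fix X assume "\<exists>D. connection A (tangent_bundle A) D \<and> X = de_rham_class A (4 * k) (pontrjagin_form (tangent_bundle A) D k)"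
    then obtain D where D: "connection A (tangent_bundle A) D"
      and X: "X = de_rham_class A (4 * k) (pontrjagin_form (tangent_bundle A) D k)" by blast
    have "(pontrjagin_form (tangent_bundle A) D k, ?L) \<in> cohomologous A (4 * k)"
      by (rule chern_weil[OF A D connection_levi_civita[OF A g] assms(4)])
    then show "X = de_rham_class A (4 * k) ?L"
      unfolding X r by (rule de_rham_class_eqI[OF A])
  qed
  then show ?thesis using cl \<tau>L by simp
qed

end
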